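(* Let $\lambda=(\lambda_1,\lambda_2,\dots)$ be a partition of $n$, let $T$ be the Young tableau of shape $2\lambda=(2\lambda_1,2\lambda_2,\dots)$ whose boxes are filled with $1,\dots,2n$ consecutively along the rows, and let $S=\{\{1,2\},\{3,4\},\dots,\{2n-1,2n\}\}$. Call a couple $(S_1,S_2)$ of pair-partitions of $[2n]$ $T$-admissible if the permutation $S\circ S_1$ preserves each column of $T$ and $S_2$ preserves each row of $T$ (permutations of $[2n]$ being viewed as permutations of the boxes of $T$). Then the zonal polynomial satisfies $$Z_\lambda=\sum_{(S_1,S_2)\ T\text{-admissible}} (-1)^{\mathcal{L}(S,S_1)}\, p_{\mathcal{L}(S_1,S_2)}.$$
   Context: A pair-partition of $[2n]=\{1,\dots,2n\}$ is a set of pairwise disjoint two-element subsets whose union is $[2n]$; it is identified with the fixed-point-free involution of $[2n]$ sending each element to its partner. For two pair-partitions $S_1,S_2$ of $[2n]$, $\mathcal{L}(S_1,S_2)$ is the bipartite graph with one black vertex for each pair of $S_1$, one white vertex for each pair of $S_2$, and, for each $i\in[2n]$, an edge labeled $i$ joining the pair of $S_1$ containing $i$ to the pair of $S_2$ containing $i$. Every vertex has degree 2, so $\mathcal{L}(S_1,S_2)$ is a disjoint union of loops of even lengths $2\ell_1\ge 2\ell_2\ge\cdots$; the partition $(\ell_1,\ell_2,\dots)$ is the type of $(S_1,S_2)$, and $|\mathcal{L}(S_1,S_2)|$ denotes the number of loops. The sign is $(-1)^{\mathcal{L}(S_1,S_2)}=(-1)^{n-|\mathcal{L}(S_1,S_2)|}$,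 and $p_{\mathcal{L}(S_1,S_2)}=p_{\ell_1}p_{\ell_2}\cdots$ is the power-sum symmetric function, $p_m=\sum_j z_j^m$. $Z_\lambda$ is the zonal polynomial in Macdonald's normalization (Macdonald, Symmetric functions and Hall polynomials, VII (2.13)); equivalently the Jack polynomial $J^{(2)}_\lambda$ in Macdonald's $J$-normalization. *)

theory Defs
  imports Complex_Main "HOL-Combinatorics.Permutations" "HOL-Library.Multiset"
begin

section \<open>Partitions and symmetric functions of degree n in the power-sum basis\<close>

text \<open>A partition is a weakly decreasing list of positive naturals.
  A homogeneous symmetric function of degree n (over the reals) is represented by its
  coefficient vector in the power-sum basis p_rho, rho ranging over partitions of n
  (a basis of the degree-n part of the ring of symmetric functions over Q).\<close>

definition is_partition :: "nat list \<Rightarrow> bool" where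
  "is_partition rho \<longleftrightarrow> sorted_wrt (\<ge>) rho \<and> 0 \<notin> set rho"

definition partitions :: "nat \<Rightarrow> nat list set" where
  "partitions n = {rho. is_partition rho \<and> sum_list rho = n}"

text \<open>Coefficient of the monomial x^mu (mu a partition) in p_rho.\<close>
definition p_to_m :: "nat list \<Rightarrow> nat list \<Rightarrow> nat" where
  "p_to_m rho mu = card {f \<in> {..<length rho} \<rightarrow>\<^sub>E {..<length mu}.
      \<forall>j<length mu. (\<Sum>i\<in>{i. i < length rho \<and> f i = j}. rho ! i) = mu ! j}"

text \<open>Coefficient of m_mu in the symmetric function with power-sum coefficients f.\<close>
definition mcoeff :: "nat \<Rightarrow> (nat list \<Rightarrow> real) \<Rightarrow> nat list \<Rightarrow> real" where
  "mcoeff n f mu = (\<Sum>rho\<in>partitions n. f rho * real (p_to_m rho mu))"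

definition zee :: "nat list \<Rightarrow> nat" where
  "zee rho = (\<Prod>i\<in>set rho. i ^ count_list rho i * fact (count_list rho i))"

text \<open>Scalar product with parameter alpha = 2: <p_rho,p_sigma> = delta 2^{l(rho)} z_rho.\<close>
definition inner2 :: "nat \<Rightarrow> (nat list \<Rightarrow> real) \<Rightarrow> (nat list \<Rightarrow> real) \<Rightarrow> real" where
  "inner2 n f g = (\<Sum>rho\<in>partitions n. f rho * g rho * 2 ^ length rho * real (zee rho))"

text \<open>Dominance order: mu \<le> lam.\<close>
definition dominated :: "nat list \<Rightarrow> nat list \<Rightarrow> bool" where
  "dominated mu lam \<longleftrightarrow> (\<forall>k. sum_list (take k mu) \<le> sum_list (take k lam))"

definition degree_vec :: "nat \<Rightarrow> (nat list \<Rightarrow> real) \<Rightarrow> bool" where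
  "degree_vec n f \<longleftrightarrow> (\<forall>rho. rho \<notin> partitions n \<longrightarrow> f rho = 0)"

text \<open>Characterisation of the Jack P-function P_lam^{(2)} (Macdonald VI (4.7)):
  P_lam = m_lam + (lower terms in dominance order), and P_lam is orthogonal to
  every m_mu with mu strictly dominated by lam (equivalently to every P_mu, mu < lam).\<close>
definition jackP_cond :: "nat list \<Rightarrow> (nat list \<Rightarrow> real) \<Rightarrow> bool" where
  "jackP_cond lam f \<longleftrightarrow> (let n = sum_list lam in
     degree_vec n f \<and>
     mcoeff n f lam = 1 \<and>
     (\<forall>mu\<in>partitions n. \<not> dominated mu lam \<longrightarrow> mcoeff n f mu = 0) \<and>
     (\<forall>g. degree_vec n g \<longrightarrow>
        (\<forall>mu\<in>partitions n. mcoeff n g mu \<noteq> 0 \<longrightarrow> dominated mu lam \<and> mu \<noteq> lam) \<longrightarrow>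
        inner2 n f g = 0))"

definition jackP2 :: "nat list \<Rightarrow> nat list \<Rightarrow> real" where
  "jackP2 lam = (THE f. jackP_cond lam f)"

text \<open>Conjugate part lam'_j (0-indexed column j).\<close>
definition conj_part :: "nat list \<Rightarrow> nat \<Rightarrow> nat" where
  "conj_part lam j = card {i. i < length lam \<and> j < lam ! i}"

text \<open>c_lam(alpha) = prod over boxes s of (alpha a(s) + l(s) + 1), at alpha = 2 (Macdonald VI (10.21)).\<close>
definition hook2 :: "nat list \<Rightarrow> real" where
  "hook2 lam = (\<Prod>(i,j)\<in>{(i,j). i < length lam \<and> j < lam ! i}.
      real (2 * (lam ! i - j - 1) + (conj_part lam j - i - 1) + 1))"

text \<open>Zonal polynomial Z_lam = J_lam^{(2)} = c_lam(2) P_lam^{(2)}, as power-sum coefficient vector.\<close>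
definition zonal :: "nat list \<Rightarrow> nat list \<Rightarrow> real" where
  "zonal lam = (\<lambda>rho. hook2 lam * jackP2 lam rho)"

section \<open>Pair-partitions, loops, tableau\<close>

definition pairpart :: "nat \<Rightarrow> (nat \<Rightarrow> nat) \<Rightarrow> bool" where
  "pairpart n f \<longleftrightarrow> f permutes {1..2*n} \<and> (\<forall>x\<in>{1..2*n}. f x \<noteq> x \<and> f (f x) = x)"

definition Sstd :: "nat \<Rightarrow> nat \<Rightarrow> nat" where
  "Sstd n i = (if i \<in> {1..2*n} then (if odd i then i + 1 else i - 1) else i)"

text \<open>Loops of L(S1,S2): classes of edge labels under the equivalence generated by S1 and S2.\<close>
definition loops :: "nat \<Rightarrow> (nat \<Rightarrow> nat) \<Rightarrow> (nat \<Rightarrow> nat) \<Rightarrow> nat set set" where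
  "loops n A B = {1..2*n} // (({(x, A x) | x. x \<in> {1..2*n}} \<union> {(x, B x) | x. x \<in> {1..2*n}})\<^sup>*)"

definition loop_type :: "nat \<Rightarrow> (nat \<Rightarrow> nat) \<Rightarrow> (nat \<Rightarrow> nat) \<Rightarrow> nat list" where
  "loop_type n A B = rev (sorted_list_of_multiset (image_mset (\<lambda>C. card C div 2) (mset_set (loops n A B))))"

definition loop_sign :: "nat \<Rightarrow> (nat \<Rightarrow> nat) \<Rightarrow> (nat \<Rightarrow> nat) \<Rightarrow> real" where
  "loop_sign n A B = (-1) ^ (n - card (loops n A B))"

text \<open>Tableau T of shape 2 lam filled consecutively along rows: row index (0-based) and
  column index (1-based) of the box containing k, for k in [2n].\<close>
definition rowT :: "nat list \<Rightarrow> nat \<Rightarrow> nat" where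
  "rowT lam k = (LEAST r. k \<le> 2 * sum_list (take (Suc r) lam))"

definition colT :: "nat list \<Rightarrow> nat \<Rightarrow> nat" where
  "colT lam k = k - 2 * sum_list (take (rowT lam k) lam)"

definition admissible :: "nat list \<Rightarrow> (nat \<Rightarrow> nat) \<Rightarrow> (nat \<Rightarrow> nat) \<Rightarrow> bool" where
  "admissible lam S1 S2 \<longleftrightarrow> (let n = sum_list lam in
     pairpart n S1 \<and> pairpart n S2 \<and>
     (\<forall>k\<in>{1..2*n}. colT lam ((Sstd n \<circ> S1) k) = colT lam k) \<and>
     (\<forall>k\<in>{1..2*n}. rowT lam (S2 k) = rowT lam k))"

end

theory Submission
  imports Defs "HOL-Library.Poly_Mapping"
begin

text \<open>An admissible \<open>S\<^sub>1\<close> is a family of permutations \<open>\<sigma>\<^sub>j\<close> of the columns of \<open>lam\<close>, with sign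
  \<open>\<Prod> sgn \<sigma>\<^sub>j\<close>, and the monomials of \<open>p\<close> of the loop type of \<open>(S\<^sub>1, S\<^sub>2)\<close> are the colourings of the
  boxes that are constant on loops. The three conditions characterising the Jack polynomial follow from
  looking at the sum over one of the two matchings for a fixed colouring.

  Orthogonality: the lower span is generated by the products \<open>e\<^sub>\<kappa>\<^sub>'\<close> of elementary symmetric functions, and
  pairing with \<open>e\<^sub>\<kappa>\<^sub>'\<close> weights colourings by \<open>(-2)\<close> to the number of loops. The sum over \<open>S\<^sub>2\<close> vanishes as soon
  as a row contains a colour more than twice, because rewiring four points produces \<open>(-2)\<^sup>2 + 2 (-2) = 0\<close>.

  Triangularity: the signed sum over \<open>S\<^sub>1\<close> vanishes unless the colours in each column are distinct.

  Normalisation: counting the matchings \<open>S\<^sub>2\<close> is Wick's formula, so the coefficient of \<open>m\<close> at \<open>lam\<close> is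
  \<open>E (\<Prod>\<^sub>j d\<^sub>j\<^sup>2)\<close>, where \<open>d\<^sub>j\<close> is the leading principal minor of a matrix of independent standard
  Gaussians whose size is the length of column \<open>j\<close>. Writing the largest \<open>d\<^sub>j\<^sup>2\<close> as a Gram determinant and
  integrating by parts row by row splits off the hook factors of one column at a time.\<close>

section \<open>Gaussian expectation on polynomials\<close>

text \<open>\<open>jackP2\<close> is a definite description, so besides the three conditions
  uniqueness is needed; it comes from the positive definiteness of the scalar product, while
  existence is supplied by the sum itself. The weight -2 of a loop is the factor 2 per part in the
  scalar product times the sign of a power sum in the expansion of elementary symmetric functions.
  The obstacle in the normalisation is that the minors share rows, so the expectation of the product
  of their squares does not factor. The integration by parts succeeds because a leading minor is
  killed when one of its rows is replaced by an earlier one. Derivatives that hit the shorter minors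
  then only count degrees: twice the arm comes from these degrees, and leg plus one from the Gram
  determinant. In the rewiring argument loops are not traced as cycles. Their number is read off
  from the number of two-colourings constant on loops, so that each surgery on matchings is a
  bijection between sets of functions.\<close>

fun match_num :: "nat \<Rightarrow> nat" where
  "match_num 0 = 1"
| "match_num (Suc 0) = 0"
| "match_num (Suc (Suc k)) = Suc k * match_num k"

text \<open>\<open>match_num k\<close> counts the perfect matchings of k points and is the k-th
  moment of a standard Gaussian. So this is the expectation of the monomial \<open>M\<close> in
  independent standard Gaussians.\<close>

definition wick :: "'v multiset \<Rightarrow> real" where
  "wick M = (\<Prod>v\<in>set_mset M. real (match_num (count M v)))"

lemma wick_superset: "finite A \<Longrightarrow> set_mset M \<subseteq> A \<Longrightarrow> wick M = (\<Prod>v\<in>A. real (match_num (count M v)))"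
  unfolding wick_def by (rule prod.mono_neutral_left) (auto simp: not_in_iff)

lemma wick_empty [simp]: "wick {#} = 1"
  by (simp add: wick_def)

text \<open>Integration by parts for one monomial: the new factor is paired with one of the equal
  factors of \<open>M\<close>. If there is none, both sides vanish.\<close>

lemma wick_add: "wick (add_mset v M) = real (count M v) * wick (M - {#v#})"
proof -
  let ?A = "insert v (set_mset M)"
  have 1: "wick (add_mset v M) = real (match_num (Suc (count M v))) * (\<Prod>u\<in>?A - {v}. real (match_num (count M u)))"
  proof -
    have "(\<Prod>u\<in>?A - {v}. real (match_num (count (add_mset v M) u))) = (\<Prod>u\<in>?A - {v}. real (match_num (count M u)))"
      by (rule prod.cong) auto
    then show ?thesis
      using prod.remove[of ?A v "\<lambda>u. real (match_num (count (add_mset v M) u))"] by (simp add: wick_def)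
  qed
  have "wick (M - {#v#}) = (\<Prod>u\<in>?A. real (match_num (count (M - {#v#}) u)))"
    by (rule wick_superset) (auto dest: in_diffD)
  also have "\<dots> = real (match_num (count M v - 1)) * (\<Prod>u\<in>?A - {v}. real (match_num (count M u)))"
  proof -
    have "(\<Prod>u\<in>?A - {v}. real (match_num (count (M - {#v#}) u))) = (\<Prod>u\<in>?A - {v}. real (match_num (count M u)))"
      by (rule prod.cong) auto
    then show ?thesis
      using prod.remove[of ?A v "\<lambda>u. real (match_num (count (M - {#v#}) u))"] by simp
  qed
  finally have 2: "wick (M - {#v#}) = \<dots>" .
  have "real (match_num (Suc k)) = real k * real (match_num (k - 1))" for k
    by (cases k) (auto simp: algebra_simps)
  then show ?thesis using 1 2 by simp
qed

text \<open>Addition of multisets is multiplication of monomials, so the convolution product of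
  \<open>Poly_Mapping\<close> is multiplication of polynomials in commuting variables.\<close>

type_synonym 'v mpol = "'v multiset \<Rightarrow>\<^sub>0 real"

definition mvar :: "'v \<Rightarrow> 'v mpol" where
  "mvar v = Poly_Mapping.single {#v#} 1"

definition gauss :: "'v mpol \<Rightarrow> real" where
  "gauss p = (\<Sum>m\<in>Poly_Mapping.keys p. Poly_Mapping.lookup p m * wick m)"

definition deriv :: "'v \<Rightarrow> 'v mpol \<Rightarrow> 'v mpol" where
  "deriv v p = (\<Sum>m\<in>Poly_Mapping.keys p.
     Poly_Mapping.single (m - {#v#}) (Poly_Mapping.lookup p m * real (count m v)))"

lemma gauss_add: "gauss (p + q) = gauss p + gauss q"
  unfolding gauss_def by (rule setsum_keys_plus_distrib) (auto simp: algebra_simps)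

lemma deriv_add: "deriv v (p + q) = deriv v p + deriv v q"
  unfolding deriv_def
  by (rule setsum_keys_plus_distrib) (auto simp: algebra_simps single_add)

lemma gauss_zero: "gauss 0 = 0"
  by (simp add: gauss_def)

lemma gauss_single: "gauss (Poly_Mapping.single m c) = c * wick m"
  by (cases "c = 0") (simp_all add: gauss_def)

lemma deriv_single: "deriv v (Poly_Mapping.single m c) = Poly_Mapping.single (m - {#v#}) (c * real (count m v))"
  by (cases "c = 0") (simp_all add: deriv_def)

lemma mpol_induct [case_names add single]:
  fixes p :: "'v mpol"
  assumes "\<And>p q. P p \<Longrightarrow> P q \<Longrightarrow> P (p + q)" "\<And>m c. P (Poly_Mapping.single m c)"
  shows "P p"
proof -
  have "P (\<Sum>m\<in>A. Poly_Mapping.single m (f m))" if "finite A" for A and f :: "'v multiset \<Rightarrow> real"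
    using that
  proof (induction A)
    case empty
    show ?case using assms(2)[of "{#}" 0] by simp
  qed (simp add: assms)
  moreover have "p = (\<Sum>m\<in>Poly_Mapping.keys p. Poly_Mapping.single m (Poly_Mapping.lookup p m))"
  proof (rule poly_mapping_eqI)
    fix k
    show "Poly_Mapping.lookup p k = Poly_Mapping.lookup (\<Sum>m\<in>Poly_Mapping.keys p. Poly_Mapping.single m (Poly_Mapping.lookup p m)) k"
      by (simp add: lookup_sum lookup_single when_def not_in_keys_iff_lookup_eq_zero)
  qed
  ultimately show ?thesis by (metis finite_keys)
qed

lemma additive_zero:
  fixes f :: "'a::ab_group_add \<Rightarrow> 'b::ab_group_add"
  shows "(\<And>p q. f (p + q) = f p + f q) \<Longrightarrow> f 0 = 0"
  by (metis add_cancel_right_right)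

lemma additive_minus:
  fixes f :: "'a::ab_group_add \<Rightarrow> 'b::ab_group_add"
  shows "(\<And>p q. f (p + q) = f p + f q) \<Longrightarrow> f (- p) = - f p"
  by (metis add.right_inverse additive_zero minus_unique)

lemma additive_sum:
  fixes f :: "'a::ab_group_add \<Rightarrow> 'b::ab_group_add"
  shows "(\<And>p q. f (p + q) = f p + f q) \<Longrightarrow> f (sum g A) = (\<Sum>x\<in>A. f (g x))"
  by (induction A rule: infinite_finite_induct) (auto simp: additive_zero[of f])

text \<open>Signs and multiplicities are the scalars that get pulled through \<open>gauss\<close>
  and through derivations, so additivity gives all the linearity required.\<close>

lemma additive_of_int:
  fixes f :: "'a::ring_1 \<Rightarrow> 'b::ring_1"
  assumes "\<And>p q. f (p + q) = f p + f q"
  shows "f (of_int k * p) = of_int k * f p"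
proof (induction k rule: int_induct[of _ 0])
  case base
  show ?case using additive_zero[of f] assms by simp
next
  case (step1 i)
  then show ?case by (simp add: algebra_simps assms)
next
  case (step2 i)
  have "f (of_int (i - 1) * p) = f (of_int i * p + - p)" by (simp add: algebra_simps)
  also have "\<dots> = f (of_int i * p) - f p"
    unfolding assms[of "of_int i * p"] using additive_minus[of f p, OF assms] by simp
  finally show ?case using step2 by (simp add: algebra_simps)
qed

lemmas gauss_sum = additive_sum[of gauss, OF gauss_add]
lemmas gauss_of_int = additive_of_int[of gauss, OF gauss_add]
text \<open>Gaussian integration by parts, E(x f) = E(f'); on monomials it is
  \<open>wick_add\<close>.\<close>

lemma gauss_ibp: "gauss (mvar v * p) = gauss (deriv v p)"
  by (induction p rule: mpol_induct)
    (simp_all add: distrib_left gauss_add deriv_add mvar_def mult_single deriv_single gauss_single wick_add)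

lemma deriv_mult: "deriv v (p * q) = deriv v p * q + p * deriv v q"
proof (induction p rule: mpol_induct)
  case (add p p')
  then show ?case by (simp add: deriv_add distrib_right)
next
  case (single m c)
  show ?case
  proof (induction q rule: mpol_induct)
    case (add q q')
    then show ?case by (simp add: deriv_add distrib_left)
  next
    case (single m' c')
    have *: "Poly_Mapping.single (m - {#v#} + m') (c * real (count m v) * c') =
      Poly_Mapping.single (m + m' - {#v#}) (c * real (count m v) * c')"
      by (cases "v \<in># m") (auto simp: not_in_iff)
    have **: "Poly_Mapping.single (m + (m' - {#v#})) (c * (c' * real (count m' v))) =
      Poly_Mapping.single (m + m' - {#v#}) (c * (c' * real (count m' v)))"
      by (cases "v \<in># m'") (auto simp: not_in_iff)
    show ?case
      by (simp add: deriv_single mult_single * ** flip: single_add) (simp add: algebra_simps)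
  qed
qed

lemma deriv_mvar: "deriv v (mvar u) = (if u = v then 1 else 0)"
  by (auto simp: mvar_def deriv_single simp flip: single_one)

lemma prod_mvar: "finite A \<Longrightarrow> (\<Prod>i\<in>A. mvar (g i)) = Poly_Mapping.single (image_mset g (mset_set A)) 1"
  by (induction A rule: finite_induct) (auto simp: mvar_def mult_single)

lemma gauss_prod_mvar: "finite A \<Longrightarrow> gauss (\<Prod>i\<in>A. mvar (g i)) = wick (image_mset g (mset_set A))"
  by (simp add: prod_mvar gauss_single)

section \<open>Derivations and the polarization of rows\<close>

locale derivation =
  fixes D :: "'a::comm_ring_1 \<Rightarrow> 'a"
  assumes add: "D (p + q) = D p + D q"
    and mult: "D (p * q) = D p * q + p * D q"
begin

lemma one: "D 1 = 0"
  using mult[of 1 1] by simp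

lemma sum: "D (\<Sum>x\<in>A. f x) = (\<Sum>x\<in>A. D (f x))"
  using add by (rule additive_sum)

lemma of_int_mult: "D (of_int k * p) = of_int k * D p"
  using add by (rule additive_of_int)

lemma prod: "finite A \<Longrightarrow> D (\<Prod>i\<in>A. f i) = (\<Sum>i\<in>A. D (f i) * (\<Prod>k\<in>A - {i}. f k))"
proof (induction A rule: finite_induct)
  case empty
  show ?case by (simp add: one)
next
  case (insert a A)
  have "(\<Prod>k\<in>insert a A - {i}. f k) = f a * (\<Prod>k\<in>A - {i}. f k)" if "i \<in> A" for i
    using that insert by (simp add: insert_Diff_if prod.insert) (auto simp: )
  then show ?case using insert
    by (simp add: mult sum_distrib_left algebra_simps)
qed

lemma prod_zero: "finite A \<Longrightarrow> (\<And>i. i \<in> A \<Longrightarrow> D (f i) = 0) \<Longrightarrow> D (\<Prod>i\<in>A. f i) = 0"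
  by (simp add: prod)

lemma prod_eigen:
  "finite A \<Longrightarrow> (\<And>i. i \<in> A \<Longrightarrow> D (f i) = w i * f i) \<Longrightarrow> D (\<Prod>i\<in>A. f i) = (\<Sum>i\<in>A. w i) * (\<Prod>i\<in>A. f i)"
  by (simp add: prod prod.remove sum_distrib_right mult.assoc)

end

text \<open>The polarization operator of Capelli's theory. The variables are the entries (row,
  column) of a matrix; row r is replaced by row s in one place at a time, within the first l
  columns. For s = r this is the Euler operator of the row.\<close>

definition polar :: "nat \<Rightarrow> nat \<Rightarrow> nat \<Rightarrow> (nat \<times> nat) mpol \<Rightarrow> (nat \<times> nat) mpol" where
  "polar l s r p = (\<Sum>c<l. mvar (s, c) * deriv (r, c) p)"

interpretation polar: derivation "polar l s r"
  by unfold_locales (simp_all add: polar_def deriv_add deriv_mult algebra_simps sum.distrib sum_distrib_left)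

lemma polar_mvar: "c < l \<Longrightarrow> polar l s r (mvar (i, c)) = (if i = r then mvar (s, c) else 0)"
  by (simp add: polar_def deriv_mvar if_distrib cong: if_cong)

lemma mpol_eq_minus_self: "p = - p \<Longrightarrow> p = 0" for p :: "'v mpol"
  by (metis poly_mapping_eqI lookup_uminus lookup_zero equation_minus_iff neg_equal_zero)

lemma permutes_lessThan_permutation: "p permutes {..<c::nat} \<Longrightarrow> permutation p"
  by (auto simp: permutation_permutes)

section \<open>Determinants of the first rows, with the columns selected by a function\<close>

definition minor :: "nat \<Rightarrow> (nat \<Rightarrow> nat) \<Rightarrow> (nat \<times> nat) mpol" where
  "minor c t = (\<Sum>\<sigma> | \<sigma> permutes {..<c}. of_int (sign \<sigma>) * (\<Prod>i<c. mvar (\<sigma> i, t i)))"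

text \<open>Two columns coincide; composing \<sigma> with their transposition reverses the sign and
  keeps each product.\<close>

lemma minor_not_inj:
  assumes "\<not> inj_on t {..<c}"
  shows "minor c t = 0"
proof -
  obtain a b where ab: "a < c" "b < c" "a \<noteq> b" "t a = t b"
    using assms by (auto simp: inj_on_def)
  let ?\<tau> = "transpose a b"
  have tp: "?\<tau> permutes {..<c}" using ab by (intro permutes_swap_id) auto
  have sg: "of_int (sign (\<sigma> \<circ> ?\<tau>)) = - (of_int (sign \<sigma>) :: (nat \<times> nat) mpol)" if "\<sigma> permutes {..<c}" for \<sigma>
    using that tp ab by (subst sign_compose) (auto simp: sign_swap_id intro: permutes_lessThan_permutation)
  have pr: "(\<Prod>i<c. mvar ((\<sigma> \<circ> ?\<tau>) i, t i)) = (\<Prod>i<c. mvar (\<sigma> i, t i))" for \<sigma>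
  proof -
    have "t (?\<tau> i) = t i" for i using ab by (auto simp: transpose_def)
    then have "(\<Prod>i<c. mvar ((\<sigma> \<circ> ?\<tau>) i, t i)) = (\<Prod>i<c. mvar (\<sigma> (?\<tau> i), t (?\<tau> i)))"
      by simp
    also have "\<dots> = (\<Prod>i<c. mvar (\<sigma> i, t i))"
      using prod.permute[OF tp, of "\<lambda>i. mvar (\<sigma> i, t i)"] by (simp add: o_def)
    finally show ?thesis .
  qed
  have "minor c t = (\<Sum>\<sigma> | \<sigma> permutes {..<c}. of_int (sign (\<sigma> \<circ> ?\<tau>)) * (\<Prod>i<c. mvar ((\<sigma> \<circ> ?\<tau>) i, t i)))"
    unfolding minor_def by (rule sum_permutations_compose_right[OF tp])
  also have "\<dots> = - minor c t"
    unfolding minor_def pr by (simp add: sg sum_negf)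
  finally show ?thesis by (rule mpol_eq_minus_self)
qed

lemma minor_perm:
  assumes t: "t permutes {..<c}"
  shows "minor c t = of_int (sign t) * minor c id"
proof -
  have ti: "inv t permutes {..<c}" using t by (rule permutes_inv)
  have "minor c t = (\<Sum>\<sigma> | \<sigma> permutes {..<c}. of_int (sign (\<sigma> \<circ> t)) * (\<Prod>i<c. mvar ((\<sigma> \<circ> t) i, t i)))"
    unfolding minor_def by (rule sum_permutations_compose_right[OF t])
  also have "\<dots> = (\<Sum>\<sigma> | \<sigma> permutes {..<c}. of_int (sign t) * (of_int (sign \<sigma>) * (\<Prod>i<c. mvar (\<sigma> i, i))))"
  proof (rule sum.cong)
    fix \<sigma> assume "\<sigma> \<in> {\<sigma>. \<sigma> permutes {..<c}}"
    then have "sign (\<sigma> \<circ> t) = sign t * sign \<sigma>"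
      using t by (subst sign_compose) (auto intro: permutes_lessThan_permutation)
    moreover have "(\<Prod>i<c. mvar ((\<sigma> \<circ> t) i, t i)) = (\<Prod>i<c. mvar (\<sigma> i, i))"
      using prod.permute[OF t, of "\<lambda>i. mvar (\<sigma> i, i)"] by (simp add: o_def)
    ultimately show "of_int (sign (\<sigma> \<circ> t)) * (\<Prod>i<c. mvar ((\<sigma> \<circ> t) i, t i)) = of_int (sign t) * (of_int (sign \<sigma>) * (\<Prod>i<c. mvar (\<sigma> i, i)))"
      by (simp add: mult.assoc)
  qed simp
  finally show ?thesis by (simp add: minor_def sum_distrib_left)
qed

text \<open>Passage to the transpose, so that each row has one factor for \<open>polar\<close> to
  act on.\<close>

lemma minor_id_rows:
  "minor c id = (\<Sum>t | t permutes {..<c}. of_int (sign t) * (\<Prod>i<c. mvar (i, t i)))"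
proof -
  have "minor c id = (\<Sum>t | t permutes {..<c}. of_int (sign (inv t)) * (\<Prod>i<c. mvar (inv t i, i)))"
    unfolding minor_def by (subst sum_permutations_inverse) simp
  also have "\<dots> = (\<Sum>t | t permutes {..<c}. of_int (sign t) * (\<Prod>i<c. mvar (i, t i)))"
  proof (rule sum.cong)
    fix t assume "t \<in> {t. t permutes {..<c}}"
    then have t: "t permutes {..<c}" by simp
    have "(\<Prod>i<c. mvar (inv t i, i)) = (\<Prod>i<c. mvar (i, t i))"
      using prod.permute[OF t, of "\<lambda>i. mvar (inv t i, i)"] permutes_inverses[OF t] by (simp add: o_def)
    then show "of_int (sign (inv t)) * (\<Prod>i<c. mvar (inv t i, i)) = of_int (sign t) * (\<Prod>i<c. mvar (i, t i))"
      using t by (simp add: sign_inverse permutes_lessThan_permutation)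
  qed simp
  finally show ?thesis .
qed

text \<open>An earlier row s in place of row r gives two equal rows, unless row r lies below the
  minor and there is nothing to replace; r in place of itself counts the degree, which is one. The
  bound \<open>c \<le> l\<close> lets the operator see every column of the minor. Products of
  leading minors thus behave like highest weight vectors.\<close>

lemma polar_minor:
  assumes "s \<le> r" "c \<le> l"
  shows "polar l s r (minor c id) = (if s = r \<and> r < c then minor c id else 0)"
proof -
  let ?t = "\<lambda>t i. (if i = r then s else i, t i)"
  have mono: "polar l s r (\<Prod>i<c. mvar (i, t i)) = (if r < c then \<Prod>i<c. mvar (if i = r then s else i, t i) else 0)"
    if t: "t permutes {..<c}" for t
  proof -
    have tl: "t i < l" if "i < c" for i
      using permutes_in_image[OF t, of i] that assms by simp
    have "polar l s r (\<Prod>i<c. mvar (i, t i)) =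
      (\<Sum>i<c. (if i = r then mvar (s, t i) else 0) * (\<Prod>k\<in>{..<c} - {i}. mvar (k, t k)))"
      by (subst polar.prod) (auto intro!: sum.cong simp: polar_mvar tl)
    also have "\<dots> = (\<Sum>i<c. if i = r then mvar (s, t i) * (\<Prod>k\<in>{..<c} - {i}. mvar (k, t k)) else 0)"
      by (rule sum.cong) auto
    also have "\<dots> = (if r < c then mvar (s, t r) * (\<Prod>k\<in>{..<c} - {r}. mvar (k, t k)) else 0)"
      by simp
    also have "\<dots> = (if r < c then \<Prod>i<c. mvar (if i = r then s else i, t i) else 0)"
    proof (cases "r < c")
      case True
      have "(\<Prod>i<c. mvar (if i = r then s else i, t i)) = mvar (s, t r) * (\<Prod>i\<in>{..<c}-{r}. mvar (if i = r then s else i, t i))"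
        using True by (subst prod.remove[of _ r]) auto
      also have "(\<Prod>i\<in>{..<c}-{r}. mvar (if i = r then s else i, t i)) = (\<Prod>k\<in>{..<c} - {r}. mvar (k, t k))"
        by (rule prod.cong) auto
      finally show ?thesis using True by simp
    qed simp
    finally show ?thesis .
  qed
  have main: "polar l s r (minor c id) =
    (\<Sum>t | t permutes {..<c}. of_int (sign t) * (if r < c then \<Prod>i<c. mvar (if i = r then s else i, t i) else 0))"
    unfolding minor_id_rows polar.sum by (rule sum.cong) (auto simp: polar.of_int_mult mono)
  show ?thesis
  proof (cases "r < c")
    case False
    then show ?thesis by (simp add: main)
  next
    case rc: True
    show ?thesis
    proof (cases "s = r")
      case True
      then have "(\<Prod>i<c. mvar (if i = r then s else i, t i)) = (\<Prod>i<c. mvar (i, t i))" for t :: "nat \<Rightarrow> nat"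
        by (intro prod.cong) auto
      then show ?thesis using rc True main by (simp add: minor_id_rows)
    next
      case False
      let ?\<tau> = "transpose s r" and ?u = "\<lambda>i. if i = r then s else i"
      have tp: "?\<tau> permutes {..<c}" using rc assms by (intro permutes_swap_id) auto
      have "polar l s r (minor c id) =
        (\<Sum>t | t permutes {..<c}. of_int (sign (t \<circ> ?\<tau>)) * (\<Prod>i<c. mvar (?u i, (t \<circ> ?\<tau>) i)))"
        unfolding main using rc by (subst sum_permutations_compose_right[OF tp]) simp
      also have "\<dots> = (\<Sum>t | t permutes {..<c}. - (of_int (sign t) * (\<Prod>i<c. mvar (?u i, t i))))"
      proof (rule sum.cong)
        fix t assume "t \<in> {t. t permutes {..<c}}"
        then have "sign (t \<circ> ?\<tau>) = - sign t"
          using tp False by (subst sign_compose) (auto simp: sign_swap_id intro: permutes_lessThan_permutation)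
        moreover have "?u (?\<tau> i) = ?u i" for i by (auto simp: transpose_def)
        then have "(\<Prod>i<c. mvar (?u i, (t \<circ> ?\<tau>) i)) = (\<Prod>i<c. mvar (?u i, t i))"
          using prod.permute[OF tp, of "\<lambda>i. mvar (?u i, t i)"] by (simp add: o_def)
        ultimately show "of_int (sign (t \<circ> ?\<tau>)) * (\<Prod>i<c. mvar (?u i, (t \<circ> ?\<tau>) i)) =
          - (of_int (sign t) * (\<Prod>i<c. mvar (?u i, t i)))" by simp
      qed simp
      also have "\<dots> = - polar l s r (minor c id)" using rc by (simp add: main sum_negf)
      finally have "polar l s r (minor c id) = 0" by (rule mpol_eq_minus_self)
      then show ?thesis using False by simp
    qed
  qed
qed

section \<open>Scalar products of rows and Gram determinants\<close>

definition ip :: "nat \<Rightarrow> nat \<Rightarrow> nat \<Rightarrow> (nat \<times> nat) mpol" where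
  "ip l i k = (\<Sum>c<l. mvar (i, c) * mvar (k, c))"

definition gram :: "nat \<Rightarrow> nat \<Rightarrow> (nat \<times> nat) mpol" where
  "gram l r = (\<Sum>\<sigma> | \<sigma> permutes {..<r}. of_int (sign \<sigma>) * (\<Prod>i<r. ip l i (\<sigma> i)))"

lemma polar_ip:
  "polar l s r (ip l i k) = (if i = r then ip l s k else 0) + (if k = r then ip l i s else 0)"
  unfolding ip_def by (simp add: polar.sum polar.mult polar_mvar sum.distrib sum_distrib_left)

text \<open>Integration by parts in the variables of row r; the factors from row b are not
  differentiated, as b differs from r.\<close>

lemma gauss_ip: "b < r \<Longrightarrow> gauss (ip l r b * p) = gauss (polar l b r p)"
  by (simp add: ip_def polar_def sum_distrib_right gauss_sum mult.assoc gauss_ibp deriv_mult deriv_mvar)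

text \<open>Now the second factor also lies in row r, and its derivatives contribute 1 for each of
  the l columns.\<close>

lemma gauss_ip_self: "gauss (ip l r r * p) = real l * gauss p + gauss (polar l r r p)"
  by (simp add: ip_def polar_def sum_distrib_right gauss_sum mult.assoc gauss_ibp deriv_mult deriv_mvar
      gauss_add sum.distrib)

abbreviation injs :: "nat \<Rightarrow> (nat \<Rightarrow> nat) set" where
  "injs m \<equiv> {t \<in> {..<m} \<rightarrow>\<^sub>E {..<m}. inj_on t {..<m}}"

text \<open>An injective self-map of a finite set is a permutation, so \<open>minor_perm\<close>
  extracts its sign and the remaining sum is the determinant once more. Extension by the identity
  translates extensional functions into \<open>permutes\<close>.\<close>

lemma sum_inj_minor:
  "(\<Sum>t\<in>injs l. (\<Prod>i<l. mvar (i, t i)) * minor l t) = minor l id * minor l id"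
proof -
  have "(\<Sum>t\<in>injs l. (\<Prod>i<l. mvar (i, t i)) * minor l t) =
    (\<Sum>t | t permutes {..<l}. (\<Prod>i<l. mvar (i, t i)) * (of_int (sign t) * minor l id))"
  proof (rule sum.reindex_bij_witness[of _ "\<lambda>t. restrict t {..<l}" "\<lambda>t i. if i < l then t i else i"])
    fix t assume t: "t \<in> injs l"
    let ?t = "\<lambda>i. if i < l then t i else i"
    show "restrict ?t {..<l} = t" using t by (auto simp: fun_eq_iff PiE_def extensional_def)
    have "bij_betw t {..<l} {..<l}"
      unfolding bij_betw_def using t by (intro conjI endo_inj_surj) auto
    then have "bij_betw ?t {..<l} {..<l}" by (rule bij_betw_cong[THEN iffD1, rotated]) auto
    then show p: "?t \<in> {t. t permutes {..<l}}" by (intro CollectI bij_imp_permutes) simp_all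
    have "minor l ?t = minor l t" by (simp add: minor_def)
    moreover have "minor l ?t = of_int (sign ?t) * minor l id" using p by (intro minor_perm) simp
    ultimately show "(\<Prod>i<l. mvar (i, ?t i)) * (of_int (sign ?t) * minor l id) = (\<Prod>i<l. mvar (i, t i)) * minor l t"
      by simp
  next
    fix t assume "t \<in> {t. t permutes {..<l}}"
    then have t: "t permutes {..<l}" by simp
    show "restrict t {..<l} \<in> injs l"
      using permutes_in_image[OF t] permutes_inj_on[OF t, of "{..<l}"] by (auto simp: inj_on_def)
    show "(\<lambda>i. if i < l then restrict t {..<l} i else i) = t"
      using permutes_not_in[OF t] by (auto simp: fun_eq_iff)
  qed
  also have "\<dots> = (\<Sum>t | t permutes {..<l}. of_int (sign t) * (\<Prod>i<l. mvar (i, t i))) * minor l id"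
    unfolding sum_distrib_right by (rule sum.cong) (simp_all only: mult_ac)
  finally show ?thesis by (simp only: minor_id_rows[symmetric])
qed

text \<open>Cauchy-Binet for a square matrix: expanding every scalar product chooses a column
  \<open>t i\<close> for each row i, and choices with a repeated column cancel.\<close>

lemma gram_eq_minor_sq: "gram l l = minor l id * minor l id"
proof -
  let ?T = "Pi\<^sub>E {..<l} (\<lambda>_. {..<l})"
  have "gram l l = (\<Sum>\<sigma> | \<sigma> permutes {..<l}. of_int (sign \<sigma>) * (\<Sum>t\<in>?T. \<Prod>i<l. mvar (i, t i) * mvar (\<sigma> i, t i)))"
    unfolding gram_def ip_def by (subst prod_sum_PiE) auto
  also have "\<dots> = (\<Sum>t\<in>?T. (\<Prod>i<l. mvar (i, t i)) * minor l t)"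
    unfolding minor_def sum_distrib_left
    by (subst sum.swap) (simp only: prod.distrib mult.left_commute)
  also have "\<dots> = (\<Sum>t\<in>injs l. (\<Prod>i<l. mvar (i, t i)) * minor l t)"
    by (rule sum.mono_neutral_right) (auto simp: finite_PiE minor_not_inj)
  also have "\<dots> = minor l id * minor l id" by (rule sum_inj_minor)
  finally show ?thesis .
qed

text \<open>Cayley's identity in probabilistic form: integrating by parts in row \<open>r\<close>, the terms that
  differentiate \<open>P\<close> only see its degree in that row, because \<open>P\<close> is killed when row \<open>r\<close> is replaced by
  an earlier one.\<close>

lemma gauss_gram_Suc:
  assumes low: "\<And>s. s < r \<Longrightarrow> polar l s r P = 0"
    and eig: "polar l r r P = of_nat m * P"
  shows "gauss (gram l (Suc r) * P) = (real l - real r + real m) * gauss (gram l r * P)"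
proof -
  let ?G = "\<lambda>p. (\<Prod>i<r. ip l i (p i)) * P"
  have perm_lt: "p i < r" if "p permutes {..<r}" "i < r" for p :: "nat \<Rightarrow> nat" and i
    using permutes_in_image[OF that(1), of i] that(2) by simp
  \<comment> \<open>Permutations of r + 1 rows are sorted by the image b of r. Since
    \<open>p\<close> fixes r, the factor \<open>ip l r b\<close> splits off.\<close>
  have split: "gram l (Suc r) * P = (\<Sum>b\<in>insert r {..<r}. \<Sum>p | p permutes {..<r}.
     of_int (sign (transpose r b \<circ> p)) * (ip l r b * ?G (transpose r b \<circ> p)))"
  proof -
    have "gram l (Suc r) * P = (\<Sum>b\<in>insert r {..<r}. \<Sum>p | p permutes {..<r}.
     of_int (sign (transpose r b \<circ> p)) * (\<Prod>i<Suc r. ip l i ((transpose r b \<circ> p) i))) * P"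
      unfolding gram_def lessThan_Suc by (subst sum_over_permutations_insert) auto
    also have "\<dots> = (\<Sum>b\<in>insert r {..<r}. \<Sum>p | p permutes {..<r}.
     of_int (sign (transpose r b \<circ> p)) * (ip l r b * ?G (transpose r b \<circ> p)))"
      unfolding sum_distrib_right
    proof (intro sum.cong refl)
      fix b p assume "p \<in> {p. p permutes {..<r}}"
      then have "p r = r" by (auto simp: permutes_not_in)
      then show "of_int (sign (transpose r b \<circ> p)) * (\<Prod>i<Suc r. ip l i ((transpose r b \<circ> p) i)) * P =
        of_int (sign (transpose r b \<circ> p)) * (ip l r b * ?G (transpose r b \<circ> p))"
        by (simp add: mult_ac)
    qed
    finally show ?thesis .
  qed
  have self: "gauss (ip l r r * ?G p) = (real l + real m) * gauss (?G p)" if p: "p permutes {..<r}" for p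
  proof -
    have "polar l r r (\<Prod>i<r. ip l i (p i)) = 0"
      by (rule polar.prod_zero) (use perm_lt[OF p] in \<open>auto simp: polar_ip\<close>)
    then have "polar l r r (?G p) = of_int (int m) * ?G p"
      by (simp add: polar.mult eig mult_ac)
    then show ?thesis by (simp only: gauss_ip_self gauss_of_int) (simp add: algebra_simps)
  qed
  \<comment> \<open>For \<open>p k = b\<close> the only factor containing row r is
    \<open>ip l k r\<close>. Putting row b in place of row r restores the product belonging to
    \<open>p\<close>, so each b below r contributes the same amount, with the sign of a
    transposition.\<close>
  have other: "gauss (ip l r b * ?G (transpose r b \<circ> p)) = gauss (?G p)"
    if p: "p permutes {..<r}" and b: "b < r" for p b
  proof -
    define k where "k = inv p b"
    have k: "k < r" "p k = b"
      using permutes_in_image[OF permutes_inv[OF p], of b] b permutes_inverses[OF p] by (auto simp: k_def)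
    have pk: "p i = b \<longleftrightarrow> i = k" for i using k p by (metis permutes_inverses(2))
    have val: "(transpose r b \<circ> p) i = (if i = k then r else p i)" if "i < r" for i
      using pk[of i] perm_lt[OF p that] by (auto simp: transpose_def)
    have "polar l b r (\<Prod>i<r. ip l i ((transpose r b \<circ> p) i)) =
      (\<Sum>i<r. polar l b r (ip l i ((transpose r b \<circ> p) i)) * (\<Prod>j\<in>{..<r} - {i}. ip l j ((transpose r b \<circ> p) j)))"
      by (rule polar.prod) simp
    also have "\<dots> = (\<Sum>i<r. if i = k then ip l k b * (\<Prod>j\<in>{..<r} - {k}. ip l j (p j)) else 0)"
    proof (rule sum.cong)
      fix i assume i: "i \<in> {..<r}"
      have "(\<Prod>j\<in>{..<r} - {k}. ip l j ((transpose r b \<circ> p) j)) = (\<Prod>j\<in>{..<r} - {k}. ip l j (p j))"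
        by (rule prod.cong) (use val in auto)
      moreover have "polar l b r (ip l i ((transpose r b \<circ> p) i)) = (if i = k then ip l k b else 0)"
        using i perm_lt[OF p, of i] unfolding polar_ip by (subst (1 2) val) auto
      ultimately show "polar l b r (ip l i ((transpose r b \<circ> p) i)) * (\<Prod>j\<in>{..<r} - {i}. ip l j ((transpose r b \<circ> p) j)) =
        (if i = k then ip l k b * (\<Prod>j\<in>{..<r} - {k}. ip l j (p j)) else 0)" by simp
    qed simp
    also have "\<dots> = (\<Prod>i<r. ip l i (p i))"
      using k by (simp add: prod.remove[of "{..<r}" k])
    finally show ?thesis using b by (simp add: gauss_ip polar.mult low)
  qed
  define S where "S = (\<Sum>p | p permutes {..<r}. of_int (sign p) * gauss (?G p))"
  have "gauss (gram l (Suc r) * P) = (\<Sum>b\<in>insert r {..<r}. \<Sum>p | p permutes {..<r}.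
     of_int (sign (transpose r b \<circ> p)) * gauss (ip l r b * ?G (transpose r b \<circ> p)))"
    unfolding split by (simp only: gauss_sum gauss_of_int)
  also have "\<dots> = (\<Sum>p | p permutes {..<r}. of_int (sign p) * gauss (ip l r r * ?G p)) +
    (\<Sum>b<r. \<Sum>p | p permutes {..<r}. - (of_int (sign p) * gauss (?G p)))"
  proof -
    have "of_int (sign (transpose r b \<circ> p)) * gauss (ip l r b * ?G (transpose r b \<circ> p)) =
      - (of_int (sign p) * gauss (?G p))" if "b < r" "p permutes {..<r}" for b p
      unfolding other[OF that(2,1)] using that
      by (subst sign_compose) (auto simp: sign_swap_id permutes_lessThan_permutation permutation_swap_id)
    then show ?thesis by simp
  qed
  also have "\<dots> = (real l - real r + real m) * S"
  proof -
    have "(\<Sum>p | p permutes {..<r}. of_int (sign p) * gauss (ip l r r * ?G p)) =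
      (\<Sum>p | p permutes {..<r}. (real l + real m) * (of_int (sign p) * gauss (?G p)))"
      by (rule sum.cong) (simp_all only: mem_Collect_eq self mult.left_commute)
    also have "\<dots> = (real l + real m) * S" by (simp only: S_def sum_distrib_left)
    finally have "(\<Sum>p | p permutes {..<r}. of_int (sign p) * gauss (ip l r r * ?G p)) = (real l + real m) * S" .
    moreover have "(\<Sum>b<r. \<Sum>p | p permutes {..<r}. - (of_int (sign p) * gauss (?G p))) = - (real r * S)"
      by (simp add: S_def sum_negf)
    ultimately show ?thesis by (simp add: left_diff_distrib distrib_right)
  qed
  also have "S = gauss (gram l r * P)"
    unfolding S_def gram_def by (simp only: sum_distrib_right gauss_sum gauss_of_int mult.assoc)
  finally show ?thesis .
qed

text \<open>The Gram determinant loses its rows from the last one on; row r leaves the factor l - r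
  + m r, where m r is the degree of \<open>P\<close> in that row.\<close>

lemma gauss_minor_sq:
  assumes "\<And>r s. s < r \<Longrightarrow> r < l \<Longrightarrow> polar l s r P = 0"
    and "\<And>r. r < l \<Longrightarrow> polar l r r P = of_nat (m r) * P"
  shows "gauss (minor l id * minor l id * P) = (\<Prod>r<l. real (l - r + m r)) * gauss P"
proof -
  have "gauss (gram l k * P) = (\<Prod>r<k. real (l - r + m r)) * gauss P" if "k \<le> l" for k
    using that
  proof (induction k)
    case 0
    show ?case by (simp add: gram_def)
  next
    case (Suc k)
    then show ?case using assms by (subst gauss_gram_Suc[where m = "m k"]) (auto simp: of_nat_diff)
  qed
  from this[of l] show ?thesis by (simp add: gram_eq_minor_sq)
qed

text \<open>The longest column is split off first, so that polarization within its
  \<open>c q\<close> columns acts on the remaining minors completely. Each remaining square that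
  contains row r has degree 2 in it.\<close>

lemma gauss_prod_minor_sq:
  fixes c :: "nat \<Rightarrow> nat"
  assumes dec: "\<And>j k. j \<le> k \<Longrightarrow> k < m \<Longrightarrow> c k \<le> c j"
  shows "gauss (\<Prod>j<m. minor (c j) id * minor (c j) id) =
    (\<Prod>j<m. \<Prod>r<c j. real (c j - r + 2 * card {k. j < k \<and> k < m \<and> r < c k}))"
proof -
  have "gauss (\<Prod>j\<in>{q..<m}. minor (c j) id * minor (c j) id) =
    (\<Prod>j\<in>{q..<m}. \<Prod>r<c j. real (c j - r + 2 * card {k. j < k \<and> k < m \<and> r < c k}))" if "q \<le> m" for q :: nat
    using that
  proof (induction q rule: inc_induct)
    case base
    show ?case using gauss_single[of "{#}" 1] by simp
  next
    case (step q)
    let ?P = "\<Prod>j\<in>{Suc q..<m}. minor (c j) id * minor (c j) id"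
    have pol: "polar (c q) s r ?P = of_nat (if s = r then 2 * card {k. q < k \<and> k < m \<and> r < c k} else 0) * ?P"
      if "s \<le> r" for s r
    proof -
      have "polar (c q) s r ?P = (\<Sum>j\<in>{Suc q..<m}. of_nat (if s = r \<and> r < c j then 2 else 0)) * ?P"
        by (rule polar.prod_eigen)
          (use that dec[of q] in \<open>auto simp: polar.mult polar_minor algebra_simps\<close>)
      also have "(\<Sum>j\<in>{Suc q..<m}. of_nat (if s = r \<and> r < c j then 2 else 0)) =
        (of_nat (\<Sum>j\<in>{Suc q..<m}. if s = r \<and> r < c j then 2 else 0) :: (nat \<times> nat) mpol)"
        by simp
      also have "(\<Sum>j\<in>{Suc q..<m}. if s = r \<and> r < c j then 2 else (0::nat)) =
        (if s = r then 2 * card {k. q < k \<and> k < m \<and> r < c k} else 0)"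
      proof -
        have "{Suc q..<m} \<inter> {j. r < c j} = {k. q < k \<and> k < m \<and> r < c k}" by auto
        then show ?thesis by (cases "s = r") (simp_all add: sum.If_cases)
      qed
      finally show ?thesis .
    qed
    have "gauss (minor (c q) id * minor (c q) id * ?P) =
      (\<Prod>r<c q. real (c q - r + 2 * card {k. q < k \<and> k < m \<and> r < c k})) * gauss ?P"
      by (rule gauss_minor_sq) (use pol in auto)
    then show ?case using step.IH step.hyps by (simp only: prod.atLeast_Suc_lessThan)
  qed
  from this[of 0] show ?thesis by (simp add: atLeast0LessThan)
qed

section \<open>Matchings and loops\<close>

text \<open>Values outside \<open>V\<close> are left open, so one function can be read as a matching
  of \<open>V\<close> and of each subset that it preserves.\<close>

definition matching_on :: "'a set \<Rightarrow> ('a \<Rightarrow> 'a) \<Rightarrow> bool" where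
  "matching_on V A \<longleftrightarrow> (\<forall>x\<in>V. A x \<in> V \<and> A x \<noteq> x \<and> A (A x) = x)"

lemma matching_onD:
  assumes "matching_on V A" "x \<in> V"
  shows "A x \<in> V" "A x \<noteq> x" "A (A x) = x"
  using assms by (auto simp: matching_on_def)

lemma matching_on_remove: "matching_on V A \<Longrightarrow> p \<in> V \<Longrightarrow> matching_on (V - {p, A p}) A"
  unfolding matching_on_def by (metis DiffD1 DiffD2 DiffI insertCI insertE singletonD)

lemma matching_on_even:
  assumes "finite V" "matching_on V A"
  shows "even (card V)"
  using assms
proof (induction "card V" arbitrary: V rule: less_induct)
  case less
  show ?case
  proof (cases "V = {}")
    case False
    then obtain p where p: "p \<in> V" by blast
    have q: "A p \<in> V" "A p \<noteq> p" using matching_onD[OF less.prems(2) p] by auto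
    have eq: "card V = card (V - {p, A p}) + 2"
      using card_Diff_subset[of "{p, A p}" V] card_mono[of V "{p, A p}"] p q less.prems(1) by auto
    have "even (card (V - {p, A p}))"
      by (rule less.hyps) (use eq less.prems p in \<open>auto intro: matching_on_remove\<close>)
    then show ?thesis using eq by simp
  qed simp
qed

section \<open>Loops and the colourings constant on them\<close>

definition loop_rel :: "'a set \<Rightarrow> ('a \<Rightarrow> 'a) \<Rightarrow> ('a \<Rightarrow> 'a) \<Rightarrow> 'a rel" where
  "loop_rel V A B = ({(x, A x) | x. x \<in> V} \<union> {(x, B x) | x. x \<in> V})\<^sup>*"

definition loop_set :: "'a set \<Rightarrow> ('a \<Rightarrow> 'a) \<Rightarrow> ('a \<Rightarrow> 'a) \<Rightarrow> 'a set set" where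
  "loop_set V A B = V // loop_rel V A B"

text \<open>Two uses: with two colours the cardinality encodes the number of loops, and with a
  prescribed content it is a coefficient of the power sum of the loop type.\<close>

definition invcol :: "'a set \<Rightarrow> 'c set \<Rightarrow> ('a \<Rightarrow> 'a) \<Rightarrow> ('a \<Rightarrow> 'a) \<Rightarrow> ('a \<Rightarrow> 'c) set" where
  "invcol V L A B = {f \<in> V \<rightarrow>\<^sub>E L. \<forall>v\<in>V. f (A v) = f v \<and> f (B v) = f v}"

text \<open>The generating steps are involutions, hence the closure is symmetric; points outside
  \<open>V\<close> form singleton classes.\<close>

lemma equiv_loop_rel:
  assumes "matching_on V A" "matching_on V B"
  shows "equiv UNIV (loop_rel V A B)"
proof -
  have "sym ({(x, A x) | x. x \<in> V} \<union> {(x, B x) | x. x \<in> V})"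
    using assms unfolding sym_def matching_on_def by fastforce
  then show ?thesis
    unfolding loop_rel_def by (intro equivI sym_rtrancl refl_rtrancl trans_rtrancl) auto
qed

lemma loop_rel_class_subset:
  assumes "matching_on V A" "matching_on V B" "v \<in> V"
  shows "loop_rel V A B `` {v} \<subseteq> V"
proof -
  have "(v, w) \<in> loop_rel V A B \<Longrightarrow> w \<in> V" for w
    unfolding loop_rel_def
    by (induction rule: rtrancl_induct) (use assms in \<open>auto simp: matching_on_def\<close>)
  then show ?thesis by blast
qed

lemma loop_rel_step:
  assumes "v \<in> V"
  shows "(v, A v) \<in> loop_rel V A B" "(v, B v) \<in> loop_rel V A B"
  using assms by (auto simp: loop_rel_def)

lemma invcol_loop_rel:
  assumes "f \<in> invcol V L A B" "(v, w) \<in> loop_rel V A B"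
  shows "f w = f v"
  using assms(2) unfolding loop_rel_def
  by (induction rule: rtrancl_induct) (use assms(1) in \<open>auto simp: invcol_def\<close>)

lemma loop_class_eq:
  assumes "matching_on V A" "matching_on V B" "v \<in> V" "C \<in> loop_set V A B"
  shows "loop_rel V A B `` {v} = C \<longleftrightarrow> v \<in> C"
  using equiv_loop_rel[OF assms(1,2)] assms(3,4) unfolding loop_set_def quotient_def
  by (auto simp: equiv_class_eq_iff equiv_def refl_on_def) (meson symE transE)+

lemma loop_set_subset:
  assumes "matching_on V A" "matching_on V B" "C \<in> loop_set V A B"
  shows "C \<subseteq> V"
  using loop_rel_class_subset[OF assms(1,2)] assms(3) by (force simp: loop_set_def quotient_def)

lemma finite_loop_set: "finite V \<Longrightarrow> finite (loop_set V A B)"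
  unfolding loop_set_def quotient_def by auto

lemma disjoint_loop_set:
  assumes "matching_on V A" "matching_on V B" "C \<in> loop_set V A B" "C' \<in> loop_set V A B" "C \<noteq> C'"
  shows "C \<inter> C' = {}"
  using loop_class_eq[OF assms(1,2)] loop_set_subset[OF assms(1,2)] assms(3-5) by blast

lemma Union_loop_set:
  assumes "matching_on V A" "matching_on V B"
  shows "\<Union>(loop_set V A B) = V"
proof
  show "\<Union>(loop_set V A B) \<subseteq> V" using loop_set_subset[OF assms] by blast
  show "V \<subseteq> \<Union>(loop_set V A B)"
    using equiv_class_self[OF equiv_loop_rel[OF assms]] by (auto simp: loop_set_def quotient_def)
qed

lemma loop_matching_on:
  assumes "matching_on V A" "matching_on V B" "C \<in> loop_set V A B"
  shows "matching_on C A"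
proof -
  have "A v \<in> C" if "v \<in> C" for v
  proof -
    have v: "v \<in> V" using loop_set_subset[OF assms] that by auto
    then have "loop_rel V A B `` {v} = C" using loop_class_eq[OF assms(1,2) v assms(3)] that by simp
    then show ?thesis using loop_rel_step(1)[OF v, of A B] by blast
  qed
  then show ?thesis using assms(1) loop_set_subset[OF assms] unfolding matching_on_def by blast
qed

lemma bij_betw_invcol:
  assumes A: "matching_on V A" and B: "matching_on V B"
  shows "bij_betw (\<lambda>g. \<lambda>v\<in>V. g (loop_rel V A B `` {v})) (loop_set V A B \<rightarrow>\<^sub>E L) (invcol V L A B)"
proof (rule bij_betwI[where g = "\<lambda>f. \<lambda>C\<in>loop_set V A B. f (SOME v. v \<in> C)"])
  let ?E = "loop_rel V A B"
  have eqv: "equiv UNIV ?E" by (rule equiv_loop_rel[OF A B])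
  have cl: "?E `` {v} \<in> loop_set V A B" if "v \<in> V" for v
    using that by (auto simp: loop_set_def quotient_def)
  have some: "(SOME v. v \<in> C) \<in> C" if "C \<in> loop_set V A B" for C
    using that eqv unfolding loop_set_def quotient_def
    by (metis (no_types, lifting) UN_E equiv_class_self UNIV_I singletonD someI)
  have eqA: "?E `` {A v} = ?E `` {v}" "?E `` {B v} = ?E `` {v}" if "v \<in> V" for v
    using loop_rel_step[OF that, where A = A and B = B] equiv_class_eq[OF eqv] by metis+
  show "(\<lambda>g. \<lambda>v\<in>V. g (?E `` {v})) \<in> (loop_set V A B \<rightarrow>\<^sub>E L) \<rightarrow> invcol V L A B"
    using A B cl eqA by (auto simp: invcol_def matching_on_def)
  show "(\<lambda>f. \<lambda>C\<in>loop_set V A B. f (SOME v. v \<in> C)) \<in> invcol V L A B \<rightarrow> (loop_set V A B \<rightarrow>\<^sub>E L)"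
    using some loop_set_subset[OF A B] by (fastforce simp: invcol_def)
  show "(\<lambda>C\<in>loop_set V A B. (\<lambda>v\<in>V. g (?E `` {v})) (SOME v. v \<in> C)) = g"
    if g: "g \<in> loop_set V A B \<rightarrow>\<^sub>E L" for g
  proof
    fix C
    show "(\<lambda>C\<in>loop_set V A B. (\<lambda>v\<in>V. g (?E `` {v})) (SOME v. v \<in> C)) C = g C"
    proof (cases "C \<in> loop_set V A B")
      case True
      then have V: "(SOME v. v \<in> C) \<in> V" using some loop_set_subset[OF A B] by blast
      have "?E `` {SOME v. v \<in> C} = C" using loop_class_eq[OF A B V True] some[OF True] by simp
      then show ?thesis using True V by simp
    qed (use g in auto)
  qed
  show "(\<lambda>v\<in>V. (\<lambda>C\<in>loop_set V A B. f (SOME v. v \<in> C)) (?E `` {v})) = f"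
    if f: "f \<in> invcol V L A B" for f
  proof
    fix v
    show "(\<lambda>v\<in>V. (\<lambda>C\<in>loop_set V A B. f (SOME v. v \<in> C)) (?E `` {v})) v = f v"
    proof (cases "v \<in> V")
      case True
      have "(v, SOME w. w \<in> ?E `` {v}) \<in> ?E" using some[OF cl[OF True]] by simp
      then show ?thesis using True cl[OF True] invcol_loop_rel[OF f] by simp
    qed (use f in \<open>auto simp: invcol_def\<close>)
  qed
qed

lemma card_invcol:
  assumes "finite V" "matching_on V A" "matching_on V B"
  shows "card (invcol V L A B) = card L ^ card (loop_set V A B)"
  using bij_betw_same_card[OF bij_betw_invcol[OF assms(2,3), of L]]
  by (simp add: card_PiE finite_loop_set assms(1))

text \<open>A loop adds its full even length to its colour class, while the loop type records half
  lengths. This is the origin of the factor 2 between the two contents.\<close>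

lemma card_invcol_content:
  assumes V: "finite V" and A: "matching_on V A" and B: "matching_on V B"
  shows "card {f \<in> invcol V L A B. \<forall>j\<in>L. card {v \<in> V. f v = j} = 2 * b j} =
    card {g \<in> loop_set V A B \<rightarrow>\<^sub>E L. \<forall>j\<in>L. (\<Sum>C\<in>{C \<in> loop_set V A B. g C = j}. card C div 2) = b j}"
proof -
  define r where "r = (\<lambda>g :: 'a set \<Rightarrow> 'b. \<lambda>v\<in>V. g (loop_rel V A B `` {v}))"
  have bij: "bij_betw r (loop_set V A B \<rightarrow>\<^sub>E L) (invcol V L A B)"
    unfolding r_def by (rule bij_betw_invcol[OF A B])
  have "card {v \<in> V. r g v = j} = 2 * (\<Sum>C\<in>{C \<in> loop_set V A B. g C = j}. card C div 2)" for g :: "'a set \<Rightarrow> 'b" and j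
  proof -
    have "{v \<in> V. r g v = j} = \<Union>{C \<in> loop_set V A B. g C = j}"
    proof (intro set_eqI iffI)
      fix v assume "v \<in> {v \<in> V. r g v = j}"
      then have v: "v \<in> V" "g (loop_rel V A B `` {v}) = j" by (auto simp: r_def)
      then have "loop_rel V A B `` {v} \<in> loop_set V A B" by (auto simp: loop_set_def quotient_def)
      then show "v \<in> \<Union>{C \<in> loop_set V A B. g C = j}" using loop_class_eq[OF A B v(1)] v by blast
    next
      fix v assume "v \<in> \<Union>{C \<in> loop_set V A B. g C = j}"
      then show "v \<in> {v \<in> V. r g v = j}"
        using loop_class_eq[OF A B] loop_set_subset[OF A B] by (auto simp: r_def)
    qed
    also have "card \<dots> = (\<Sum>C\<in>{C \<in> loop_set V A B. g C = j}. card C)"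
      by (rule card_Union_disjoint)
        (use disjoint_loop_set[OF A B] finite_subset[OF loop_set_subset[OF A B] V] in \<open>auto simp: pairwise_def disjnt_def\<close>)
    also have "\<dots> = (\<Sum>C\<in>{C \<in> loop_set V A B. g C = j}. 2 * (card C div 2))"
    proof (rule sum.cong)
      fix C assume "C \<in> {C \<in> loop_set V A B. g C = j}"
      then have "even (card C)"
        using loop_matching_on[OF A B] loop_set_subset[OF A B] V by (blast intro: matching_on_even finite_subset)
      then show "card C = 2 * (card C div 2)" by simp
    qed simp
    finally show ?thesis by (simp add: sum_distrib_left)
  qed
  note cnt = this
  let ?G = "{g \<in> loop_set V A B \<rightarrow>\<^sub>E L. \<forall>j\<in>L. (\<Sum>C\<in>{C \<in> loop_set V A B. g C = j}. card C div 2) = b j}"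
  have "inj_on r ?G"
    using bij by (auto simp: bij_betw_def intro: inj_on_subset)
  then have "card (r ` ?G) = card ?G" by (rule card_image)
  moreover have "r ` ?G = {f \<in> invcol V L A B. \<forall>j\<in>L. card {v \<in> V. f v = j} = 2 * b j}"
    unfolding bij_betw_imp_surj_on[OF bij, symmetric] by (auto simp: cnt)
  ultimately show ?thesis by argo
qed

section \<open>Contracting edges of the second matching\<close>

lemma invcol_contract_loop:
  assumes V: "finite V" "finite L" and A: "matching_on V A" and B: "matching_on V B" and p: "p \<in> V" "A p = B p"
  shows "card (invcol V L A B) = card L * card (invcol (V - {p, B p}) L A B)"
proof -
  let ?V = "V - {p, B p}"
  have q: "B p \<in> V" "A (B p) = p" "B (B p) = p" "B p \<noteq> p"
    using matching_onD[OF A p(1)] matching_onD[OF B p(1)] p(2) by auto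
  have A': "A v \<in> ?V" "B v \<in> ?V" if "v \<in> ?V" for v
    using that matching_onD(1)[OF matching_on_remove[OF A p(1)], of v] matching_onD(1)[OF matching_on_remove[OF B p(1)], of v]
    by (simp_all add: p(2))
  have "bij_betw (\<lambda>(y, g). g(p := y, B p := y)) (L \<times> invcol ?V L A B) (invcol V L A B)"
  proof (rule bij_betwI[where g = "\<lambda>f. (f p, restrict f ?V)"])
    show "(\<lambda>(y, g). g(p := y, B p := y)) \<in> L \<times> invcol ?V L A B \<rightarrow> invcol V L A B"
      using A' p q by (auto simp: invcol_def PiE_def Pi_def extensional_def)
    show "(\<lambda>f. (f p, restrict f ?V)) \<in> invcol V L A B \<rightarrow> L \<times> invcol ?V L A B"
      using A' p q by (auto simp: invcol_def PiE_def Pi_def extensional_def)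
    show "(\<lambda>f. (f p, restrict f ?V)) ((\<lambda>(y, g). g(p := y, B p := y)) z) = z" if "z \<in> L \<times> invcol ?V L A B" for z
      using that q by (cases z) (auto simp: fun_eq_iff invcol_def PiE_def extensional_def)
    show "(\<lambda>(y, g). g(p := y, B p := y)) (f p, restrict f ?V) = f" if "f \<in> invcol V L A B" for f
      using that q p by (auto simp: fun_eq_iff invcol_def PiE_def extensional_def)
  qed
  from bij_betw_same_card[OF this] show ?thesis by (simp add: card_cartesian_product)
qed

lemma matching_on_contract:
  assumes A: "matching_on V A" and p: "p \<in> V" "q \<in> V" "p \<noteq> q" "A p \<noteq> q"
  shows "matching_on (V - {p, q}) (A(A p := A q, A q := A p))"
  unfolding matching_on_def
proof
  note m = matching_onD[OF A]
  fix v assume "v \<in> V - {p, q}"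
  then have v: "v \<in> V" "v \<noteq> p" "v \<noteq> q" by auto
  have "A p \<noteq> A q" "A p \<noteq> p" "A q \<noteq> q" "A q \<noteq> p" using m p by metis+
  moreover have "A v \<noteq> p \<and> A v \<noteq> q \<and> A v \<noteq> A p \<and> A v \<noteq> A q" if "v \<noteq> A p" "v \<noteq> A q"
    using m v p that by metis
  ultimately show "(A(A p := A q, A q := A p)) v \<in> V - {p, q} \<and> (A(A p := A q, A q := A p)) v \<noteq> v \<and>
    (A(A p := A q, A q := A p)) ((A(A p := A q, A q := A p)) v) = v"
    using m v p by (cases "v = A p"; cases "v = A q") auto
qed

text \<open>The edge from \<open>p\<close> to \<open>B p\<close> is deleted and the
  \<open>A\<close>-partners of its ends are joined. The colour at both ends is dictated by the one
  at \<open>A p\<close>, so restriction loses nothing.\<close>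

lemma invcol_contract_path:
  assumes A: "matching_on V A" and B: "matching_on V B" and p: "p \<in> V" "A p \<noteq> B p"
  shows "card (invcol V L A B) = card (invcol (V - {p, B p}) L (A(A p := A (B p), A (B p) := A p)) B)"
proof -
  define q where "q = B p"
  define A' where "A' = A(A p := A q, A q := A p)"
  let ?V = "V - {p, q}"
  have q0: "q \<in> V" "B q = p" "q \<noteq> p" "A p \<noteq> q"
    using matching_onD[OF B p(1)] p(2) unfolding q_def by auto
  note q = q0 matching_onD[OF A p(1)] matching_onD[OF A q0(1)]
  have q': "A q \<noteq> p" "A p \<noteq> A q" using q by metis+
  note q = q q'
  have B': "B v \<in> ?V" if "v \<in> ?V" for v
    using that matching_onD(1)[OF matching_on_remove[OF B p(1)], of v] by (simp add: q_def)
  have A': "A' v \<in> ?V" if "v \<in> ?V" for v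
    using that matching_onD(1)[OF matching_on_contract[OF A p(1) q0(1) q0(3)[symmetric] q0(4)], of v]
    by (simp add: A'_def)
  have Av: "A v \<in> ?V" if "v \<in> ?V" "v \<noteq> A p" "v \<noteq> A q" for v
    using that matching_onD[OF A, of v] q by auto
  have "bij_betw (\<lambda>f. restrict f ?V) (invcol V L A B) (invcol ?V L A' B)"
  proof (rule bij_betwI[where g = "\<lambda>g. g(p := g (A p), q := g (A p))"])
    show "(\<lambda>f. restrict f ?V) \<in> invcol V L A B \<rightarrow> invcol ?V L A' B"
    proof (intro funcsetI)
      fix f assume f: "f \<in> invcol V L A B"
      have fA: "f (A v) = f v" "f (B v) = f v" if "v \<in> V" for v using f that by (auto simp: invcol_def)
      have "f (A p) = f p" "f (A q) = f q" "f q = f p" using fA[OF p(1)] fA[OF q(1)] by (auto simp: q_def)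
      then have "f (A' v) = f v" if "v \<in> ?V" for v
        using fA[of v] that q by (auto simp: A'_def)
      then show "restrict f ?V \<in> invcol ?V L A' B"
        using f fA A' B' by (auto simp: invcol_def)
    qed
    show "(\<lambda>g. g(p := g (A p), q := g (A p))) \<in> invcol ?V L A' B \<rightarrow> invcol V L A B"
    proof (intro funcsetI)
      fix g assume g: "g \<in> invcol ?V L A' B"
      have gA: "g (A' v) = g v" "g (B v) = g v" if "v \<in> ?V" for v using g that by (auto simp: invcol_def)
      have "A p \<in> ?V" using q by auto
      then have gpq: "g (A q) = g (A p)" using gA(1)[of "A p"] q by (auto simp: A'_def)
      let ?f = "g(p := g (A p), q := g (A p))"
      have "?f (A v) = ?f v" if v: "v \<in> V" for v
      proof (cases "v \<in> {p, q, A p, A q}")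
        case True
        then show ?thesis using q gpq by auto
      next
        case False
        then show ?thesis using gA(1)[of v] v Av[of v] by (auto simp: A'_def)
      qed
      moreover have "?f (B v) = ?f v" if v: "v \<in> V" for v
        using gA(2)[of v] B'[of v] v q by (cases "v \<in> ?V") (auto simp: q_def)
      moreover have "?f \<in> V \<rightarrow>\<^sub>E L"
        using g p q by (auto simp: invcol_def PiE_def Pi_def extensional_def)
      ultimately show "?f \<in> invcol V L A B" by (auto simp: invcol_def)
    qed
    show "(restrict f ?V)(p := restrict f ?V (A p), q := restrict f ?V (A p)) = f" if f: "f \<in> invcol V L A B" for f
    proof -
      have fA: "f (A v) = f v" "f (B v) = f v" if "v \<in> V" for v using f that by (auto simp: invcol_def)
      have "f (A p) = f p" "f q = f p" using fA[OF p(1)] by (auto simp: q_def)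
      then show ?thesis using f q p by (auto simp: fun_eq_iff invcol_def PiE_def extensional_def)
    qed
    show "restrict (g(p := g (A p), q := g (A p))) ?V = g" if "g \<in> invcol ?V L A' B" for g
      using that by (auto simp: fun_eq_iff invcol_def PiE_def extensional_def)
  qed
  from bij_betw_same_card[OF this] show ?thesis by (simp add: A'_def q_def)
qed

lemma invcol_cong:
  assumes "\<And>v. v \<in> V \<Longrightarrow> A v = A' v" "\<And>v. v \<in> V \<Longrightarrow> B v = B' v"
  shows "invcol V L A B = invcol V L A' B'"
  using assms by (auto simp: invcol_def)

text \<open>Contracting the edges of the second matching outside \<open>Q\<close> leaves a matching of \<open>Q\<close> that no
  longer depends on how \<open>Q\<close> itself is matched.\<close>

lemma invcol_reduce:
  assumes "finite V" "finite L" "matching_on V A" "Q \<subseteq> V" "matching_on (V - Q) B"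
  shows "\<exists>k A'. matching_on Q A' \<and>
    ((\<forall>v\<in>V. s (A v) \<noteq> (s v :: bool)) \<longrightarrow> (\<forall>v\<in>V - Q. s (B v) \<noteq> s v) \<longrightarrow> (\<forall>v\<in>Q. s (A' v) \<noteq> s v)) \<and>
    (\<forall>M. matching_on Q M \<longrightarrow>
      card (invcol V L A (\<lambda>v. if v \<in> Q then M v else B v)) = card L ^ k * card (invcol Q L A' M))"
  using assms
proof (induction "card V" arbitrary: V A rule: less_induct)
  case less
  let ?alt = "\<lambda>V A A'. (\<forall>v\<in>V. s (A v) \<noteq> s v) \<longrightarrow> (\<forall>v\<in>V - Q. s (B v) \<noteq> s v) \<longrightarrow> (\<forall>v\<in>Q. s (A' v) \<noteq> s v)"
  note A = less.prems(3) and B = less.prems(5)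
  show ?case
  proof (cases "V = Q")
    case True
    have "invcol Q L A (\<lambda>v. if v \<in> Q then M v else B v) = invcol Q L A M" for M
      by (rule invcol_cong) auto
    then show ?thesis using A True by (intro exI[of _ 0] exI[of _ A]) auto
  next
    case False
    then obtain p where p: "p \<in> V" "p \<notin> Q" using less.prems(4) by blast
    define q where "q = B p"
    have q: "q \<in> V" "q \<notin> Q" "q \<noteq> p" using matching_onD[OF B, of p] p by (auto simp: q_def)
    let ?V = "V - {p, q}" and ?B = "\<lambda>M v. if v \<in> Q then M v else B v"
    have card: "card ?V < card V" using p less.prems(1) by (intro psubset_card_mono) auto
    have QV: "Q \<subseteq> ?V" using less.prems(4) p q by auto
    have B': "matching_on (?V - Q) B"
    proof -
      have "?V - Q = V - Q - {p, B p}" by (auto simp: q_def)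
      then show ?thesis using matching_on_remove[OF B, of p] p by simp
    qed
    have BM: "matching_on V (?B M)" if "matching_on Q M" for M
      using that B less.prems(4) unfolding matching_on_def by auto
    have sB: "s q \<noteq> s p" if "\<forall>v\<in>V - Q. s (B v) \<noteq> s v" using that p by (auto simp: q_def)
    show ?thesis
    proof (cases "A p = q")
      case True
      \<comment> \<open>The removed pair is a loop by itself and accounts for one factor
        \<open>card L\<close>.\<close>
      have A': "matching_on ?V A" using matching_on_remove[OF A p(1)] True by simp
      obtain k A' where k: "matching_on Q A'"
        "?alt ?V A A'"
        "\<And>M. matching_on Q M \<Longrightarrow> card (invcol ?V L A (?B M)) = card L ^ k * card (invcol Q L A' M)"
        using less.hyps[OF card _ less.prems(2) A' QV B'] less.prems(1) by blast
      have "card (invcol V L A (?B M)) = card L ^ Suc k * card (invcol Q L A' M)" if M: "matching_on Q M" for M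
        using invcol_contract_loop[OF less.prems(1,2) A BM[OF M] p(1)] True k(3)[OF M] p(2) by (simp add: q_def)
      note kM = this
      have ks: "?alt V A A'"
        using k(2) by blast
      show ?thesis
        by (rule exI[of _ "Suc k"], rule exI[of _ A'], rule conjI[OF k(1) conjI[OF ks]], rule allI, rule impI, rule kM)
    next
      case False
      let ?A = "A(A p := A q, A q := A p)"
      have A': "matching_on ?V ?A" using matching_on_contract[OF A p(1) q(1)] q(3) False by simp
      obtain k A' where k: "matching_on Q A'"
        "?alt ?V ?A A'"
        "\<And>M. matching_on Q M \<Longrightarrow> card (invcol ?V L ?A (?B M)) = card L ^ k * card (invcol Q L A' M)"
        using less.hyps[OF card _ less.prems(2) A' QV B'] less.prems(1) by blast
      have "card (invcol V L A (?B M)) = card L ^ k * card (invcol Q L A' M)" if M: "matching_on Q M" for M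
        using invcol_contract_path[OF A BM[OF M] p(1), of L] False k(3)[OF M] p(2) by (simp add: q_def)
      note kM = this
      \<comment> \<open>The alternation survives the contraction: p and q carry opposite values of
        \<open>s\<close>, hence so do their partners \<open>A p\<close> and \<open>A q\<close>,
        which are now joined.\<close>
      have "s (?A v) \<noteq> s v" if "\<forall>v\<in>V. s (A v) \<noteq> s v" "\<forall>v\<in>V - Q. s (B v) \<noteq> s v" "v \<in> ?V" for v
        using that(1)[rule_format, of p] that(1)[rule_format, of q] that(1)[rule_format, of v] sB[OF that(2)] p q that(3)
        by auto
      moreover have "s (B v) \<noteq> s v" if "\<forall>v\<in>V - Q. s (B v) \<noteq> s v" "v \<in> ?V - Q" for v
        using that by blast
      ultimately have ks: "?alt V A A'"
        using k(2) by blast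
      show ?thesis
        by (rule exI[of _ k], rule exI[of _ A'], rule conjI[OF k(1) conjI[OF ks]], rule allI, rule impI, rule kM)
    qed
  qed
qed

lemma invcol_empty: "invcol {} L A B = {\<lambda>_. undefined}"
  by (auto simp: invcol_def)

lemma invcol_pair:
  assumes "finite L" "u \<noteq> w" "A u = w" "A w = u" "B u = w" "B w = u"
  shows "card (invcol {u, w} L A B) = card L"
proof -
  have "{u, w} - {u, B u} = {}" using assms by auto
  then show ?thesis
    using invcol_contract_loop[of "{u, w}" L A B u] assms by (simp add: matching_on_def invcol_empty)
qed

lemma invcol_four_same:
  assumes "finite L" and d: "distinct [a, x, c, d]" and "A a = x" "A x = a" "A c = d" "A d = c"
    "B a = x" "B x = a" "B c = d" "B d = c"
  shows "card (invcol {a, x, c, d} L A B) = card L ^ 2"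
proof -
  have "matching_on {a, x, c, d} A" "matching_on {a, x, c, d} B"
    using assms by (auto simp: matching_on_def)
  moreover have "{a, x, c, d} - {a, B a} = {c, d}" using assms by auto
  ultimately show ?thesis
    using invcol_contract_loop[of "{a, x, c, d}" L A B a] invcol_pair[of L c d A B] assms
    by (simp add: power2_eq_square)
qed

lemma invcol_four_diff:
  assumes "finite L" and d: "distinct [a, x, c, d]" and "A a = x" "A x = a" "A c = d" "A d = c"
    "B a = c" "B c = a" "B x = d" "B d = x"
  shows "card (invcol {a, x, c, d} L A B) = card L"
proof -
  have "matching_on {a, x, c, d} A" "matching_on {a, x, c, d} B"
    using assms by (auto simp: matching_on_def)
  moreover have "{a, x, c, d} - {a, B a} = {x, d}" using assms by auto
  ultimately show ?thesis
    using invcol_contract_path[of "{a, x, c, d}" A B a L] assms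
      invcol_pair[of L x d "A(A a := A (B a), A (B a) := A a)" B] by simp
qed

lemma matching_on_four:
  assumes "distinct [a, x, c, d]" "matching_on {a, x, c, d} A"
  shows "A a = x \<and> A x = a \<and> A c = d \<and> A d = c \<or> A a = c \<and> A c = a \<and> A x = d \<and> A d = x \<or>
    A a = d \<and> A d = a \<and> A x = c \<and> A c = x"
proof -
  have m: "A a \<in> {x, c, d}" "A (A a) = a" "A x \<in> {a, c, d}" "A (A x) = x" "A c \<in> {a, x, d}" "A (A c) = c"
    "A d \<in> {a, x, c}" "A (A d) = d"
    using assms(2) by (auto simp: matching_on_def)
  from m(1) consider "A a = x" | "A a = c" | "A a = d" by blast
  then show ?thesis
  proof cases
    case 1
    then show ?thesis using m(2-) assms(1) by auto
  next
    case 2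
    then show ?thesis using m(2-) assms(1) by auto
  next
    case 3
    then show ?thesis using m(2-) assms(1) by auto
  qed
qed

section \<open>Rewiring a matching at four points\<close>

definition conj_fun :: "'a \<Rightarrow> 'a \<Rightarrow> ('a \<Rightarrow> 'a) \<Rightarrow> 'a \<Rightarrow> 'a" where
  "conj_fun x y B = transpose x y \<circ> B \<circ> transpose x y"

lemma conj_fun_conj_fun: "conj_fun x y (conj_fun x y B) = B"
  by (auto simp: conj_fun_def fun_eq_iff)

lemma conj_fun_commute: "conj_fun x y B = conj_fun y x B"
  by (simp add: conj_fun_def transpose_commute)

lemma matching_on_conj_fun:
  "matching_on V B \<Longrightarrow> x \<in> V \<Longrightarrow> y \<in> V \<Longrightarrow> matching_on V (conj_fun x y B)"
  unfolding matching_on_def conj_fun_def by (auto simp: transpose_def)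

text \<open>Conjugation by the transposition of \<open>B a\<close> with \<open>c\<close>, or with
  \<open>B c\<close>, yields the two other matchings of the points \<open>a\<close>,
  \<open>B a\<close>, \<open>c\<close>, \<open>B c\<close> and changes nothing elsewhere. After
  contraction to these points \<open>A\<close> becomes one of the three matchings, which has two
  loops with itself and one with each of the others. For the second claim \<open>s\<close>
  alternates along the contracted matching, which therefore cannot join \<open>a\<close> to
  \<open>c\<close>; so n0 and n2 differ by one.\<close>

lemma loop_set_rewire:
  fixes s :: "'a \<Rightarrow> bool"
  assumes V: "finite V" and A: "matching_on V A" and B: "matching_on V B"
    and a: "a \<in> V" and c: "c \<in> V" "c \<noteq> a" "c \<noteq> B a"
  defines "n0 \<equiv> card (loop_set V A B)" and "n1 \<equiv> card (loop_set V A (conj_fun (B a) c B))"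
    and "n2 \<equiv> card (loop_set V A (conj_fun (B a) (B c) B))"
  shows "\<exists>k. (n0, n1, n2) \<in> {(k + 2, k + 1, k + 1), (k + 1, k + 2, k + 1), (k + 1, k + 1, k + 2)}"
    and "\<forall>v\<in>V. s (A v) \<noteq> s v \<Longrightarrow> \<forall>v\<in>V. s (B v) \<noteq> s v \<Longrightarrow> s a = s c \<Longrightarrow> odd (n0 + n2)"
proof -
  define x d where "x = B a" and "d = B c"
  let ?Q = "{a, x, c, d}" and ?L = "{..<2::nat}"
  let ?B1 = "conj_fun x c B" and ?B2 = "conj_fun x d B"
  have V4: "x \<in> V" "d \<in> V" "B x = a" "B d = c" "B a = x" "B c = d" "x \<noteq> a" "d \<noteq> c" "c \<noteq> a" "c \<noteq> x"
    using matching_onD[OF B a] matching_onD[OF B c(1)] c by (simp_all add: x_def d_def)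
  then have "d \<noteq> a" "d \<noteq> x" by metis+
  then have dist: "distinct [a, x, c, d]" using V4(7-10) by auto
  then have dist': "x \<noteq> a" "c \<noteq> a" "d \<noteq> a" "c \<noteq> x" "d \<noteq> x" "d \<noteq> c" by auto
  have QV: "?Q \<subseteq> V" using V4 a c by auto
  have BQ: "matching_on (V - ?Q) B"
  proof -
    have "V - ?Q = V - {a, B a} - {c, B c}" using V4 by auto
    moreover have "matching_on (V - {a, B a} - {c, B c}) B"
      by (intro matching_on_remove B a) (use c in auto)
    ultimately show ?thesis by simp
  qed
  obtain k A' where k: "matching_on ?Q A'"
    "(\<forall>v\<in>V. s (A v) \<noteq> s v) \<longrightarrow> (\<forall>v\<in>V - ?Q. s (B v) \<noteq> s v) \<longrightarrow> (\<forall>v\<in>?Q. s (A' v) \<noteq> s v)"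
    "\<And>M. matching_on ?Q M \<Longrightarrow> card (invcol V ?L A (\<lambda>v. if v \<in> ?Q then M v else B v)) = card ?L ^ k * card (invcol ?Q ?L A' M)"
    using invcol_reduce[OF V _ A QV BQ, of ?L s] by blast
  \<comment> \<open>With two colours the number of loops is the exponent of a power of 2.\<close>
  have red: "2 ^ card (loop_set V A M) = 2 ^ k * card (invcol ?Q ?L A' M)"
    if "matching_on V M" "matching_on ?Q M" "\<And>v. v \<in> V - ?Q \<Longrightarrow> M v = B v" for M
  proof -
    have "invcol V ?L A (\<lambda>v. if v \<in> ?Q then M v else B v) = invcol V ?L A M"
      by (rule invcol_cong) (use that(3) in auto)
    then show ?thesis using card_invcol[OF V A that(1), of ?L] k(3)[OF that(2)] by simp
  qed
  have vals: "?B1 a = c" "?B1 c = a" "?B1 x = d" "?B1 d = x" "?B2 a = d" "?B2 d = a" "?B2 c = x" "?B2 x = c"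
    using V4 dist by (auto simp: conj_fun_def)
  have out: "?B1 v = B v" "?B2 v = B v" if "v \<in> V - ?Q" for v
    using matching_onD(1)[OF BQ that] that by (auto simp: conj_fun_def transpose_def)
  have B0: "matching_on ?Q B" using V4 dist by (auto simp: matching_on_def)
  have M1: "matching_on V ?B1" "matching_on ?Q ?B1" and M2: "matching_on V ?B2" "matching_on ?Q ?B2"
    using matching_on_conj_fun[OF B] matching_on_conj_fun[OF B0] V4 c by auto
  have red0: "2 ^ n0 = 2 ^ k * card (invcol ?Q ?L A' B)"
    unfolding n0_def by (rule red) (use B B0 in auto)
  have red1: "2 ^ n1 = 2 ^ k * card (invcol ?Q ?L A' ?B1)"
    unfolding n1_def x_def[symmetric] by (rule red) (use M1 out in auto)
  have red2: "2 ^ n2 = 2 ^ k * card (invcol ?Q ?L A' ?B2)"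
    unfolding n2_def x_def[symmetric] d_def[symmetric] by (rule red) (use M2 out in auto)
  have pw: "2 ^ n = 2 ^ k * (2::nat) ^ i \<Longrightarrow> n = k + i" for n i
    by (simp flip: power_add)
  consider (0) "A' a = x" "A' x = a" "A' c = d" "A' d = c" | (1) "A' a = c" "A' c = a" "A' x = d" "A' d = x"
    | (2) "A' a = d" "A' d = a" "A' x = c" "A' c = x"
    using matching_on_four[OF dist k(1)] by blast
  then have *: "(n0, n1, n2) = (k + 2, k + 1, k + 1) \<or> (n0, n1, n2) = (k + 1, k + 2, k + 1) \<and> A' a = c \<or>
    (n0, n1, n2) = (k + 1, k + 1, k + 2)"
  proof cases
    case 0
    have "card (invcol ?Q ?L A' B) = 2 ^ 2"
      using invcol_four_same[of ?L a x c d A' B] dist dist' 0 V4 by simp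
    moreover have "card (invcol ?Q ?L A' ?B1) = 2 ^ 1"
      using invcol_four_diff[of ?L a x c d A' ?B1] dist dist' 0 vals by simp
    moreover have "card (invcol ?Q ?L A' ?B2) = 2 ^ 1"
      using invcol_four_diff[of ?L a x d c A' ?B2] dist dist' 0 vals by (simp add: insert_commute)
    ultimately show ?thesis using red0 red1 red2 pw by metis
  next
    case 1
    have "card (invcol ?Q ?L A' ?B1) = 2 ^ 2"
      using invcol_four_same[of ?L a c x d A' ?B1] dist dist' 1 vals by (simp add: insert_commute)
    moreover have "card (invcol ?Q ?L A' B) = 2 ^ 1"
      using invcol_four_diff[of ?L a c x d A' B] dist dist' 1 V4 by (simp add: insert_commute)
    moreover have "card (invcol ?Q ?L A' ?B2) = 2 ^ 1"
      using invcol_four_diff[of ?L a c d x A' ?B2] dist dist' 1 vals by (simp add: insert_commute)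
    ultimately show ?thesis using red0 red1 red2 pw 1(1) by metis
  next
    case 2
    have "card (invcol ?Q ?L A' ?B2) = 2 ^ 2"
      using invcol_four_same[of ?L a d x c A' ?B2] dist dist' 2 vals by (simp add: insert_commute)
    moreover have "card (invcol ?Q ?L A' B) = 2 ^ 1"
      using invcol_four_diff[of ?L a d x c A' B] dist dist' 2 V4 by (simp add: insert_commute)
    moreover have "card (invcol ?Q ?L A' ?B1) = 2 ^ 1"
      using invcol_four_diff[of ?L a d c x A' ?B1] dist dist' 2 vals by (simp add: insert_commute)
    ultimately show ?thesis using red0 red1 red2 pw by metis
  qed
  then show "\<exists>k. (n0, n1, n2) \<in> {(k + 2, k + 1, k + 1), (k + 1, k + 2, k + 1), (k + 1, k + 1, k + 2)}"
    by blast
  show "odd (n0 + n2)" if "\<forall>v\<in>V. s (A v) \<noteq> s v" "\<forall>v\<in>V. s (B v) \<noteq> s v" "s a = s c"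
  proof -
    have "s (A' a) \<noteq> s a" using k(2) that(1,2) by blast
    then have "A' a \<noteq> c" using that(3) by metis
    then show ?thesis using * by auto
  qed
qed

lemma card_invcol_self:
  assumes "finite V" "finite L" "matching_on V A"
  shows "card (invcol V L A A) = card L ^ (card V div 2)"
  using assms
proof (induction "card V" arbitrary: V rule: less_induct)
  case less
  show ?case
  proof (cases "V = {}")
    case False
    then obtain p where p: "p \<in> V" by blast
    have q: "A p \<in> V" "A p \<noteq> p" using matching_onD[OF less.prems(3) p] by auto
    have eq: "card V = card (V - {p, A p}) + 2"
      using card_Diff_subset[of "{p, A p}" V] card_mono[of V "{p, A p}"] p q less.prems(1) by auto
    have "card (invcol (V - {p, A p}) L A A) = card L ^ (card (V - {p, A p}) div 2)"
      by (rule less.hyps) (use eq less.prems p in \<open>auto intro: matching_on_remove\<close>)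
    then show ?thesis
      using invcol_contract_loop[OF less.prems(1,2,3,3) p] eq by simp
  qed (simp add: invcol_empty)
qed

text \<open>Each pair is a loop by itself; for the standard matching this gives sign 1, the base
  case of the sign computation.\<close>

lemma card_loop_set_self:
  assumes "finite V" "matching_on V A"
  shows "card (loop_set V A A) = card V div 2"
  using card_invcol_self[OF assms(1) _ assms(2), of "{..<2::nat}"] card_invcol[OF assms(1,2,2), of "{..<2::nat}"] by simp

section \<open>Matchings that preserve the level sets of a function\<close>

definition matchings :: "'a set \<Rightarrow> ('a \<Rightarrow> 'a) set" where
  "matchings V = {B. B permutes V \<and> (\<forall>x\<in>V. B x \<noteq> x \<and> B (B x) = x)}"

definition respecting :: "'a set \<Rightarrow> ('a \<Rightarrow> 'b) \<Rightarrow> ('a \<Rightarrow> 'a) set" where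
  "respecting V h = {B \<in> matchings V. \<forall>v\<in>V. h (B v) = h v}"

lemma finite_matchings: "finite V \<Longrightarrow> finite (matchings V)"
  unfolding matchings_def by (rule finite_subset[OF _ finite_permutations]) auto

lemma finite_respecting: "finite V \<Longrightarrow> finite (respecting V h)"
  unfolding respecting_def using finite_matchings[of V] by simp

lemma matchings_iff: "B \<in> matchings V \<longleftrightarrow> matching_on V B \<and> (\<forall>x. x \<notin> V \<longrightarrow> B x = x)"
proof
  assume B: "B \<in> matchings V"
  then have "B permutes V" by (simp add: matchings_def)
  then show "matching_on V B \<and> (\<forall>x. x \<notin> V \<longrightarrow> B x = x)"
    using B permutes_in_image[of B V] by (simp add: matchings_def matching_on_def permutes_not_in)
next
  assume B: "matching_on V B \<and> (\<forall>x. x \<notin> V \<longrightarrow> B x = x)"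
  have "bij_betw B V V"
    by (rule bij_betw_byWitness[where f' = B]) (use B in \<open>auto simp: matching_on_def\<close>)
  then have "B permutes V" using B by (intro bij_imp_permutes) auto
  then show "B \<in> matchings V" using B by (simp add: matchings_def matching_on_def)
qed

lemma respecting_matching_on: "B \<in> respecting V h \<Longrightarrow> matching_on V B"
  by (simp add: respecting_def matchings_iff)

lemma conj_fun_respecting:
  assumes "B \<in> respecting V h" "x \<in> V" "y \<in> V" "h x = h y"
  shows "conj_fun x y B \<in> respecting V h"
proof -
  have m: "matching_on V B" and o: "\<And>v. v \<notin> V \<Longrightarrow> B v = v" and h: "\<And>v. v \<in> V \<Longrightarrow> h (B v) = h v"
    using assms(1) by (auto simp: respecting_def matchings_iff)
  have t: "h (transpose x y v) = h v" for v using assms(4) by (simp add: transpose_def)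
  have "transpose x y v \<in> V" if "v \<in> V" for v using that assms(2,3) by (simp add: transpose_def)
  then have "h (conj_fun x y B v) = h v" if "v \<in> V" for v
    using that by (simp add: conj_fun_def t h)
  moreover have "conj_fun x y B v = v" if "v \<notin> V" for v
  proof -
    have "v \<noteq> x" "v \<noteq> y" using that assms(2,3) by auto
    then show ?thesis using o[OF that] by (simp add: conj_fun_def)
  qed
  ultimately show ?thesis
    using matching_on_conj_fun[OF m assms(2,3)] by (simp add: respecting_def matchings_iff)
qed

text \<open>Averaging over the three ways to match the four points \<open>a\<close>, \<open>B a\<close>, \<open>c\<close>, \<open>B c\<close>:
  the loop numbers are \<open>k + 2\<close>, \<open>k + 1\<close>, \<open>k + 1\<close>, and \<open>(-2)\<^sup>2 + 2 (-2) = 0\<close>.\<close>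

lemma sum_respecting_loops_eq_0:
  assumes V: "finite V" and A: "matching_on V A" and big: "card {v \<in> V. h v = z} \<ge> 3"
  shows "(\<Sum>B\<in>respecting V h. (-2 :: real) ^ card (loop_set V A B)) = 0"
proof -
  define C where "C = {v \<in> V. h v = z}"
  define w where "w = (\<lambda>B. (-2 :: real) ^ card (loop_set V A B))"
  have C: "finite C" "C \<subseteq> V" using V by (auto simp: C_def)
  obtain a where a: "a \<in> C" using big by (fastforce simp: C_def[symmetric] card_eq_0_iff)
  then have aV: "a \<in> V" using C by auto
  \<comment> \<open>A further point c in the class of a is marked. Each \<open>B\<close> admits
    \<open>card C - 2\<close> such points, a positive number that does not depend on
    \<open>B\<close>, so it suffices that the marked sum vanishes.\<close>
  define P where "P = Sigma (respecting V h) (\<lambda>B. C - {a, B a})"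
  \<comment> \<open>Both rewirings become involutions of \<open>P\<close>: \<phi> marks the old
    partner of a, and \<psi> keeps c, whose new partner is the old partner of a.\<close>
  define \<phi> where "\<phi> = (\<lambda>(B, c). (conj_fun (B a) c B, B a))"
  define \<psi> where "\<psi> = (\<lambda>(B, c). (conj_fun (B a) (B c) B, c))"
  have facts: "B a \<in> C" "B c \<in> C" "B a \<noteq> a" "B c \<noteq> c" "B (B a) = a" "B (B c) = c" "c \<noteq> a" "c \<noteq> B a" "c \<in> C"
    "B a \<in> V" "B c \<in> V" "c \<in> V" "B c \<noteq> a" "B c \<noteq> B a"
    if "(B, c) \<in> P" for B c
  proof -
    have B: "B \<in> respecting V h" and c: "c \<in> C" "c \<noteq> a" "c \<noteq> B a" using that by (auto simp: P_def)
    have c': "c \<in> V" using c C by auto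
    note ma = matching_onD[OF respecting_matching_on[OF B] aV] and mc = matching_onD[OF respecting_matching_on[OF B] c']
    have "h (B a) = h a" "h (B c) = h c" using B aV c' by (auto simp: respecting_def)
    then show "B a \<in> C" "B c \<in> C" using ma mc a c by (simp_all add: C_def)
    show "B a \<noteq> a" "B c \<noteq> c" "B (B a) = a" "B (B c) = c" "c \<noteq> a" "c \<noteq> B a" "c \<in> C"
      "B a \<in> V" "B c \<in> V" "c \<in> V" using ma mc c c' by auto
    show "B c \<noteq> a" using mc(3) c(3) by metis
    show "B c \<noteq> B a" using mc(3) ma(3) c(2) by metis
  qed
  have phi: "\<phi> p \<in> P \<and> \<phi> (\<phi> p) = p" if "p \<in> P" for p
  proof -
    obtain B c where p: "p = (B, c)" by force
    note f = facts[OF that[unfolded p]]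
    have B: "B \<in> respecting V h" using that p by (auto simp: P_def)
    have "conj_fun (B a) c B \<in> respecting V h"
      using f by (intro conj_fun_respecting[OF B]) (auto simp: C_def)
    moreover have v: "conj_fun (B a) c B a = c"
      using f by (simp add: conj_fun_def transpose_def)
    ultimately have "\<phi> p \<in> P" using f by (auto simp: \<phi>_def p P_def)
    moreover have "\<phi> (\<phi> p) = p"
      by (simp add: \<phi>_def p v conj_fun_commute[of c] conj_fun_conj_fun)
    ultimately show ?thesis by simp
  qed
  have psi: "\<psi> p \<in> P \<and> \<psi> (\<psi> p) = p" if "p \<in> P" for p
  proof -
    obtain B c where p: "p = (B, c)" by force
    note f = facts[OF that[unfolded p]]
    have B: "B \<in> respecting V h" using that p by (auto simp: P_def)
    have "conj_fun (B a) (B c) B \<in> respecting V h"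
      using f by (intro conj_fun_respecting[OF B]) (auto simp: C_def)
    moreover have v: "conj_fun (B a) (B c) B a = B c" "conj_fun (B a) (B c) B c = B a"
      using f by (auto simp: conj_fun_def transpose_def)
    ultimately have "\<psi> p \<in> P" using f by (auto simp: \<psi>_def p P_def)
    moreover have "\<psi> (\<psi> p) = p"
      by (simp add: \<psi>_def p v conj_fun_commute[of "B c"] conj_fun_conj_fun)
    ultimately show ?thesis by simp
  qed
  have zero: "w (fst p) + w (fst (\<phi> p)) + w (fst (\<psi> p)) = 0" if "p \<in> P" for p
  proof -
    obtain B c where p: "p = (B, c)" by force
    note f = facts[OF that[unfolded p]]
    have B: "matching_on V B" using that p by (auto simp: P_def respecting_matching_on)
    obtain k where "(card (loop_set V A B), card (loop_set V A (conj_fun (B a) c B)), card (loop_set V A (conj_fun (B a) (B c) B)))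
      \<in> {(k + 2, k + 1, k + 1), (k + 1, k + 2, k + 1), (k + 1, k + 1, k + 2)}"
      using loop_set_rewire(1)[OF V A B aV, of c] f by auto
    then show ?thesis by (auto simp: p \<phi>_def \<psi>_def w_def)
  qed
  have "(\<Sum>p\<in>P. w (fst p)) = (\<Sum>p\<in>P. w (fst (\<phi> p)))"
    by (rule sum.reindex_bij_witness[of _ \<phi> \<phi>]) (use phi in auto)
  moreover have "(\<Sum>p\<in>P. w (fst p)) = (\<Sum>p\<in>P. w (fst (\<psi> p)))"
    by (rule sum.reindex_bij_witness[of _ \<psi> \<psi>]) (use psi in auto)
  ultimately have "3 * (\<Sum>p\<in>P. w (fst p)) = (\<Sum>p\<in>P. w (fst p) + w (fst (\<phi> p)) + w (fst (\<psi> p)))"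
    by (simp add: sum.distrib)
  then have "(\<Sum>p\<in>P. w (fst p)) = 0" by (simp add: zero)
  moreover have "(\<Sum>p\<in>P. w (fst p)) = (\<Sum>B\<in>respecting V h. \<Sum>c\<in>C - {a, B a}. w B)"
    unfolding P_def using C by (subst sum.Sigma) (auto simp: finite_respecting[OF V] case_prod_unfold)
  moreover have "card (C - {a, B a}) = card C - 2" if B: "B \<in> respecting V h" for B
  proof -
    have "B a \<in> C" using B a C by (auto simp: respecting_def matchings_iff matching_on_def C_def)
    moreover have "B a \<noteq> a" using matching_onD[OF respecting_matching_on[OF B] aV] by simp
    ultimately show ?thesis using a C by (simp add: card_Diff_subset)
  qed
  ultimately have "real (card C - 2) * (\<Sum>B\<in>respecting V h. w B) = 0"
    by (simp add: sum_distrib_left)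
  then show ?thesis using big by (simp add: C_def w_def)
qed

text \<open>Choosing the partner of one point among the others with the same value of
  \<open>h\<close> reproduces the recursion \<open>wick_add\<close>. This is Wick's formula.\<close>

lemma card_respecting:
  assumes "finite V"
  shows "real (card (respecting V h)) = wick (image_mset h (mset_set V))"
  using assms
proof (induction "card V" arbitrary: V rule: less_induct)
  case less
  show ?case
  proof (cases "V = {}")
    case True
    then have "respecting V h = {id}" by (auto simp: respecting_def matchings_def)
    then show ?thesis using True by simp
  next
    case False
    then obtain a where a: "a \<in> V" by blast
    define N where "N = {b \<in> V - {a}. h b = h a}"
    have N: "finite N" using less.prems by (simp add: N_def)
    let ?M = "image_mset h (mset_set (V - {a}))"
    have bij: "card {B \<in> respecting V h. B a = b} = card (respecting (V - {a, b}) h)" if b: "b \<in> N" for b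
    proof (rule bij_betw_same_card[OF bij_betwI[where f = "\<lambda>B. B(a := a, b := b)" and g = "\<lambda>B. B(a := b, b := a)"]])
      have ab: "a \<in> V" "b \<in> V" "a \<noteq> b" "h b = h a" using a b by (auto simp: N_def)
      show "(\<lambda>B. B(a := a, b := b)) \<in> {B \<in> respecting V h. B a = b} \<rightarrow> respecting (V - {a, b}) h"
      proof (intro funcsetI)
        fix B assume B: "B \<in> {B \<in> respecting V h. B a = b}"
        then have "matching_on (V - {a, b}) B"
          using matching_on_remove[OF respecting_matching_on ab(1), of B h] by auto
        then show "B(a := a, b := b) \<in> respecting (V - {a, b}) h"
          using B by (auto simp: respecting_def matchings_iff matching_on_def)
      qed
      show "(\<lambda>B. B(a := b, b := a)) \<in> respecting (V - {a, b}) h \<rightarrow> {B \<in> respecting V h. B a = b}"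
        using ab by (auto simp: respecting_def matchings_iff matching_on_def)
      show "(B(a := a, b := b))(a := b, b := a) = B" if "B \<in> {B \<in> respecting V h. B a = b}" for B
        using that ab by (auto simp: fun_eq_iff respecting_def matchings_iff matching_on_def)
      show "(B(a := b, b := a))(a := a, b := b) = B" if "B \<in> respecting (V - {a, b}) h" for B
        using that ab by (auto simp: fun_eq_iff respecting_def matchings_iff)
    qed
    have "respecting V h = (\<Union>b\<in>N. {B \<in> respecting V h. B a = b})"
      using a by (auto simp: respecting_def matchings_iff matching_on_def N_def)
    then have "card (respecting V h) = card (\<Union>b\<in>N. {B \<in> respecting V h. B a = b})" by simp
    also have "\<dots> = (\<Sum>b\<in>N. card {B \<in> respecting V h. B a = b})"
      by (rule card_UN_disjoint) (use N finite_subset[OF _ finite_respecting[OF less.prems, of h]] in auto)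
    finally have "real (card (respecting V h)) = (\<Sum>b\<in>N. real (card (respecting (V - {a, b}) h)))"
      by (simp add: bij)
    also have "\<dots> = (\<Sum>b\<in>N. wick (?M - {#h a#}))"
    proof (rule sum.cong)
      fix b assume b: "b \<in> N"
      then have bV: "b \<in> V - {a}" "h b = h a" by (auto simp: N_def)
      have "card (V - {a, b}) < card V" using a less.prems by (intro psubset_card_mono) auto
      then have "real (card (respecting (V - {a, b}) h)) = wick (image_mset h (mset_set (V - {a, b})))"
        using less.hyps less.prems by simp
      also have "image_mset h (mset_set (V - {a, b})) = ?M - {#h a#}"
      proof -
        have "mset_set (V - {a}) = add_mset b (mset_set (V - {a} - {b}))"
          using bV less.prems by (intro mset_set.remove) auto
        moreover have "V - {a} - {b} = V - {a, b}" by auto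
        ultimately show ?thesis using bV by simp
      qed
      finally show "real (card (respecting (V - {a, b}) h)) = wick (?M - {#h a#})" .
    qed simp
    also have "\<dots> = real (card N) * wick (?M - {#h a#})" by simp
    also have "card N = count ?M (h a)"
      using less.prems by (simp add: count_image_mset' N_def) (rule arg_cong[where f = card], auto)
    also have "real (count ?M (h a)) * wick (?M - {#h a#}) = wick (image_mset h (mset_set V))"
      using a less.prems by (simp add: wick_add[symmetric] mset_set.remove[of V a])
    finally show ?thesis .
  qed
qed

section \<open>Elementary symmetric functions in the power-sum basis\<close>

text \<open>The coefficient of the monomial with exponents \<open>b\<close> in the product of the
  power sums of degrees \<open>w u\<close>. The index set is arbitrary so that loops can be used
  before they are sorted into a list.\<close>

definition colcount :: "'a set \<Rightarrow> ('a \<Rightarrow> nat) \<Rightarrow> nat \<Rightarrow> (nat \<Rightarrow> nat) \<Rightarrow> nat" where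
  "colcount U w L b = card {g \<in> U \<rightarrow>\<^sub>E {..<L}. \<forall>j<L. (\<Sum>u\<in>{u \<in> U. g u = j}. w u) = b j}"

lemma p_to_m_colcount: "p_to_m rho mu = colcount {..<length rho} (nth rho) (length mu) (nth mu)"
  by (simp add: p_to_m_def colcount_def)

lemma colcount_reindex:
  assumes h: "bij_betw h U U'" and w: "\<And>u. u \<in> U \<Longrightarrow> w' (h u) = w u"
  shows "colcount U w L b = colcount U' w' L b"
proof -
  let ?k = "the_inv_into U h"
  let ?F = "{g \<in> U \<rightarrow>\<^sub>E {..<L}. \<forall>j<L. (\<Sum>u\<in>{u \<in> U. g u = j}. w u) = b j}"
    and ?F' = "{g \<in> U' \<rightarrow>\<^sub>E {..<L}. \<forall>j<L. (\<Sum>u\<in>{u \<in> U'. g u = j}. w' u) = b j}"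
  have k: "?k v \<in> U" "h (?k v) = v" if "v \<in> U'" for v
    using that h by (auto simp: bij_betw_def the_inv_into_into f_the_inv_into_f)
  have k': "?k (h u) = u" "h u \<in> U'" if "u \<in> U" for u
    using that h by (auto simp: bij_betw_def the_inv_into_f_f)
  have kw: "w' v = w (?k v)" if "v \<in> U'" for v
    using w[OF k(1)[OF that]] k(2)[OF that] by simp
  have sums: "(\<Sum>u\<in>{u \<in> U. g (h u) = j}. w u) = (\<Sum>v\<in>{v \<in> U'. g v = j}. w' v)" for g j
    by (rule sum.reindex_bij_witness[of _ ?k h]) (use k k' w kw in auto)
  have "bij_betw (\<lambda>g. \<lambda>u\<in>U. g (h u)) ?F'
     ?F"
  proof (rule bij_betwI[where g = "\<lambda>g. \<lambda>v\<in>U'. g (?k v)"])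
    have r: "{u \<in> U. (\<lambda>u\<in>U. g (h u)) u = j} = {u \<in> U. g (h u) = j}" for g :: "_ \<Rightarrow> nat" and j by auto
    show "(\<lambda>g. \<lambda>u\<in>U. g (h u)) \<in> ?F' \<rightarrow>
      ?F"
      using k' by (intro funcsetI, unfold mem_Collect_eq r sums) auto
    have r': "(\<Sum>v\<in>{v \<in> U'. (\<lambda>v\<in>U'. g (?k v)) v = j}. w' v) = (\<Sum>u\<in>{u \<in> U. g u = j}. w u)" for g :: "_ \<Rightarrow> nat" and j
      by (rule sum.reindex_bij_witness[of _ h ?k]) (use k k' w kw in auto)
    show "(\<lambda>g. \<lambda>v\<in>U'. g (?k v)) \<in> ?F \<rightarrow>
      ?F'"
      using k by (intro funcsetI, unfold mem_Collect_eq r') auto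
  qed (use k k' in \<open>auto simp: fun_eq_iff PiE_def extensional_def\<close>)
  from bij_betw_same_card[OF this] show ?thesis by (simp add: colcount_def)
qed

lemma colcount_image_mset:
  assumes "finite U" "mset xs = image_mset w (mset_set U)"
  shows "colcount U w L b = colcount {..<length xs} (nth xs) L b"
proof -
  obtain us where us: "set us = U" "distinct us" using finite_distinct_list[OF assms(1)] by blast
  then have "mset xs = mset (map w us)" using assms(2) mset_set_set[OF us(2)] by simp
  then obtain p where p: "p permutes {..<length us}" "permute_list p (map w us) = xs"
    using mset_eq_permutation[of xs "map w us"] by auto
  have len: "length xs = length us" using p(2) by auto
  have "bij_betw (\<lambda>i. us ! p i) {..<length xs} U"
    using bij_betw_trans[OF permutes_imp_bij[OF p(1)] bij_betw_nth[OF us(2) refl us(1)[symmetric]]]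
    by (simp add: o_def len)
  moreover have "w (us ! p i) = xs ! i" if "i < length xs" for i
    using p that len permutes_in_image[OF p(1), of i] by (auto simp: permute_list_nth)
  ultimately show ?thesis by (intro colcount_reindex[symmetric]) auto
qed

lemma colcount_mset_cong: "mset xs = mset ys \<Longrightarrow> colcount {..<length xs} (nth xs) L b = colcount {..<length ys} (nth ys) L b"
proof -
  assume *: "mset xs = mset ys"
  have "mset xs = image_mset (nth ys) (mset_set {..<length ys})"
    unfolding * by (metis atLeast_upt map_nth mset_map mset_set_upto_eq_mset_upto)
  from colcount_image_mset[OF _ this] show ?thesis by simp
qed

text \<open>The power sum of degree \<open>w u\<close> picks one variable i; the guard
  \<open>w u \<le> b i\<close> keeps the subtraction exact.\<close>

lemma colcount_insert:
  assumes U: "finite U" "u \<notin> U"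
  shows "colcount (insert u U) w L b = (\<Sum>i\<in>{i. i < L \<and> w u \<le> b i}. colcount U w L (b(i := b i - w u)))"
proof -
  let ?S = "\<lambda>U b. {g \<in> U \<rightarrow>\<^sub>E {..<L}. \<forall>j<L. (\<Sum>v\<in>{v \<in> U. g v = j}. w v) = b j}"
  let ?I = "\<lambda>i. {g \<in> ?S (insert u U) b. g u = i}"
  have fin: "finite (?S U b)" if "finite U" for U :: "'a set" and b
    by (rule finite_subset[OF _ finite_PiE[OF that, of "\<lambda>_. {..<L}"]]) auto
  have ins: "(\<Sum>v\<in>{v \<in> insert u U. g v = j}. w v) = (if g u = j then w u else 0) + (\<Sum>v\<in>{v \<in> U. g v = j}. w v)" for g :: "'a \<Rightarrow> nat" and j
  proof -
    have "{v \<in> insert u U. g v = j} = (if g u = j then insert u {v \<in> U. g v = j} else {v \<in> U. g v = j})" by auto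
    then show ?thesis using U by simp
  qed
  have fib: "card (?I i) = (if w u \<le> b i then card (?S U (b(i := b i - w u))) else 0)"
    if i: "i < L" for i
  proof (cases "w u \<le> b i")
    case False
    have "?I i = {}"
    proof (safe, simp_all only: empty_iff)
      fix g assume g: "\<forall>j<L. (\<Sum>v\<in>{v \<in> insert u U. g v = j}. w v) = b j" "i = g u"
      then have "w u + (\<Sum>v\<in>{v \<in> U. g v = i}. w v) = b i" using i ins[of g i] by auto
      then show False using False by simp
    qed
    then show ?thesis using False by (simp only: card.empty if_False)
  next
    case True
    let ?T = "{g \<in> insert u U \<rightarrow>\<^sub>E {..<L}. g u = i \<and> (\<forall>j<L. (\<Sum>v\<in>{v \<in> U. g v = j}. w v) = (b(i := b i - w u)) j)}"
    have cond: "(\<forall>j<L. (if i = j then w u else 0) + f j = b j) \<longleftrightarrow> (\<forall>j<L. f j = (b(i := b i - w u)) j)" for f :: "nat \<Rightarrow> nat"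
      using True i by (auto split: if_splits)
    have *: "?I i =
      ?T"
      unfolding ins cond[symmetric] by auto
    have rs: "{v \<in> U. (g(u := y)) v = j} = {v \<in> U. g v = j}" for g :: "'a \<Rightarrow> nat" and y j using U by auto
    have "bij_betw (\<lambda>g. g(u := undefined)) (?I i) (?S U (b(i := b i - w u)))"
      unfolding *
    proof (rule bij_betwI[where g = "\<lambda>g. g(u := i)"])
      show "(\<lambda>g. g(u := undefined)) \<in> ?T \<rightarrow> ?S U (b(i := b i - w u))"
        using U by (intro funcsetI, unfold mem_Collect_eq rs) (auto simp: PiE_def Pi_def extensional_def)
      show "(\<lambda>g. g(u := i)) \<in> ?S U (b(i := b i - w u)) \<rightarrow> ?T"
        using U i by (intro funcsetI, unfold mem_Collect_eq rs) (auto simp: PiE_def Pi_def extensional_def)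
    qed (use U in \<open>auto simp: fun_eq_iff PiE_def extensional_def\<close>)
    from bij_betw_same_card[OF this] show ?thesis using True by simp
  qed
  have "?S (insert u U) b = (\<Union>i\<in>{..<L}. ?I i)" by auto
  then have "colcount (insert u U) w L b = card (\<Union>i\<in>{..<L}. ?I i)"
    unfolding colcount_def by (rule arg_cong[where f = card])
  also have "\<dots> = (\<Sum>i<L. card (?I i))"
  proof (rule card_UN_disjoint)
    show "\<forall>i\<in>{..<L}. finite (?I i)"
      using fin[of "insert u U" b] U by (intro ballI finite_Collect_conjI disjI1) simp_all
  qed auto
  also have "\<dots> = (\<Sum>i<L. if w u \<le> b i then card (?S U (b(i := b i - w u))) else 0)"
    using fib by simp
  also have "\<dots> = (\<Sum>i\<in>{i\<in>{..<L}. w u \<le> b i}. colcount U w L (b(i := b i - w u)))"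
    by (simp add: sum.inter_filter[symmetric] colcount_def)
  finally show ?thesis by simp
qed

section \<open>Partitions and the numbers z\<close>

definition partition_of :: "nat multiset \<Rightarrow> nat list" where
  "partition_of M = rev (sorted_list_of_multiset M)"

lemma mset_partition_of [simp]: "mset (partition_of M) = M"
  by (simp add: partition_of_def)

lemma is_partition_iff: "is_partition xs \<longleftrightarrow> partition_of (mset xs) = xs \<and> 0 \<notin> set xs"
proof -
  have "sorted_wrt (\<ge>) xs \<longleftrightarrow> sorted (rev xs)" by (simp add: sorted_wrt_rev)
  also have "\<dots> \<longleftrightarrow> partition_of (mset xs) = xs"
    unfolding partition_of_def
    by (metis mset_rev rev_rev_ident sorted_list_of_multiset_mset sorted_sort sorted_sort_id)
  finally show ?thesis by (simp add: is_partition_def)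
qed

lemma partition_of_in_partitions: "partition_of M \<in> partitions n \<longleftrightarrow> 0 \<notin># M \<and> sum_mset M = n"
proof -
  have "0 \<notin> set (partition_of M) \<longleftrightarrow> 0 \<notin># M" by (metis mset_partition_of set_mset_mset)
  moreover have "sum_list (partition_of M) = sum_mset M" by (metis mset_partition_of sum_mset_sum_list)
  ultimately show ?thesis by (simp add: partitions_def is_partition_iff)
qed

lemma partition_eqI: "xs \<in> partitions n \<Longrightarrow> ys \<in> partitions n' \<Longrightarrow> mset xs = mset ys \<Longrightarrow> xs = ys"
  by (metis is_partition_iff mem_Collect_eq partitions_def)

lemma length_le_sum_list: "0 \<notin> set xs \<Longrightarrow> length xs \<le> sum_list (xs :: nat list)"
  by (induction xs) auto

lemma finite_partitions: "finite (partitions n)"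
proof (rule finite_subset)
  show "partitions n \<subseteq> {xs. set xs \<subseteq> {..n} \<and> length xs \<le> n}"
    using length_le_sum_list by (auto simp: partitions_def is_partition_def member_le_sum_list)
qed (simp add: finite_lists_length_le)

lemma partitions_0: "partitions 0 = {[]}"
  by (auto simp: partitions_def is_partition_def) (metis list.set_intros(1) neq_Nil_conv)

lemma zee_pos: "0 \<notin> set xs \<Longrightarrow> zee xs > 0"
  unfolding zee_def by (intro prod_pos) (auto intro!: Nat.gr0I)

definition mzee :: "nat multiset \<Rightarrow> nat" where
  "mzee M = (\<Prod>i\<in>set_mset M. i ^ count M i * fact (count M i))"

lemma zee_mzee: "zee xs = mzee (mset xs)"
  by (simp add: zee_def mzee_def count_mset)

lemma mzee_add: "mzee (add_mset r M) = r * Suc (count M r) * mzee M"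
proof -
  let ?A = "insert r (set_mset M)" and ?f = "\<lambda>k i. i ^ k * (fact k :: nat)"
  have eq: "(\<Prod>i\<in>?A - {r}. ?f (count (add_mset r M) i) i) = (\<Prod>i\<in>?A - {r}. ?f (count M i) i)"
    by (rule prod.cong) auto
  have "mzee (add_mset r M) = ?f (Suc (count M r)) r * (\<Prod>i\<in>?A - {r}. ?f (count M i) i)"
    unfolding mzee_def eq[symmetric]
    using prod.remove[of ?A r "\<lambda>i. ?f (count (add_mset r M) i) i"] by simp
  moreover have "mzee M = (\<Prod>i\<in>?A. ?f (count M i) i)"
    unfolding mzee_def by (rule prod.mono_neutral_left) (auto simp: not_in_iff)
  then have "mzee M = ?f (count M r) r * (\<Prod>i\<in>?A - {r}. ?f (count M i) i)"
    using prod.remove[of ?A r "\<lambda>i. ?f (count M i) i"] by simp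
  ultimately show ?thesis by (simp add: algebra_simps)
qed

lemma sum_list_count: "sum_list xs = (\<Sum>r\<in>set xs. r * count (mset xs) r)" for xs :: "nat list"
  using sum_mset_sum_list[of xs] by (simp add: sum_mset_sum_list sum_list_map_eq_sum_count[of id, simplified] count_mset mult.commute)

text \<open>Removing a marked part: the numbers \<open>1 / z\<^sub>\<rho>\<close> enter only through this recursion.\<close>

lemma sum_partitions_rec:
  fixes \<phi> :: "nat list \<Rightarrow> real"
  assumes inv: "\<And>xs ys. mset xs = mset ys \<Longrightarrow> \<phi> xs = \<phi> ys"
  shows "real n * (\<Sum>xs\<in>partitions n. \<phi> xs / zee xs) =
    (\<Sum>r=1..n. \<Sum>ys\<in>partitions (n - r). \<phi> (r # ys) / zee ys)"
proof -
  let ?u = "\<lambda>(xs, r). (r, partition_of (mset xs - {#r#}))"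
    and ?v = "\<lambda>(r, ys). (partition_of (add_mset r (mset ys)), r)"
  \<comment> \<open>The factor n is the sum over the distinct parts r of r times its multiplicity;
    the part r is then removed once.\<close>
  have "real n * (\<Sum>xs\<in>partitions n. \<phi> xs / zee xs) =
    (\<Sum>xs\<in>partitions n. \<Sum>r\<in>set xs. r * count (mset xs) r * (\<phi> xs / zee xs))"
    unfolding sum_distrib_left
  proof (rule sum.cong)
    fix xs assume "xs \<in> partitions n"
    then have "real n = real (\<Sum>r\<in>set xs. r * count (mset xs) r)" by (simp add: partitions_def flip: sum_list_count)
    also have "\<dots> = (\<Sum>r\<in>set xs. real (r * count (mset xs) r))" by simp
    finally show "real n * (\<phi> xs / zee xs) = (\<Sum>r\<in>set xs. r * count (mset xs) r * (\<phi> xs / zee xs))"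
      by (simp only: sum_distrib_right)
  qed simp
  also have "\<dots> = (\<Sum>(xs, r)\<in>Sigma (partitions n) set. r * count (mset xs) r * (\<phi> xs / zee xs))"
    by (rule sum.Sigma) (auto simp: finite_partitions)
  also have "\<dots> = (\<Sum>(r, ys)\<in>Sigma {1..n} (\<lambda>r. partitions (n - r)). \<phi> (r # ys) / zee ys)"
  proof (rule sum.reindex_bij_witness[of _ ?v ?u])
    fix p assume "p \<in> Sigma (partitions n) set"
    then obtain xs r where p: "p = (xs, r)" "xs \<in> partitions n" "r \<in> set xs" by blast
    have xs: "partition_of (mset xs) = xs" "0 \<notin> set xs" "sum_list xs = n"
      using p(2) by (auto simp: partitions_def is_partition_iff)
    obtain M where M: "mset xs = add_mset r M" using p(3) by (metis insert_DiffM set_mset_mset)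
    have "sum_mset (mset xs) = n" using xs(3) by (simp add: sum_mset_sum_list)
    then have n: "n = r + sum_mset M" by (simp add: M)
    have z: "0 \<notin># mset xs" using xs(2) by simp
    then have r: "0 < r" "0 \<notin># M" by (auto simp: M)
    show "?v (?u p) = p"
      using xs(1) by (simp add: p M)
    show "?u p \<in> Sigma {1..n} (\<lambda>r. partitions (n - r))"
      using n r by (simp add: p M partition_of_in_partitions)
    have \<phi>: "\<phi> (r # partition_of M) = \<phi> xs" by (rule inv) (simp add: M)
    \<comment> \<open>By \<open>mzee_add\<close> the number z loses exactly this factor when the
      part r is removed, and the factor is also the weight of the marked part; so the two
      cancel.\<close>
    define c where "c = real (r * Suc (count M r))"
    have "real (zee xs) = c * real (zee (partition_of M))"
      by (simp add: zee_mzee M mzee_add c_def)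
    moreover have "c > 0" using r unfolding c_def of_nat_0_less_iff by simp
    moreover have "real (r * count (mset xs) r) = c" by (simp add: M c_def)
    ultimately show "(case ?u p of (r, ys) \<Rightarrow> \<phi> (r # ys) / zee ys) =
      (case p of (xs, r) \<Rightarrow> r * count (mset xs) r * (\<phi> xs / zee xs))"
      using \<phi> by (simp add: p M del: of_nat_mult)
  next
    fix q assume "q \<in> Sigma {1..n} (\<lambda>r. partitions (n - r))"
    then obtain r ys where q: "q = (r, ys)" "1 \<le> r" "r \<le> n" "ys \<in> partitions (n - r)" by auto
    have ys: "partition_of (mset ys) = ys" "0 \<notin> set ys" "sum_list ys = n - r"
      using q(4) by (auto simp: partitions_def is_partition_iff)
    show "?u (?v q) = q"
      using ys by (simp add: q)
    have "r \<in> set (partition_of (add_mset r (mset ys)))" by (metis mset_partition_of set_mset_mset union_single_eq_member)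
    then show "?v q \<in> Sigma (partitions n) set"
      using ys q by (simp add: partition_of_in_partitions sum_mset_sum_list)
  qed
  also have "\<dots> = (\<Sum>r=1..n. \<Sum>ys\<in>partitions (n - r). \<phi> (r # ys) / zee ys)"
    by (rule sum.Sigma[symmetric]) (auto simp: finite_partitions)
  finally show ?thesis .
qed

section \<open>Zero-one matrices and the dual Cauchy identity\<close>

definition margins :: "nat \<Rightarrow> nat \<Rightarrow> (nat \<Rightarrow> nat) \<Rightarrow> (nat \<Rightarrow> nat) \<Rightarrow> (nat \<times> nat) set set" where
  "margins K L a b = {R. R \<subseteq> {..<K} \<times> {..<L} \<and>
     (\<forall>i<K. card {j. (i, j) \<in> R} = a i) \<and> (\<forall>j<L. card {i. (i, j) \<in> R} = b j)}"

definition dec_at :: "nat \<Rightarrow> nat \<Rightarrow> (nat \<Rightarrow> nat) \<Rightarrow> nat \<Rightarrow> nat" where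
  "dec_at i r a = a(i := a i - r)"

lemma finite_margins: "finite (margins K L a b)"
  by (rule finite_subset[of _ "Pow ({..<K} \<times> {..<L})"]) (auto simp: margins_def)

lemma margins_card:
  assumes "R \<in> margins K L a b"
  shows "card R = (\<Sum>i<K. a i)"
proof -
  have "R = Sigma {..<K} (\<lambda>i. {j. (i, j) \<in> R})" using assms by (auto simp: margins_def)
  then have "card R = (\<Sum>i<K. card {j. (i, j) \<in> R})"
  proof -
    have "finite {j. (i, j) \<in> R}" for i
      by (rule finite_subset[of _ "{..<L}"]) (use assms in \<open>auto simp: margins_def\<close>)
    then show ?thesis
      by (subst \<open>R = _\<close>) simp
  qed
  then show ?thesis using assms by (simp add: margins_def)
qed

text \<open>Clearing the entry lowers one row sum and one column sum. If one of them is 0, no matrix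
  has a 1 there, and the case split keeps truncated margins out.\<close>

lemma margins_remove:
  assumes ij: "i < K" "j < L"
  shows "card {R \<in> margins K L a b. (i, j) \<in> R} =
    (if a i > 0 \<and> b j > 0 then card {R \<in> margins K L (dec_at i 1 a) (dec_at j 1 b). (i, j) \<notin> R} else 0)"
proof -
  let ?M = "{R \<in> margins K L a b. (i, j) \<in> R}"
    and ?M' = "{R \<in> margins K L (dec_at i 1 a) (dec_at j 1 b). (i, j) \<notin> R}"
  have fin: "finite {j. (i, j) \<in> R}" "finite {i. (i, j) \<in> R}" if "R \<subseteq> {..<K} \<times> {..<L}" for R i j
    using that by (auto intro: finite_subset[of _ "{..<L}"] finite_subset[of _ "{..<K}"])
  have pos: "a i > 0 \<and> b j > 0" if R: "R \<in> margins K L a b" "(i, j) \<in> R" for R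
  proof -
    have "card {j. (i, j) \<in> R} > 0" "card {i. (i, j) \<in> R} > 0"
      using fin[of R] R by (auto simp: card_gt_0_iff margins_def)
    then show ?thesis using R ij by (auto simp: margins_def)
  qed
  show ?thesis
  proof (cases "a i > 0 \<and> b j > 0")
    case False
    then have "?M = {}" using pos by blast
    then show ?thesis using False by (simp only: card.empty if_False)
  next
    case True
    have row: "{j'. (i', j') \<in> R - {(i, j)}} = (if i' = i then {j'. (i, j') \<in> R} - {j} else {j'. (i', j') \<in> R})"
      and col: "{i'. (i', j') \<in> R - {(i, j)}} = (if j' = j then {i'. (i', j) \<in> R} - {i} else {i'. (i', j') \<in> R})"
      for R i' j' by auto
    have row': "{j'. (i', j') \<in> insert (i, j) R} = (if i' = i then insert j {j'. (i, j') \<in> R} else {j'. (i', j') \<in> R})"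
      and col': "{i'. (i', j') \<in> insert (i, j) R} = (if j' = j then insert i {i'. (i', j) \<in> R} else {i'. (i', j') \<in> R})"
      for R i' j' by auto
    have "bij_betw (\<lambda>R. R - {(i, j)}) ?M
      ?M'"
    proof (rule bij_betwI[where g = "insert (i, j)"])
      show "(\<lambda>R. R - {(i, j)}) \<in> ?M \<rightarrow>
        ?M'"
      proof (intro funcsetI)
        fix R assume "R \<in> ?M"
        then have R: "R \<subseteq> {..<K} \<times> {..<L}" "\<And>i. i < K \<Longrightarrow> card {j. (i, j) \<in> R} = a i"
          "\<And>j. j < L \<Longrightarrow> card {i. (i, j) \<in> R} = b j" "(i, j) \<in> R" by (auto simp: margins_def)
        have "card {j'. (i', j') \<in> R - {(i, j)}} = dec_at i 1 a i'" if "i' < K" for i'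
          unfolding row using R(2)[OF that] R(4) fin[OF R(1)] by (auto simp: dec_at_def)
        moreover have "card {i'. (i', j') \<in> R - {(i, j)}} = dec_at j 1 b j'" if "j' < L" for j'
          unfolding col using R(3)[OF that] R(4) fin[OF R(1)] by (auto simp: dec_at_def)
        ultimately show "R - {(i, j)} \<in> ?M'"
          using R(1) unfolding margins_def by blast
      qed
      show "insert (i, j) \<in> ?M' \<rightarrow>
        ?M"
      proof (intro funcsetI)
        fix R assume "R \<in> ?M'"
        then have R: "R \<subseteq> {..<K} \<times> {..<L}" "\<And>i'. i' < K \<Longrightarrow> card {j. (i', j) \<in> R} = dec_at i 1 a i'"
          "\<And>j'. j' < L \<Longrightarrow> card {i. (i, j') \<in> R} = dec_at j 1 b j'" "(i, j) \<notin> R" by (auto simp: margins_def)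
        have "card {j'. (i', j') \<in> insert (i, j) R} = a i'" if "i' < K" for i'
          unfolding row' using R(2)[OF that] R(4) fin[OF R(1)] True by (auto simp: dec_at_def)
        moreover have "card {i'. (i', j') \<in> insert (i, j) R} = b j'" if "j' < L" for j'
          unfolding col' using R(3)[OF that] R(4) fin[OF R(1)] True by (auto simp: dec_at_def)
        moreover have "insert (i, j) R \<subseteq> {..<K} \<times> {..<L}" using R(1) ij by auto
        ultimately show "insert (i, j) R \<in> ?M"
          unfolding margins_def by blast
      qed
    qed auto
    from bij_betw_same_card[OF this] show ?thesis using True by simp
  qed
qed

text \<open>Matrices with a 0 at the position are all matrices minus those with a 1, so
  \<open>margins_remove\<close> can be iterated with alternating signs. In generating functions this
  is t / (1 + t) = t - t^2 + ... for t the product of the two variables.\<close>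

lemma margins_member:
  assumes ij: "i < K" "j < L"
  shows "real (card {R \<in> margins K L a b. (i, j) \<in> R}) =
    (\<Sum>r\<in>{1..min (a i) (b j)}. (-1) ^ (r - 1) * real (card (margins K L (dec_at i r a) (dec_at j r b))))"
proof (induction "min (a i) (b j)" arbitrary: a b)
  case 0
  then have "\<not> (a i > 0 \<and> b j > 0)" by auto
  then show ?case using 0 margins_remove[OF ij, of a b] by auto
next
  case (Suc m)
  then have pos: "a i > 0" "b j > 0" by auto
  let ?a = "dec_at i 1 a" and ?b = "dec_at j 1 b" and ?m = "\<lambda>r. real (card (margins K L (dec_at i r a) (dec_at j r b)))"
  have m: "m = min (?a i) (?b j)" using Suc.hyps(2) by (auto simp: dec_at_def)
  have dd: "dec_at i r ?a = dec_at i (Suc r) a" "dec_at j r ?b = dec_at j (Suc r) b" for r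
    by (auto simp: dec_at_def)
  have split: "card (margins K L ?a ?b) = card {R \<in> margins K L ?a ?b. (i, j) \<notin> R} + card {R \<in> margins K L ?a ?b. (i, j) \<in> R}"
    using finite_margins by (subst card_Un_disjoint[symmetric]) (auto intro!: arg_cong[where f = card])
  have "real (card {R \<in> margins K L a b. (i, j) \<in> R}) = real (card {R \<in> margins K L ?a ?b. (i, j) \<notin> R})"
    using margins_remove[OF ij, of a b] pos by simp
  also have "\<dots> = real (card (margins K L ?a ?b)) - real (card {R \<in> margins K L ?a ?b. (i, j) \<in> R})"
    using split by simp
  also have "real (card {R \<in> margins K L ?a ?b. (i, j) \<in> R}) =
    (\<Sum>r\<in>{1..m}. (-1) ^ (r - 1) * ?m (Suc r))"
    using Suc.hyps(1)[of ?a ?b, OF m] unfolding m[symmetric] dd .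
  also have "real (card (margins K L ?a ?b)) - \<dots> =
    (\<Sum>r\<in>{1..Suc m}. (-1) ^ (r - 1) * ?m r)"
  proof -
    have "(\<Sum>r\<in>{Suc 1..Suc m}. (-1) ^ (r - 1) * ?m r) =
      (\<Sum>r\<in>{1..m}. (-1) ^ r * ?m (Suc r))"
      by (subst sum.shift_bounds_cl_Suc_ivl) simp
    also have "\<dots> = - (\<Sum>r\<in>{1..m}. (-1) ^ (r - 1) * ?m (Suc r))"
      unfolding sum_negf[symmetric]
    proof (rule sum.cong)
      fix r assume "r \<in> {1..m}"
      then obtain q where "r = Suc q" by (cases r) auto
      then show "(-1) ^ r * ?m (Suc r) =
        - ((-1) ^ (r - 1) * ?m (Suc r))" by simp
    qed simp
    finally show ?thesis by (subst sum.atLeast_Suc_atMost) auto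
  qed
  finally show ?case by (simp only: Suc.hyps(2))
qed

abbreviation content_count :: "nat list \<Rightarrow> nat \<Rightarrow> (nat \<Rightarrow> nat) \<Rightarrow> nat" where
  "content_count xs L b \<equiv> colcount {..<length xs} (nth xs) L b"

lemma content_count_Cons:
  "content_count (r # xs) L b = (\<Sum>i\<in>{i. i < L \<and> r \<le> b i}. content_count xs L (dec_at i r b))"
proof -
  have "content_count (r # xs) L b = colcount (insert (length xs) {..<length xs}) (nth (xs @ [r])) L b"
    using colcount_mset_cong[of "r # xs" "xs @ [r]" L b] by (simp add: lessThan_Suc)
  also have "\<dots> = (\<Sum>i\<in>{i. i < L \<and> r \<le> b i}. colcount {..<length xs} (nth (xs @ [r])) L (dec_at i r b))"
    by (subst colcount_insert) (auto simp: dec_at_def)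
  also have "\<dots> = (\<Sum>i\<in>{i. i < L \<and> r \<le> b i}. content_count xs L (dec_at i r b))"
    by (intro sum.cong refl colcount_reindex[where h = id]) (auto simp: nth_append)
  finally show ?thesis .
qed

lemma sum_sum_scale:
  fixes s t z :: real
  shows "(\<Sum>i\<in>I. \<Sum>j\<in>J. s * (t * x i * y j / z)) = s * t * (\<Sum>i\<in>I. x i) * (\<Sum>j\<in>J. y j) / z"
proof -
  have "s * (t * x i * y j / z) = (s * t / z * x i) * y j" for i j by simp
  then show ?thesis
    by (simp only: sum_distrib_left[symmetric] sum_distrib_right[symmetric]) simp
qed

text \<open>The coefficient of \<open>x\<^sup>a y\<^sup>b\<close> in Cauchy's product \<open>\<Prod>(1 + x\<^sub>i y\<^sub>j)\<close>, expanded in power sums.\<close>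

lemma dual_cauchy:
  assumes "(\<Sum>i<K. a i) = n" "(\<Sum>j<L. b j) = n"
  shows "(\<Sum>xs\<in>partitions n. (-1) ^ (n + length xs) * real (content_count xs K a) * real (content_count xs L b) / zee xs) =
    real (card (margins K L a b))"
  using assms
proof (induction n arbitrary: a b rule: less_induct)
  case (less n)
  show ?case
  proof (cases "n = 0")
    case True
    then have z: "\<forall>i<K. a i = 0" "\<forall>j<L. b j = 0" using less.prems by auto
    have "margins K L a b = {{}}"
    proof -
      have "R = {}" if "R \<in> margins K L a b" for R
      proof -
        have "card R = 0" using margins_card[OF that] less.prems True by simp
        moreover have "finite R" using that finite_subset[of R "{..<K} \<times> {..<L}"] by (simp add: margins_def)
        ultimately show ?thesis by simp
      qed
      moreover have "{} \<in> margins K L a b" using z by (simp add: margins_def)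
      ultimately show ?thesis by blast
    qed
    then show ?thesis using z True by (simp add: partitions_0 colcount_def zee_def)
  next
    case False
    define w where "w = (\<lambda>xs. (-1 :: real) ^ (n + length xs) * real (content_count xs K a) * real (content_count xs L b))"
    define I where "I = (\<lambda>r. {i. i < K \<and> r \<le> a i})"
    define J where "J = (\<lambda>r. {j. j < L \<and> r \<le> b j})"
    let ?t = "\<lambda>r i j ys. (-1) ^ (n - r + length ys) * real (content_count ys K (dec_at i r a)) * real (content_count ys L (dec_at j r b)) / zee ys"
    let ?m = "\<lambda>r i j. (-1) ^ (r - 1) * real (card (margins K L (dec_at i r a) (dec_at j r b)))"
    have dec: "(\<Sum>i'<M. dec_at i r c i') = n - r" if "i < M" "r \<le> c i" "(\<Sum>i<M. c i) = n" for i r c and M :: nat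
    proof -
      have "(\<Sum>i'<M. c i') = c i + (\<Sum>i'\<in>{..<M} - {i}. c i')" using that by (intro sum.remove) auto
      moreover have "(\<Sum>i'<M. dec_at i r c i') = dec_at i r c i + (\<Sum>i'\<in>{..<M} - {i}. dec_at i r c i')"
        using that by (intro sum.remove) auto
      moreover have "(\<Sum>i'\<in>{..<M} - {i}. dec_at i r c i') = (\<Sum>i'\<in>{..<M} - {i}. c i')"
        by (rule sum.cong) (auto simp: dec_at_def)
      ultimately show ?thesis using that by (simp add: dec_at_def)
    qed
    \<comment> \<open>In effect logarithmic derivatives are compared: the removed part r is assigned
      to a row i and to a column j.\<close>
    have "real n * (\<Sum>xs\<in>partitions n. w xs / zee xs) = (\<Sum>r=1..n. \<Sum>ys\<in>partitions (n - r). w (r # ys) / zee ys)"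
    proof (rule sum_partitions_rec)
      fix xs ys :: "nat list" assume eq: "mset xs = mset ys"
      then show "w xs = w ys"
        unfolding w_def colcount_mset_cong[OF eq, of K a] colcount_mset_cong[OF eq, of L b]
        by (simp only: mset_eq_length[OF eq])
    qed
    also have "\<dots> = (\<Sum>r=1..n. \<Sum>i\<in>I r. \<Sum>j\<in>J r. ?m r i j)"
    proof (rule sum.cong)
      fix r assume r: "r \<in> {1..n}"
      have "(\<Sum>ys\<in>partitions (n - r). w (r # ys) / zee ys) = (\<Sum>ys\<in>partitions (n - r). \<Sum>i\<in>I r. \<Sum>j\<in>J r.
        (-1) ^ (r - 1) * (?t r i j ys))"
      proof (rule sum.cong)
        fix ys
        have "(-1 :: real) ^ (n + length (r # ys)) = (-1) ^ (r - 1) * (-1) ^ (n - r + length ys)"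
        proof -
          have "n + length (r # ys) = (r - 1) + (n - r + length ys) + 2" using r by auto
          then show ?thesis by (simp only: power_add) simp
        qed
        then show "w (r # ys) / zee ys = (\<Sum>i\<in>I r. \<Sum>j\<in>J r.
          (-1) ^ (r - 1) * (?t r i j ys))"
          unfolding w_def content_count_Cons I_def J_def of_nat_sum
          by (simp only: sum_sum_scale)
      qed simp
      also have "\<dots> = (\<Sum>i\<in>I r. \<Sum>j\<in>J r. (-1) ^ (r - 1) * (\<Sum>ys\<in>partitions (n - r).
        ?t r i j ys))"
        unfolding sum_distrib_left by (subst sum.swap, rule sum.cong[OF refl], rule sum.swap)
      also have "\<dots> = (\<Sum>i\<in>I r. \<Sum>j\<in>J r. ?m r i j)"
      proof (intro sum.cong refl)
        fix i j assume "i \<in> I r" "j \<in> J r"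
        then show "(-1) ^ (r - 1) * (\<Sum>ys\<in>partitions (n - r).
          ?t r i j ys) = ?m r i j"
          using less.IH[of "n - r" "dec_at i r a" "dec_at j r b"] dec[of i K r a] dec[of j L r b] less.prems r
          by (simp add: I_def J_def)
      qed
      finally show "(\<Sum>ys\<in>partitions (n - r). w (r # ys) / zee ys) = (\<Sum>i\<in>I r. \<Sum>j\<in>J r. ?m r i j)" .
    qed simp
    also have "\<dots> = (\<Sum>r=1..n. \<Sum>i<K. \<Sum>j<L. if r \<le> a i \<and> r \<le> b j then ?m r i j else 0)"
    proof (rule sum.cong)
      fix r
      have IJ: "I r = {i \<in> {..<K}. r \<le> a i}" "J r = {j \<in> {..<L}. r \<le> b j}" by (auto simp: I_def J_def)
      show "(\<Sum>i\<in>I r. \<Sum>j\<in>J r. ?m r i j) = (\<Sum>i<K. \<Sum>j<L. if r \<le> a i \<and> r \<le> b j then ?m r i j else 0)"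
        unfolding IJ sum.inter_filter[OF finite_lessThan] by (intro sum.cong refl) simp
    qed simp
    also have "\<dots> = (\<Sum>i<K. \<Sum>j<L. \<Sum>r=1..n. if r \<le> a i \<and> r \<le> b j then ?m r i j else 0)"
      by (subst sum.swap, rule sum.cong[OF refl], rule sum.swap)
    also have "\<dots> = (\<Sum>i<K. \<Sum>j<L. real (card {R \<in> margins K L a b. (i, j) \<in> R}))"
    proof (intro sum.cong refl)
      fix i j assume ij: "i \<in> {..<K}" "j \<in> {..<L}"
      have "a i \<le> n" using ij less.prems(1) member_le_sum[of i "{..<K}" a] by auto
      then have "{r \<in> {1..n}. r \<le> a i \<and> r \<le> b j} = {1..min (a i) (b j)}" by auto
      then show "(\<Sum>r=1..n. if r \<le> a i \<and> r \<le> b j then ?m r i j else 0) = real (card {R \<in> margins K L a b. (i, j) \<in> R})"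
        using ij by (simp add: margins_member sum.inter_filter[symmetric])
    qed
    \<comment> \<open>Double counting of pairs of a matrix and one of its ones. Every matrix has n
      ones, which cancels the factor n on the left.\<close>
    also have "\<dots> = (\<Sum>R\<in>margins K L a b. real (card R))"
    proof -
      have "real (card R) = (\<Sum>i<K. \<Sum>j<L. if (i, j) \<in> R then 1 else 0)" if R: "R \<in> margins K L a b" for R
      proof -
        have "R = {p \<in> {..<K} \<times> {..<L}. p \<in> R}" using R by (auto simp: margins_def)
        then have "real (card R) = (\<Sum>p\<in>{p \<in> {..<K} \<times> {..<L}. p \<in> R}. 1)" by simp
        also have "\<dots> = (\<Sum>p\<in>{..<K} \<times> {..<L}. if p \<in> R then 1 else 0)" by (rule sum.inter_filter) simp
        finally show ?thesis by (simp add: sum.cartesian_product case_prod_unfold)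
      qed
      then have "(\<Sum>R\<in>margins K L a b. real (card R)) = (\<Sum>R\<in>margins K L a b. \<Sum>i<K. \<Sum>j<L. if (i, j) \<in> R then 1 else 0)"
        by simp
      also have "\<dots> = (\<Sum>i<K. \<Sum>j<L. \<Sum>R\<in>margins K L a b. if (i, j) \<in> R then 1 else 0)"
        by (subst sum.swap, rule sum.cong[OF refl], rule sum.swap)
      also have "\<dots> = (\<Sum>i<K. \<Sum>j<L. real (card {R \<in> margins K L a b. (i, j) \<in> R}))"
        by (simp add: sum.inter_filter[symmetric] finite_margins)
      finally show ?thesis by simp
    qed
    also have "\<dots> = real n * real (card (margins K L a b))"
      using less.prems by (simp add: margins_card)
    finally have "(\<Sum>xs\<in>partitions n. w xs / zee xs) = real (card (margins K L a b))" using False by simp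
    then show ?thesis by (simp add: w_def)
  qed
qed

section \<open>Dominance and the characterisation of the Jack polynomial\<close>

lemma sum_card_swap:
  assumes "finite I" "finite J"
  shows "(\<Sum>i\<in>I. card {j \<in> J. R j i}) = (\<Sum>j\<in>J. card {i \<in> I. R j i})"
proof -
  have "(\<Sum>i\<in>I. card {j \<in> J. R j i}) = (\<Sum>i\<in>I. \<Sum>j\<in>J. if R j i then 1 else 0)"
    using assms by (simp add: sum.inter_filter[symmetric])
  also have "\<dots> = (\<Sum>j\<in>J. \<Sum>i\<in>I. if R j i then 1 else 0)" by (rule sum.swap)
  finally show ?thesis using assms by (simp add: sum.inter_filter[symmetric])
qed

text \<open>The parts decrease, so the rows that reach column j form an initial segment. From here
  on \<open>i < conj_part lam j\<close> serves as the test for a box.\<close>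

lemma less_conj_part_iff:
  assumes "is_partition lam"
  shows "i < conj_part lam j \<longleftrightarrow> i < length lam \<and> j < lam ! i"
proof -
  let ?S = "{i. i < length lam \<and> j < lam ! i}"
  have down: "i' \<in> ?S" if "i \<in> ?S" "i' \<le> i" for i i'
  proof (cases "i' = i")
    case False
    then have "lam ! i \<le> lam ! i'"
      using assms that sorted_wrt_nth_less[of "(\<ge>)" lam i' i] by (simp add: is_partition_def)
    then show ?thesis using that by auto
  qed (use that in simp)
  have fin: "finite ?S" by simp
  have "?S = {..<card ?S}"
  proof (cases "?S = {}")
    case False
    have "?S = {..Max ?S}"
    proof (intro equalityI subsetI)
      fix x assume "x \<in> ?S"
      then show "x \<in> {..Max ?S}" unfolding atMost_iff by (rule Max_ge[OF fin])
    next
      fix x assume "x \<in> {..Max ?S}"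
      then show "x \<in> ?S" unfolding atMost_iff by (rule down[OF Max_in[OF fin False]])
    qed
    then show ?thesis by (metis card_atMost lessThan_Suc_atMost)
  next
    case True
    then show ?thesis by (simp only: card.empty lessThan_0)
  qed
  then show ?thesis unfolding conj_part_def by blast
qed

lemma conj_part_le_length: "conj_part lam j \<le> length lam"
  unfolding conj_part_def using card_mono[of "{..<length lam}" "{i. i < length lam \<and> j < lam ! i}"] by auto

lemma conj_part_antimono: "j \<le> k \<Longrightarrow> conj_part lam k \<le> conj_part lam j"
  unfolding conj_part_def by (rule card_mono) auto

lemma nth_le_sum_list: "i < length xs \<Longrightarrow> xs ! i \<le> sum_list (xs :: nat list)"
  by (simp add: member_le_sum_list)

lemma sum_list_take: "sum_list (take k xs) = (\<Sum>i | i < k \<and> i < length xs. xs ! i)" for xs :: "nat list"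
proof -
  have "sum_list (take k xs) = (\<Sum>i\<in>{0..<min (length xs) k}. xs ! i)"
    by (subst sum_list_sum_nth) (auto intro!: sum.cong)
  moreover have "{0..<min (length xs) k} = {i. i < k \<and> i < length xs}" by auto
  ultimately show ?thesis by simp
qed

text \<open>The boxes of the first k rows, counted by columns and by rows. The dominance estimates
  below bound something column by column and then sum up in this way.\<close>

lemma sum_min_conj_part:
  assumes "is_partition lam"
  shows "(\<Sum>j<sum_list lam. min k (conj_part lam j)) = sum_list (take k lam)"
proof -
  have "min k (conj_part lam j) = card {i \<in> {i. i < k \<and> i < length lam}. j < lam ! i}" for j
  proof -
    have "{i \<in> {i. i < k \<and> i < length lam}. j < lam ! i} = {..<min k (conj_part lam j)}"
      using less_conj_part_iff[OF assms] by auto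
    then show ?thesis by simp
  qed
  then have "(\<Sum>j<sum_list lam. min k (conj_part lam j)) =
    (\<Sum>j<sum_list lam. card {i \<in> {i. i < k \<and> i < length lam}. j < lam ! i})"
    by (simp only:)
  also have "\<dots> = (\<Sum>i | i < k \<and> i < length lam. card {j \<in> {..<sum_list lam}. j < lam ! i})"
    by (rule sum_card_swap) auto
  also have "\<dots> = (\<Sum>i | i < k \<and> i < length lam. lam ! i)"
  proof (rule sum.cong)
    fix i assume "i \<in> {i. i < k \<and> i < length lam}"
    then have "{j \<in> {..<sum_list lam}. j < lam ! i} = {..<lam ! i}" using nth_le_sum_list[of i lam] by auto
    then show "card {j \<in> {..<sum_list lam}. j < lam ! i} = lam ! i" by simp
  qed simp
  finally show ?thesis by (simp add: sum_list_take)
qed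

lemma sum_conj_part:
  assumes "is_partition lam"
  shows "(\<Sum>j<sum_list lam. conj_part lam j) = sum_list lam"
  using sum_min_conj_part[OF assms, of "length lam"] conj_part_le_length[of lam] by (simp add: min_absorb2)

lemma dominated_if_columns:
  assumes "is_partition lam"
    and "\<And>k. (\<Sum>i | i < k \<and> i < length mu. mu ! i) \<le> (\<Sum>j<sum_list lam. min k (conj_part lam j))"
  shows "dominated mu lam"
  unfolding dominated_def sum_list_take[of _ mu] sum_min_conj_part[OF assms(1), symmetric]
  using assms(2) by blast

text \<open>Partial sums determine the entries up to trailing zeros, which positivity rules
  out.\<close>

lemma dominated_antisym:
  assumes "dominated mu lam" "dominated lam mu" "0 \<notin> set mu" "0 \<notin> set lam"
  shows "mu = lam"
proof -
  have "\<forall>k. sum_list (take k mu) = sum_list (take k lam)"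
    using assms by (auto simp: dominated_def intro: antisym)
  then show ?thesis using assms(3,4)
  proof (induction mu arbitrary: lam)
    case Nil
    then show ?case by (cases lam) (auto dest: spec[of _ 1])
  next
    case (Cons x mu)
    then have "lam \<noteq> []" by (auto dest: spec[of _ 1])
    then obtain y lam' where lam: "lam = y # lam'" by (cases lam) auto
    have xy: "x = y" using Cons.prems(1)[rule_format, of 1] by (simp add: lam)
    have "sum_list (take k mu) = sum_list (take k lam')" for k
      using Cons.prems(1)[rule_format, of "Suc k"] xy by (simp add: lam)
    then show ?case using Cons.IH[of lam'] Cons.prems xy lam by simp
  qed
qed

lemma dominated_trans: "dominated mu nu \<Longrightarrow> dominated nu lam \<Longrightarrow> dominated mu lam"
  by (auto simp: dominated_def intro: order_trans)

text \<open>Power-sum coordinates of the product of the elementary symmetric functions whose degrees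
  are the column lengths of \<open>kap\<close>: sign, 1 / z, and a monomial coefficient of the power
  sum. Columns beyond the diagram have length 0 and contribute the factor 1, so n of them can be
  used for every \<open>kap\<close>.\<close>

definition evec :: "nat \<Rightarrow> nat list \<Rightarrow> nat list \<Rightarrow> real" where
  "evec n kap rho = (if rho \<in> partitions n
     then (-1) ^ (n + length rho) * real (content_count rho n (conj_part kap)) / zee rho else 0)"

lemma mcoeff_evec:
  assumes "kap \<in> partitions n" "mu \<in> partitions n"
  shows "mcoeff n (evec n kap) mu = real (card (margins n (length mu) (conj_part kap) (nth mu)))"
proof -
  have "mcoeff n (evec n kap) mu = (\<Sum>xs\<in>partitions n. (-1) ^ (n + length xs) *
    real (content_count xs n (conj_part kap)) * real (content_count xs (length mu) (nth mu)) / zee xs)"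
    unfolding mcoeff_def by (rule sum.cong) (auto simp: evec_def p_to_m_colcount)
  also have "\<dots> = real (card (margins n (length mu) (conj_part kap) (nth mu)))"
  proof (rule dual_cauchy)
    show "(\<Sum>i<n. conj_part kap i) = n" using assms(1) sum_conj_part[of kap] by (simp add: partitions_def)
    show "(\<Sum>j<length mu. mu ! j) = n"
      using assms(2) by (simp add: partitions_def sum_list_sum_nth atLeast0LessThan)
  qed
  finally show ?thesis .
qed

text \<open>The easy half of the Gale-Ryser theorem: row j of such a matrix has
  \<open>conj_part kap j\<close> ones in all, and at most k of them in the first k places.\<close>

lemma mcoeff_evec_dominated:
  assumes "kap \<in> partitions n" "mu \<in> partitions n" "mcoeff n (evec n kap) mu \<noteq> 0"
  shows "dominated mu kap"
proof -
  have kap: "is_partition kap" "sum_list kap = n" using assms(1) by (auto simp: partitions_def)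
  obtain R where "R \<in> margins n (length mu) (conj_part kap) (nth mu)"
    using assms(3) mcoeff_evec[OF assms(1,2)] by fastforce
  then have R: "R \<subseteq> {..<n} \<times> {..<length mu}" "\<And>j. j < n \<Longrightarrow> card {i. (j, i) \<in> R} = conj_part kap j"
    "\<And>i. i < length mu \<Longrightarrow> card {j. (j, i) \<in> R} = mu ! i" by (auto simp: margins_def)
  show ?thesis
  proof (rule dominated_if_columns[OF kap(1)])
    fix k
    let ?I = "{i. i < k \<and> i < length mu}"
    have "(\<Sum>i\<in>?I. mu ! i) = (\<Sum>i\<in>?I. card {j \<in> {..<n}. (j, i) \<in> R})"
    proof (rule sum.cong)
      fix i assume i: "i \<in> ?I"
      have "{j \<in> {..<n}. (j, i) \<in> R} = {j. (j, i) \<in> R}" using R(1) by auto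
      then show "mu ! i = card {j \<in> {..<n}. (j, i) \<in> R}" using R(3) i by simp
    qed simp
    also have "\<dots> = (\<Sum>j<n. card {i \<in> ?I. (j, i) \<in> R})" by (rule sum_card_swap) auto
    also have "\<dots> \<le> (\<Sum>j<n. min k (conj_part kap j))"
    proof (rule sum_mono)
      fix j assume "j \<in> {..<n}"
      then have "card {i. (j, i) \<in> R} = conj_part kap j" by (simp add: R(2))
      moreover have "finite {i. (j, i) \<in> R}" by (rule finite_subset[of _ "{..<length mu}"]) (use R(1) in auto)
      ultimately have "card {i \<in> ?I. (j, i) \<in> R} \<le> conj_part kap j" by (metis (no_types, lifting) card_mono mem_Collect_eq subsetI)
      moreover have "card {i \<in> ?I. (j, i) \<in> R} \<le> card {..<k}" by (rule card_mono) auto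
      ultimately show "card {i \<in> ?I. (j, i) \<in> R} \<le> min k (conj_part kap j)" by simp
    qed
    finally show "(\<Sum>i\<in>?I. mu ! i) \<le> (\<Sum>j<sum_list kap. min k (conj_part kap j))" by (simp add: kap(2))
  qed
qed

text \<open>The diagram of \<open>kap\<close> is itself a matrix with these margins.\<close>

lemma mcoeff_evec_diag:
  assumes "kap \<in> partitions n"
  shows "mcoeff n (evec n kap) kap \<noteq> 0"
proof -
  have kap: "is_partition kap" "sum_list kap = n" using assms(1) by (auto simp: partitions_def)
  let ?R = "{(j, i). i < length kap \<and> j < kap ! i}"
  have le: "kap ! i \<le> n" if "i < length kap" for i using nth_le_sum_list[OF that] kap by simp
  have "?R \<in> margins n (length kap) (conj_part kap) (nth kap)"
    using le by (fastforce simp: margins_def conj_part_def)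
  then have "card (margins n (length kap) (conj_part kap) (nth kap)) \<noteq> 0"
    using finite_margins by (metis card_0_eq empty_iff)
  then show ?thesis by (simp add: mcoeff_evec[OF assms assms])
qed

text \<open>The number z cancels, and the sign merges with the power of 2: every part of
  \<open>rho\<close>, later every loop, gets the weight -2.\<close>

lemma inner2_evec:
  assumes "kap \<in> partitions n"
  shows "inner2 n f (evec n kap) =
    (\<Sum>rho\<in>partitions n. f rho * ((-1) ^ n * (-2) ^ length rho * real (content_count rho n (conj_part kap))))"
  unfolding inner2_def
proof (rule sum.cong)
  fix rho assume rho: "rho \<in> partitions n"
  then have z: "real (zee rho) \<noteq> 0"
    using zee_pos[of rho] by (simp add: partitions_def is_partition_def)
  have s: "(-2 :: real) ^ length rho = (-1) ^ length rho * 2 ^ length rho"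
    by (simp flip: power_mult_distrib)
  show "f rho * evec n kap rho * 2 ^ length rho * real (zee rho) =
    f rho * ((-1) ^ n * (-2) ^ length rho * real (content_count rho n (conj_part kap)))"
    unfolding evec_def s power_add using rho z by simp
qed simp

text \<open>Each part of \<open>mu\<close> is a sum of at least one part of \<open>rho\<close>; if
  the lengths agree, nothing is merged.\<close>

lemma p_to_m_length:
  assumes "0 \<notin> set rho" "0 \<notin> set mu" "p_to_m rho mu \<noteq> 0"
  shows "length mu \<le> length rho" and "length mu = length rho \<Longrightarrow> mset mu = mset rho"
proof -
  obtain f where f: "f \<in> {..<length rho} \<rightarrow>\<^sub>E {..<length mu}"
    "\<And>j. j < length mu \<Longrightarrow> (\<Sum>i\<in>{i. i < length rho \<and> f i = j}. rho ! i) = mu ! j"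
  proof -
    have "{f \<in> {..<length rho} \<rightarrow>\<^sub>E {..<length mu}.
      \<forall>j<length mu. (\<Sum>i\<in>{i. i < length rho \<and> f i = j}. rho ! i) = mu ! j} \<noteq> {}"
      using assms(3) unfolding p_to_m_def by (intro notI) (simp only: card.empty)
    then show ?thesis using that by blast
  qed
  have "j \<in> f ` {..<length rho}" if "j < length mu" for j
  proof (rule ccontr)
    assume "j \<notin> f ` {..<length rho}"
    then have "{i. i < length rho \<and> f i = j} = {}" by auto
    then have "mu ! j = 0" using f(2)[OF that] by (simp only: sum.empty)
    then show False using assms(2) that by (metis nth_mem)
  qed
  then have surj: "f ` {..<length rho} = {..<length mu}" using f(1) by auto
  then show "length mu \<le> length rho" by (metis card_image_le card_lessThan finite_lessThan)
  assume len: "length mu = length rho"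
  then have inj: "inj_on f {..<length rho}" using surj by (intro eq_card_imp_inj_on) auto
  have nth: "mu ! f i = rho ! i" if "i < length rho" for i
  proof -
    have "f i < length mu" using f(1) that by auto
    moreover have "{i'. i' < length rho \<and> f i' = f i} = {i}" using inj that by (auto simp: inj_on_def)
    ultimately show ?thesis using f(2)[of "f i"] by simp
  qed
  have ms: "mset xs = image_mset (nth xs) (mset_set {..<length xs})" for xs :: "nat list"
    by (metis atLeast_upt map_nth mset_map mset_set_upto_eq_mset_upto)
  have "mset mu = image_mset (nth mu) (image_mset f (mset_set {..<length rho}))"
    using image_mset_mset_set[OF inj] surj ms[of mu] by simp
  also have "\<dots> = mset rho"
    unfolding ms[of rho] multiset.map_comp by (rule image_mset_cong) (simp add: nth)
  finally show "mset mu = mset rho" .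
qed

lemma p_to_m_diag: "p_to_m rho rho \<noteq> 0"
proof -
  let ?S = "{f \<in> {..<length rho} \<rightarrow>\<^sub>E {..<length rho}. \<forall>j<length rho. (\<Sum>i\<in>{i. i < length rho \<and> f i = j}. rho ! i) = rho ! j}"
  have single: "{i. i < length rho \<and> restrict id {..<length rho} i = j} = {j}" if "j < length rho" for j
    using that by auto
  have "\<forall>j<length rho. (\<Sum>i\<in>{i. i < length rho \<and> restrict id {..<length rho} i = j}. rho ! i) = rho ! j"
  proof (intro allI impI)
    fix j assume "j < length rho"
    from single[OF this] show "(\<Sum>i\<in>{i. i < length rho \<and> restrict id {..<length rho} i = j}. rho ! i) = rho ! j"
      by (simp only:) simp
  qed
  moreover have "restrict id {..<length rho} \<in> {..<length rho} \<rightarrow>\<^sub>E {..<length rho}" by auto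
  ultimately have "restrict id {..<length rho} \<in> ?S" by blast
  moreover have "finite ?S"
    by (rule finite_Collect_conjI) (simp add: finite_PiE)
  ultimately have "card ?S > 0" unfolding card_gt_0_iff by blast
  then show ?thesis unfolding p_to_m_def by simp
qed

text \<open>Triangularity with respect to length: if \<open>mu\<close> is longest in the support of
  \<open>g\<close>, then the power sum of \<open>mu\<close> alone contributes to its monomial
  coefficient.\<close>

lemma mcoeff_inj:
  assumes g: "degree_vec n g" and z: "\<And>mu. mu \<in> partitions n \<Longrightarrow> mcoeff n g mu = 0"
  shows "g = (\<lambda>_. 0)"
proof (rule ccontr)
  assume "g \<noteq> (\<lambda>_. 0)"
  define T where "T = {rho \<in> partitions n. g rho \<noteq> 0}"
  have "finite T" using finite_partitions by (simp add: T_def)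
  moreover have "T \<noteq> {}" using g \<open>g \<noteq> _\<close> by (auto simp: T_def degree_vec_def fun_eq_iff)
  ultimately obtain mu where mu: "mu \<in> T" "\<And>rho. rho \<in> T \<Longrightarrow> length rho \<le> length mu"
  proof -
    assume T: "finite T" "T \<noteq> {}"
    have "Max (length ` T) \<in> length ` T" using T by (intro Max_in) auto
    then obtain mu where "mu \<in> T" "length mu = Max (length ` T)" by auto
    then show ?thesis using that[of mu] T by simp
  qed
  have mup: "mu \<in> partitions n" using mu(1) by (simp add: T_def)
  have "g rho * real (p_to_m rho mu) = 0" if "rho \<in> partitions n - {mu}" for rho
  proof (rule ccontr)
    assume nz: "g rho * real (p_to_m rho mu) \<noteq> 0"
    then have "rho \<in> T" using that by (simp add: T_def)
    then have "length rho \<le> length mu" by (rule mu(2))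
    then have "mset mu = mset rho"
      using p_to_m_length[of rho mu] nz that mup by (auto simp: partitions_def is_partition_def)
    then have "mu = rho" using partition_eqI[OF mup] that by blast
    then show False using that by simp
  qed
  then have "mcoeff n g mu = g mu * real (p_to_m mu mu)"
    using sum.remove[OF finite_partitions mup, of "\<lambda>rho. g rho * real (p_to_m rho mu)"]
    by (simp add: mcoeff_def sum.neutral)
  then show False using z[OF mup] mu(1) p_to_m_diag[of mu] by (simp add: T_def)
qed

text \<open>A numerical statistic, strictly monotone for dominance on the partitions of n, which
  permits induction along the partial order. The range \<open>k \<le> n\<close> suffices because
  later partial sums are all n.\<close>

definition dom_weight :: "nat \<Rightarrow> nat list \<Rightarrow> nat" where
  "dom_weight n mu = (\<Sum>k\<le>n. sum_list (take k mu))"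

lemma dom_weight_less:
  assumes "mu \<in> partitions n" "lam \<in> partitions n" "dominated mu lam" "mu \<noteq> lam"
  shows "dom_weight n mu < dom_weight n lam"
proof -
  have le: "sum_list (take k mu) \<le> sum_list (take k lam)" for k using assms(3) by (simp add: dominated_def)
  have "\<not> dominated lam mu"
    using dominated_antisym[of mu lam] assms by (auto simp: partitions_def is_partition_def)
  then obtain k where k: "sum_list (take k mu) < sum_list (take k lam)" by (auto simp: dominated_def not_le)
  have "k \<le> n"
  proof (rule ccontr)
    assume "\<not> k \<le> n"
    then have "length mu \<le> k" "length lam \<le> k"
      using assms(1,2) length_le_sum_list[of mu] length_le_sum_list[of lam] by (auto simp: partitions_def is_partition_def)
    then show False using k assms(1,2) by (simp add: partitions_def)
  qed
  then show ?thesis unfolding dom_weight_def using le k by (intro sum_strict_mono_ex1) auto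
qed

lemma mcoeff_diff_sum:
  "mcoeff n (\<lambda>rho. f rho - (\<Sum>x\<in>A. c x * e x rho)) mu = mcoeff n f mu - (\<Sum>x\<in>A. c x * mcoeff n (e x) mu)"
  unfolding mcoeff_def
  by (simp add: left_diff_distrib sum_subtractf sum_distrib_right sum_distrib_left sum.swap[of _ A] mult.assoc)

lemma inner2_diff_sum:
  "inner2 n q (\<lambda>rho. f rho - (\<Sum>x\<in>A. c x * e x rho)) = inner2 n q f - (\<Sum>x\<in>A. c x * inner2 n q (e x))"
  unfolding inner2_def
  by (simp add: right_diff_distrib left_diff_distrib sum_subtractf sum_distrib_right sum_distrib_left sum.swap[of _ A] mult_ac)

text \<open>The vectors \<open>evec n kap\<close> with \<open>kap\<close> strictly below
  \<open>lam\<close> span all \<open>g\<close> whose monomials lie strictly below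
  \<open>lam\<close>. The induction clears the monomials of largest weight by subtracting such
  vectors.\<close>

lemma inner2_lower_eq_0:
  assumes lam: "lam \<in> partitions n"
    and q: "\<And>kap. kap \<in> partitions n \<Longrightarrow> dominated kap lam \<Longrightarrow> kap \<noteq> lam \<Longrightarrow> inner2 n q (evec n kap) = 0"
    and g: "degree_vec n g" "\<And>mu. mu \<in> partitions n \<Longrightarrow> mcoeff n g mu \<noteq> 0 \<Longrightarrow> dominated mu lam \<and> mu \<noteq> lam"
  shows "inner2 n q g = 0"
proof -
  define low where "low = (\<lambda>kap. kap \<in> partitions n \<and> dominated kap lam \<and> kap \<noteq> lam)"
  have "inner2 n q g = 0" if "degree_vec n g"
    "\<And>mu. mu \<in> partitions n \<Longrightarrow> mcoeff n g mu \<noteq> 0 \<Longrightarrow> low mu \<and> dom_weight n mu < w" for w g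
    using that
  proof (induction w arbitrary: g)
    case 0
    then have "g = (\<lambda>_. 0)" by (intro mcoeff_inj) auto
    then show ?case by (simp add: inner2_def)
  next
    case (Suc w)
    define K where "K = {kap. low kap \<and> dom_weight n kap = w}"
    have K: "finite K" by (rule finite_subset[OF _ finite_partitions[of n]]) (auto simp: K_def low_def)
    let ?c = "\<lambda>kap. mcoeff n g kap / mcoeff n (evec n kap) kap"
    let ?g = "\<lambda>rho. g rho - (\<Sum>kap\<in>K. ?c kap * evec n kap rho)"
    \<comment> \<open>Apart from its diagonal coefficient, the vector of \<open>kap\<close> lives on
      partitions of smaller weight that are still below \<open>lam\<close>. Clearing
      \<open>kap\<close> thus disturbs neither the other partitions of weight w nor the support
      condition.\<close>
    have off: "mcoeff n (evec n kap) mu = 0"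
      if "kap \<in> K" "mu \<in> partitions n" "\<not> (low mu \<and> dom_weight n mu < w)" "mu \<noteq> kap" for kap mu
    proof (rule ccontr)
      assume nz: "mcoeff n (evec n kap) mu \<noteq> 0"
      have kap: "kap \<in> partitions n" "dominated kap lam" "kap \<noteq> lam" "dom_weight n kap = w"
        using that(1) by (auto simp: K_def low_def)
      have d: "dominated mu kap" by (rule mcoeff_evec_dominated[OF kap(1) that(2) nz])
      have "dominated mu lam" using d kap(2) by (rule dominated_trans)
      moreover have "mu \<noteq> lam"
        using dominated_antisym[of kap lam] d kap that(2) by (auto simp: partitions_def is_partition_def)
      moreover have "dom_weight n mu < w" using dom_weight_less[OF that(2) kap(1) d that(4)] kap(4) by simp
      ultimately show False using that(2,3) by (simp add: low_def)
    qed
    have "inner2 n q ?g = 0"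
    proof (rule Suc.IH)
      show "degree_vec n ?g" using Suc.prems(1) by (simp add: degree_vec_def evec_def)
      fix mu assume mu: "mu \<in> partitions n" and nz: "mcoeff n ?g mu \<noteq> 0"
      show "low mu \<and> dom_weight n mu < w"
      proof (rule ccontr)
        assume nlow: "\<not> (low mu \<and> dom_weight n mu < w)"
        have "(\<Sum>kap\<in>K. ?c kap * mcoeff n (evec n kap) mu) = (\<Sum>kap\<in>K. if kap = mu then mcoeff n g mu else 0)"
        proof (rule sum.cong)
          fix kap assume kap: "kap \<in> K"
          show "?c kap * mcoeff n (evec n kap) mu = (if kap = mu then mcoeff n g mu else 0)"
            using off[OF kap mu nlow] mcoeff_evec_diag[OF mu] by auto
        qed simp
        also have "\<dots> = (if mu \<in> K then mcoeff n g mu else 0)" using K by simp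
        also have "\<dots> = mcoeff n g mu"
          using Suc.prems(2)[OF mu] nlow by (cases "mcoeff n g mu = 0") (auto simp: K_def)
        finally show False using nz unfolding mcoeff_diff_sum by simp
      qed
    qed
    moreover have "inner2 n q (evec n kap) = 0" if "kap \<in> K" for kap
      using q that by (simp add: K_def low_def)
    ultimately show ?case unfolding inner2_diff_sum by simp
  qed
  from this[of g "Suc (Max (dom_weight n ` partitions n))"] show ?thesis
    using g finite_partitions[of n] by (auto simp: low_def less_Suc_eq_le)
qed

text \<open>The difference of two solutions has all its monomials strictly below \<open>lam\<close>,
  so both solutions are orthogonal to it. It is then orthogonal to itself, and the scalar product is
  positive definite.\<close>

lemma jackP_cond_unique:
  assumes "jackP_cond lam f" "jackP_cond lam g"
  shows "f = g"
proof -
  define n where "n = sum_list lam"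
  define d where "d = (\<lambda>rho. f rho - g rho)"
  have f: "degree_vec n f" "mcoeff n f lam = 1" "\<forall>mu\<in>partitions n. \<not> dominated mu lam \<longrightarrow> mcoeff n f mu = 0"
    "\<And>h. degree_vec n h \<Longrightarrow> \<forall>mu\<in>partitions n. mcoeff n h mu \<noteq> 0 \<longrightarrow> dominated mu lam \<and> mu \<noteq> lam \<Longrightarrow> inner2 n f h = 0"
    using assms(1) by (simp_all add: jackP_cond_def Let_def n_def)
  have g: "degree_vec n g" "mcoeff n g lam = 1" "\<forall>mu\<in>partitions n. \<not> dominated mu lam \<longrightarrow> mcoeff n g mu = 0"
    "\<And>h. degree_vec n h \<Longrightarrow> \<forall>mu\<in>partitions n. mcoeff n h mu \<noteq> 0 \<longrightarrow> dominated mu lam \<and> mu \<noteq> lam \<Longrightarrow> inner2 n g h = 0"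
    using assms(2) by (simp_all add: jackP_cond_def Let_def n_def)
  have md: "mcoeff n d mu = mcoeff n f mu - mcoeff n g mu" for mu
    by (simp add: mcoeff_def d_def left_diff_distrib sum_subtractf)
  have dd: "degree_vec n d" using f(1) g(1) by (simp add: degree_vec_def d_def)
  have low: "\<forall>mu\<in>partitions n. mcoeff n d mu \<noteq> 0 \<longrightarrow> dominated mu lam \<and> mu \<noteq> lam"
  proof (intro ballI impI)
    fix mu assume mu: "mu \<in> partitions n" "mcoeff n d mu \<noteq> 0"
    have "mu \<noteq> lam" using mu(2) f(2) g(2) by (auto simp: md)
    moreover have "\<not> \<not> dominated mu lam"
    proof
      assume "\<not> dominated mu lam"
      then have "mcoeff n f mu = 0" "mcoeff n g mu = 0" using f(3) g(3) mu(1) by blast+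
      then show False using mu(2) by (simp add: md)
    qed
    ultimately show "dominated mu lam \<and> mu \<noteq> lam" by blast
  qed
  have "inner2 n d d = inner2 n f d - inner2 n g d"
    unfolding inner2_def by (simp add: d_def left_diff_distrib sum_subtractf)
  then have "inner2 n d d = 0" using f(4)[OF dd low] g(4)[OF dd low] by simp
  then have "\<forall>rho\<in>partitions n. d rho * d rho * 2 ^ length rho * real (zee rho) = 0"
    unfolding inner2_def by (subst (asm) sum_nonneg_eq_0_iff) (auto simp: finite_partitions)
  moreover have "zee rho \<noteq> 0" if "rho \<in> partitions n" for rho
    using that zee_pos[of rho] by (simp add: partitions_def is_partition_def)
  ultimately have "d rho = 0" for rho
    using dd by (cases "rho \<in> partitions n") (force simp: degree_vec_def)+
  then show ?thesis by (simp add: d_def fun_eq_iff)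
qed

lemma hook2_pos: "hook2 lam > 0"
  unfolding hook2_def by (rule prod_pos) auto

text \<open>The quotient of \<open>F\<close> by the hook product satisfies the defining conditions,
  so uniqueness evaluates the definite description. Orthogonality is requested as a dominance
  statement: for \<open>kap\<close> strictly below \<open>lam\<close> its conclusion contradicts
  antisymmetry.\<close>

lemma zonal_eqI:
  assumes lam: "is_partition lam" and n: "n = sum_list lam" and F: "degree_vec n F"
    and lead: "mcoeff n F lam = hook2 lam"
    and tri: "\<And>mu. mu \<in> partitions n \<Longrightarrow> mcoeff n F mu \<noteq> 0 \<Longrightarrow> dominated mu lam"
    and orth: "\<And>kap. kap \<in> partitions n \<Longrightarrow> inner2 n F (evec n kap) \<noteq> 0 \<Longrightarrow> dominated lam kap"
  shows "zonal lam = F"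
proof -
  let ?f = "\<lambda>rho. F rho / hook2 lam"
  have lamn: "lam \<in> partitions n" using lam n by (simp add: partitions_def)
  have m: "mcoeff n ?f mu = mcoeff n F mu / hook2 lam" for mu
    by (simp add: mcoeff_def sum_divide_distrib)
  have i: "inner2 n ?f g = inner2 n F g / hook2 lam" for g
    by (simp add: inner2_def sum_divide_distrib)
  have "inner2 n F g = 0" if "degree_vec n g" "\<forall>mu\<in>partitions n. mcoeff n g mu \<noteq> 0 \<longrightarrow> dominated mu lam \<and> mu \<noteq> lam" for g
  proof (rule inner2_lower_eq_0[OF lamn _ that(1)])
    fix kap assume kap: "kap \<in> partitions n" "dominated kap lam" "kap \<noteq> lam"
    then have "\<not> dominated lam kap"
      using dominated_antisym[of kap lam] lamn by (auto simp: partitions_def is_partition_def)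
    then show "inner2 n F (evec n kap) = 0" using orth kap(1) by blast
  qed (use that(2) in blast)
  then have "jackP_cond lam ?f"
    unfolding jackP_cond_def Let_def n[symmetric] using F lead tri hook2_pos[of lam]
    by (auto simp: m i degree_vec_def)
  then have "jackP2 lam = ?f"
    unfolding jackP2_def using jackP_cond_unique by blast
  then show ?thesis using hook2_pos[of lam] by (simp add: zonal_def)
qed

section \<open>The sum over admissible couples\<close>

lemma pairpart_iff: "pairpart n f \<longleftrightarrow> f \<in> matchings {1..2 * n}"
  by (auto simp: pairpart_def matchings_def)

lemma loops_loop_set: "loops n A B = loop_set {1..2 * n} A B"
  by (simp add: loops_def loop_set_def loop_rel_def)

lemma length_loop_type: "length (loop_type n A B) = card (loop_set {1..2 * n} A B)"
proof -
  have "length (sorted_list_of_multiset M) = size M" for M :: "nat multiset"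
    by (metis mset_sorted_list_of_multiset size_mset)
  then show ?thesis by (simp add: loop_type_def loops_loop_set)
qed

lemma mset_loop_type: "mset (loop_type n A B) = image_mset (\<lambda>C. card C div 2) (mset_set (loop_set {1..2 * n} A B))"
  by (simp add: loop_type_def loops_loop_set)

lemma loop_type_partition:
  assumes "matching_on {1..2 * n} A" "matching_on {1..2 * n} B"
  shows "loop_type n A B \<in> partitions n"
proof -
  let ?V = "{1..2 * n}" and ?M = "image_mset (\<lambda>C. card C div 2) (mset_set (loop_set {1..2 * n} A B))"
  have fin: "finite (loop_set ?V A B)" by (simp add: finite_loop_set)
  have C: "card C = 2 * (card C div 2)" "finite C" "card C div 2 \<noteq> 0" if CL: "C \<in> loop_set ?V A B" for C
  proof -
    show fC: "finite C" using finite_subset[OF loop_set_subset[OF assms CL]] by simp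
    then have "even (card C)" using loop_matching_on[OF assms CL] by (rule matching_on_even)
    then show e: "card C = 2 * (card C div 2)" by simp
    obtain v where "v \<in> ?V" "C = loop_rel ?V A B `` {v}"
      using CL unfolding loop_set_def quotient_def by blast
    then have "v \<in> C" using loop_class_eq[OF assms _ CL] by blast
    then have "card C \<noteq> 0" using fC by auto
    then show "card C div 2 \<noteq> 0" using e by auto
  qed
  have "2 * n = card (\<Union>(loop_set ?V A B))" unfolding Union_loop_set[OF assms] by simp
  also have "\<dots> = (\<Sum>C\<in>loop_set ?V A B. card C)"
    by (rule card_Union_disjoint) (use disjoint_loop_set[OF assms] C in \<open>auto simp: pairwise_def disjnt_def\<close>)
  also have "\<dots> = 2 * (\<Sum>C\<in>loop_set ?V A B. card C div 2)"
    unfolding sum_distrib_left by (rule sum.cong) (use C in auto)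
  finally have "sum_mset ?M = n" by (simp add: sum_unfold_sum_mset)
  moreover have "0 \<notin># ?M" using C(3) fin by fastforce
  ultimately have "partition_of ?M \<in> partitions n" by (simp add: partition_of_in_partitions)
  moreover have "partition_of ?M = loop_type n A B"
    by (simp add: partition_of_def loop_type_def loops_loop_set)
  ultimately show ?thesis by simp
qed

lemma content_count_loop_type:
  assumes "matching_on {1..2 * n} A" "matching_on {1..2 * n} B"
  shows "content_count (loop_type n A B) L b =
    card {f \<in> invcol {1..2 * n} {..<L} A B. \<forall>j<L. card {v \<in> {1..2 * n}. f v = j} = 2 * b j}"
proof -
  have "content_count (loop_type n A B) L b = colcount (loop_set {1..2 * n} A B) (\<lambda>C. card C div 2) L b"
    by (rule colcount_image_mset[symmetric]) (simp_all add: finite_loop_set mset_loop_type)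
  then show ?thesis
    using card_invcol_content[OF _ assms, of "{..<L}" b] by (simp add: colcount_def Ball_def)
qed

text \<open>The colouring is fixed before the matching. The matching then has to preserve the pair
  of \<open>h\<close> and colour, which is again a sum over some \<open>respecting\<close>.\<close>

lemma sum_respecting_swap:
  fixes w :: "('a \<Rightarrow> 'a) \<Rightarrow> real"
  assumes "finite V" "finite L"
  shows "(\<Sum>B\<in>respecting V h. w B * real (card {f \<in> invcol V L A B. P f})) =
    (\<Sum>f\<in>{f \<in> V \<rightarrow>\<^sub>E L. (\<forall>v\<in>V. f (A v) = f v) \<and> P f}. \<Sum>B\<in>respecting V (\<lambda>v. (h v, f v)). w B)"
proof -
  let ?G = "{f \<in> V \<rightarrow>\<^sub>E L. (\<forall>v\<in>V. f (A v) = f v) \<and> P f}"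
  have fin: "finite ?G" using assms by (simp add: finite_PiE)
  have "w B * real (card {f \<in> invcol V L A B. P f}) = (\<Sum>f\<in>?G. if \<forall>v\<in>V. f (B v) = f v then w B else 0)" for B
  proof -
    have "{f \<in> invcol V L A B. P f} = {f \<in> ?G. \<forall>v\<in>V. f (B v) = f v}" by (auto simp: invcol_def)
    then show ?thesis by (simp add: sum.inter_filter[OF fin, symmetric])
  qed
  then have "(\<Sum>B\<in>respecting V h. w B * real (card {f \<in> invcol V L A B. P f})) =
    (\<Sum>f\<in>?G. \<Sum>B\<in>respecting V h. if \<forall>v\<in>V. f (B v) = f v then w B else 0)"
    by (simp add: sum.swap[of _ ?G])
  also have "\<dots> = (\<Sum>f\<in>?G. \<Sum>B\<in>respecting V (\<lambda>v. (h v, f v)). w B)"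
  proof (rule sum.cong)
    fix f
    have "respecting V (\<lambda>v. (h v, f v)) = {B \<in> respecting V h. \<forall>v\<in>V. f (B v) = f v}"
      by (auto simp: respecting_def)
    then show "(\<Sum>B\<in>respecting V h. if \<forall>v\<in>V. f (B v) = f v then w B else 0) =
      (\<Sum>B\<in>respecting V (\<lambda>v. (h v, f v)). w B)"
      by (simp add: sum.inter_filter[OF finite_respecting[OF assms(1)], symmetric])
  qed simp
  finally show ?thesis .
qed

text \<open>The right-hand side of the theorem as a coordinate vector.\<close>

definition zvec :: "nat list \<Rightarrow> nat list \<Rightarrow> real" where
  "zvec lam rho = (\<Sum>(S1, S2)\<in>{(S1, S2). admissible lam S1 S2 \<and> loop_type (sum_list lam) S1 S2 = rho}.
     loop_sign (sum_list lam) (Sstd (sum_list lam)) S1)"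

definition colmatch :: "nat list \<Rightarrow> (nat \<Rightarrow> nat) set" where
  "colmatch lam = {S1 \<in> matchings {1..2 * sum_list lam}.
     \<forall>k\<in>{1..2 * sum_list lam}. colT lam (Sstd (sum_list lam) (S1 k)) = colT lam k}"

lemma finite_colmatch: "finite (colmatch lam)"
  unfolding colmatch_def using finite_matchings[of "{1..2 * sum_list lam}"] by simp

lemma colmatch_matching_on: "A \<in> colmatch lam \<Longrightarrow> matching_on {1..2 * sum_list lam} A"
  by (simp add: colmatch_def matchings_iff)

lemma admissible_iff:
  "admissible lam S1 S2 \<longleftrightarrow> S1 \<in> colmatch lam \<and> S2 \<in> respecting {1..2 * sum_list lam} (rowT lam)"
  by (auto simp: admissible_def Let_def colmatch_def respecting_def pairpart_iff)

lemma degree_vec_zvec: "degree_vec (sum_list lam) (zvec lam)"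
  unfolding degree_vec_def
proof (intro allI impI)
  fix rho assume "rho \<notin> partitions (sum_list lam)"
  then have "{(S1, S2). admissible lam S1 S2 \<and> loop_type (sum_list lam) S1 S2 = rho} = {}"
    using loop_type_partition colmatch_matching_on respecting_matching_on by (force simp: admissible_iff)
  then show "zvec lam rho = 0" unfolding zvec_def by (simp only: sum.empty)
qed

text \<open>Monomial coefficients and pairings with \<open>evec\<close> are both linear in the
  coordinates; either becomes a sum over couples in which the two matchings vary
  independently.\<close>

lemma sum_zvec:
  "(\<Sum>rho\<in>partitions (sum_list lam). zvec lam rho * \<phi> rho) =
    (\<Sum>A\<in>colmatch lam. loop_sign (sum_list lam) (Sstd (sum_list lam)) A *
       (\<Sum>B\<in>respecting {1..2 * sum_list lam} (rowT lam). \<phi> (loop_type (sum_list lam) A B)))"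
proof -
  define n where "n = sum_list lam"
  define X where "X = colmatch lam \<times> respecting {1..2 * n} (rowT lam)"
  let ?s = "\<lambda>A. loop_sign n (Sstd n) A" and ?t = "\<lambda>p. loop_type n (fst p) (snd p)"
  have fin: "finite X" unfolding X_def by (simp add: finite_colmatch finite_respecting)
  have "(\<Sum>rho\<in>partitions n. zvec lam rho * \<phi> rho) =
    (\<Sum>rho\<in>partitions n. \<Sum>p\<in>{p \<in> X. ?t p = rho}. ?s (fst p) * \<phi> (?t p))"
  proof (rule sum.cong)
    fix rho
    have "{(S1, S2). admissible lam S1 S2 \<and> loop_type (sum_list lam) S1 S2 = rho} = {p \<in> X. ?t p = rho}"
      by (auto simp: X_def admissible_iff n_def)
    then show "zvec lam rho * \<phi> rho = (\<Sum>p\<in>{p \<in> X. ?t p = rho}. ?s (fst p) * \<phi> (?t p))"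
      by (simp add: zvec_def sum_distrib_right case_prod_unfold n_def)
  qed simp
  also have "\<dots> = (\<Sum>p\<in>X. ?s (fst p) * \<phi> (?t p))"
  proof (rule sum.group)
    show "?t ` X \<subseteq> partitions n"
      using loop_type_partition colmatch_matching_on respecting_matching_on by (force simp: X_def n_def)
  qed (use fin finite_partitions in auto)
  also have "\<dots> = (\<Sum>A\<in>colmatch lam. ?s A * (\<Sum>B\<in>respecting {1..2 * n} (rowT lam). \<phi> (loop_type n A B)))"
    by (simp add: X_def sum.cartesian_product[symmetric] case_prod_unfold sum_distrib_left sum.cartesian_product)
  finally show ?thesis by (simp add: n_def)
qed

section \<open>Coordinates on the tableau\<close>

locale tableau =
  fixes lam :: "nat list"
  assumes partition: "is_partition lam"
begin

definition n where "n = sum_list lam"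
definition V where "V = {1..2 * n}"

abbreviation c where "c \<equiv> conj_part lam"

text \<open>The doubled shape is \<open>lam\<close> with each column repeated: i is the row, j the
  column of \<open>lam\<close>, and b = 0 or 1 selects the left or right copy, which are the columns
  2j + 1 and 2j + 2 of the tableau. In these coordinates the standard matching flips b, and left
  boxes carry odd labels.\<close>

definition box :: "nat \<Rightarrow> nat \<Rightarrow> nat \<Rightarrow> nat" where
  "box i j b = 2 * sum_list (take i lam) + 2 * j + 1 + b"

lemma finite_V [simp]: "finite V"
  by (simp add: V_def)

lemma less_c: "i < c j \<longleftrightarrow> i < length lam \<and> j < lam ! i"
  by (rule less_conj_part_iff[OF partition])

lemma less_c_n: "i < c j \<Longrightarrow> j < n"
  using nth_le_sum_list[of i lam] by (auto simp: less_c n_def)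

lemma sum_list_take_Suc: "i < length lam \<Longrightarrow> sum_list (take (Suc i) lam) = sum_list (take i lam) + lam ! i"
  by (simp add: take_Suc_conv_app_nth)

lemma sum_list_take_mono: "i \<le> k \<Longrightarrow> sum_list (take i lam) \<le> sum_list (take k lam)"
  by (simp add: sum_list_take sum_mono2 Collect_mono)

lemma sum_list_take_le: "sum_list (take i lam) \<le> n"
  using sum_list_take_mono[of i "max i (length lam)"] by (simp add: n_def)

lemma box_bound:
  assumes "i < c j" "b < 2"
  shows "box i j b \<le> 2 * sum_list (take (Suc i) lam)"
  using assms sum_list_take_Suc[of i] by (auto simp: box_def less_c)

lemma box_in_V: "i < c j \<Longrightarrow> b < 2 \<Longrightarrow> box i j b \<in> V"
  using box_bound[of i j b] sum_list_take_le[of "Suc i"] by (auto simp: V_def box_def)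

lemma rowT_box:
  assumes "i < c j" "b < 2"
  shows "rowT lam (box i j b) = i"
  unfolding rowT_def
proof (rule Least_equality)
  show "box i j b \<le> 2 * sum_list (take (Suc i) lam)" by (rule box_bound[OF assms])
  fix r assume "box i j b \<le> 2 * sum_list (take (Suc r) lam)"
  then have "\<not> sum_list (take (Suc r) lam) \<le> sum_list (take i lam)" by (simp add: box_def)
  then have "\<not> Suc r \<le> i" using sum_list_take_mono by blast
  then show "i \<le> r" by simp
qed

lemma colT_box: "i < c j \<Longrightarrow> b < 2 \<Longrightarrow> colT lam (box i j b) = 2 * j + 1 + b"
  by (simp add: colT_def rowT_box) (simp add: box_def)

lemma box_eq_iff:
  assumes "i < c j" "b < 2" "i' < c j'" "b' < 2"
  shows "box i j b = box i' j' b' \<longleftrightarrow> i = i' \<and> j = j' \<and> b = b'"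
proof
  assume eq: "box i j b = box i' j' b'"
  then have "i = i'" using rowT_box assms by metis
  moreover have "2 * j + 1 + b = 2 * j' + 1 + b'" using eq colT_box assms by metis
  ultimately show "i = i' \<and> j = j' \<and> b = b'" using assms by presburger
qed simp

lemma even_box: "even (box i j b) \<longleftrightarrow> odd b"
  by (simp add: box_def)

lemma box_cases:
  assumes "k \<in> V"
  obtains i j b where "i < c j" "j < n" "b < 2" "k = box i j b"
proof -
  let ?P = "\<lambda>r. k \<le> 2 * sum_list (take (Suc r) lam)"
  define i where "i = (LEAST r. ?P r)"
  have "?P (length lam)" using assms by (simp add: V_def n_def)
  then have Pi: "?P i" unfolding i_def by (rule LeastI)
  have lo: "2 * sum_list (take i lam) < k"
  proof (cases i)
    case 0
    then show ?thesis using assms by (simp add: V_def)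
  next
    case (Suc r)
    then have "\<not> ?P r" unfolding i_def by (intro not_less_Least) simp
    then show ?thesis using Suc by simp
  qed
  have i: "i < length lam"
  proof (rule ccontr)
    assume "\<not> i < length lam"
    then show False using lo Pi by simp
  qed
  \<comment> \<open>The 0-based position in the row; its quotient and remainder modulo 2 are j and
    b.\<close>
  define d where "d = k - 2 * sum_list (take i lam) - 1"
  have d: "k = 2 * sum_list (take i lam) + d + 1" using lo by (simp add: d_def)
  have "d < 2 * lam ! i" using Pi sum_list_take_Suc[OF i] d by simp
  then have ij: "i < c (d div 2)" using i by (simp add: less_c)
  show ?thesis
  proof (rule that[OF ij less_c_n[OF ij]])
    show "d mod 2 < 2" by simp
    show "k = box i (d div 2) (d mod 2)" using d by (simp add: box_def)
  qed
qed

lemma Sstd_box: "i < c j \<Longrightarrow> b < 2 \<Longrightarrow> Sstd n (box i j b) = box i j (1 - b)"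
  using box_in_V[of i j b] by (auto simp: Sstd_def V_def even_box less_2_cases_iff) (auto simp: box_def)

lemma bij_betw_box: "bij_betw (\<lambda>(j, i, b). box i j b) (Sigma {..<n} (\<lambda>j. {..<c j} \<times> {..<2})) V"
  unfolding bij_betw_def
proof
  show "inj_on (\<lambda>(j, i, b). box i j b) (Sigma {..<n} (\<lambda>j. {..<c j} \<times> {..<2}))"
    by (auto simp: inj_on_def box_eq_iff)
  show "(\<lambda>(j, i, b). box i j b) ` Sigma {..<n} (\<lambda>j. {..<c j} \<times> {..<2}) = V"
  proof
    show "V \<subseteq> (\<lambda>(j, i, b). box i j b) ` Sigma {..<n} (\<lambda>j. {..<c j} \<times> {..<2})"
      by (rule subsetI, erule box_cases) force
  qed (auto simp: box_in_V)
qed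

lemma prod_V:
  fixes g :: "nat \<Rightarrow> 'b::comm_monoid_mult"
  shows "(\<Prod>v\<in>V. g v) = (\<Prod>j<n. (\<Prod>i<c j. g (box i j 0)) * (\<Prod>i<c j. g (box i j 1)))"
proof -
  have "(\<Prod>v\<in>V. g v) = (\<Prod>(j, i, b)\<in>Sigma {..<n} (\<lambda>j. {..<c j} \<times> {..<2}). g (box i j b))"
    using prod.reindex_bij_betw[OF bij_betw_box, of g] by (simp add: case_prod_unfold)
  also have "\<dots> = (\<Prod>j<n. \<Prod>(i, b)\<in>{..<c j} \<times> {..<2}. g (box i j b))"
    by (subst prod.Sigma) auto
  also have "\<dots> = (\<Prod>j<n. \<Prod>i<c j. \<Prod>b<2. g (box i j b))"
    by (simp add: prod.cartesian_product)
  finally show ?thesis by (simp add: numeral_2_eq_2 prod.distrib)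
qed

lemma sum_V:
  fixes g :: "nat \<Rightarrow> 'b::comm_monoid_add"
  shows "(\<Sum>v\<in>V. g v) = (\<Sum>j<n. (\<Sum>i<c j. g (box i j 0)) + (\<Sum>i<c j. g (box i j 1)))"
proof -
  have "(\<Sum>v\<in>V. g v) = (\<Sum>(j, i, b)\<in>Sigma {..<n} (\<lambda>j. {..<c j} \<times> {..<2}). g (box i j b))"
    using sum.reindex_bij_betw[OF bij_betw_box, of g] by (simp add: case_prod_unfold)
  also have "\<dots> = (\<Sum>j<n. \<Sum>(i, b)\<in>{..<c j} \<times> {..<2}. g (box i j b))"
    by (subst sum.Sigma) auto
  also have "\<dots> = (\<Sum>j<n. \<Sum>i<c j. \<Sum>b<2. g (box i j b))"
    by (simp add: sum.cartesian_product)
  finally show ?thesis by (simp add: numeral_2_eq_2 sum.distrib)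
qed

lemma card_row_less: "card {v \<in> V. rowT lam v < k} = 2 * sum_list (take k lam)"
proof -
  have "card {v \<in> V. rowT lam v < k} = (\<Sum>v\<in>V. if rowT lam v < k then 1 else 0)"
    by (simp add: sum.inter_filter[symmetric])
  also have "\<dots> = (\<Sum>j<n. 2 * (\<Sum>i<c j. if i < k then 1 else 0))"
    unfolding sum_V by (intro sum.cong refl) (simp add: rowT_box mult_2)
  also have "\<dots> = 2 * (\<Sum>j<n. min k (c j))"
  proof -
    have "(\<Sum>i<m. if i < k then 1 else (0::nat)) = min k m" for m
    proof -
      have "{i \<in> {..<m}. i < k} = {..<min k m}" by auto
      then show ?thesis by (simp add: sum.inter_filter[symmetric])
    qed
    then show ?thesis by (simp add: sum_distrib_left)
  qed
  finally show ?thesis by (simp add: n_def sum_min_conj_part[OF partition])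
qed

text \<open>Only colourings that use every colour at most twice in each row survive, which forces
  the shape to be dominated.\<close>

lemma inner2_zvec_evec:
  assumes kap: "kap \<in> partitions n" and nz: "inner2 n (zvec lam) (evec n kap) \<noteq> 0"
  shows "dominated lam kap"
proof -
  have kap': "is_partition kap" "sum_list kap = n" using kap by (auto simp: partitions_def)
  let ?P = "\<lambda>f. \<forall>j<n. card {v \<in> V. f v = j} = 2 * conj_part kap j"
  let ?G = "\<lambda>A. {f \<in> V \<rightarrow>\<^sub>E {..<n}. (\<forall>v\<in>V. f (A v) = f v) \<and> ?P f}"
  let ?Z = "\<lambda>A f. \<Sum>B\<in>respecting V (\<lambda>v. (rowT lam v, f v)). (-1 :: real) ^ n * (-2) ^ card (loop_set V A B)"
  have "inner2 n (zvec lam) (evec n kap) = (\<Sum>A\<in>colmatch lam. loop_sign n (Sstd n) A *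
      (\<Sum>B\<in>respecting V (rowT lam). (-1) ^ n * (-2) ^ length (loop_type n A B) * real (content_count (loop_type n A B) n (conj_part kap))))"
    unfolding inner2_evec[OF kap] using sum_zvec[of lam "\<lambda>rho. (-1) ^ n * (-2) ^ length rho * real (content_count rho n (conj_part kap))"]
    by (simp add: n_def V_def)
  also have "\<dots> = (\<Sum>A\<in>colmatch lam. loop_sign n (Sstd n) A *
      (\<Sum>B\<in>respecting V (rowT lam). (-1) ^ n * (-2) ^ card (loop_set V A B) * real (card {f \<in> invcol V {..<n} A B. ?P f})))"
  proof (rule sum.cong[OF refl], rule arg_cong[where f = "times _"], rule sum.cong[OF refl])
    fix A B assume A: "A \<in> colmatch lam" and B: "B \<in> respecting V (rowT lam)"
    have m: "matching_on {1..2 * n} A" "matching_on {1..2 * n} B"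
      using colmatch_matching_on[OF A] respecting_matching_on[OF B] by (simp_all add: n_def V_def)
    show "(-1) ^ n * (-2) ^ length (loop_type n A B) * real (content_count (loop_type n A B) n (conj_part kap)) =
      (-1) ^ n * (-2) ^ card (loop_set V A B) * real (card {f \<in> invcol V {..<n} A B. ?P f})"
      unfolding content_count_loop_type[OF m] unfolding length_loop_type V_def ..
  qed
  also have "\<dots> = (\<Sum>A\<in>colmatch lam. loop_sign n (Sstd n) A *
      (\<Sum>f\<in>?G A. ?Z A f))"
    by (subst sum_respecting_swap) simp_all
  finally have "(\<Sum>A\<in>colmatch lam. loop_sign n (Sstd n) A *
      (\<Sum>f\<in>?G A. ?Z A f)) \<noteq> 0"
    using nz by simp
  then obtain A where A: "A \<in> colmatch lam" and "loop_sign n (Sstd n) A *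
      (\<Sum>f\<in>?G A. ?Z A f) \<noteq> 0"
    by (rule sum.not_neutral_contains_not_neutral)
  then have "(\<Sum>f\<in>?G A. ?Z A f) \<noteq> 0"
    by (simp only: mult_eq_0_iff) blast
  then obtain f where f: "f \<in> ?G A" and
    "?Z A f \<noteq> 0"
    by (rule sum.not_neutral_contains_not_neutral)
  then have nzB: "(\<Sum>B\<in>respecting V (\<lambda>v. (rowT lam v, f v)). (-2 :: real) ^ card (loop_set V A B)) \<noteq> 0"
    unfolding sum_distrib_left[symmetric] by (simp only: mult_eq_0_iff) blast
  have mA: "matching_on V A" using colmatch_matching_on[OF A] by (simp add: V_def n_def)
  have small: "card {v \<in> V. (rowT lam v, f v) = z} \<le> 2" for z
    using sum_respecting_loops_eq_0[OF finite_V mA, of "\<lambda>v. (rowT lam v, f v)" z] nzB by linarith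
  \<comment> \<open>The boxes of the first k rows are counted by colour: colour j is used
    \<open>2 * conj_part kap j\<close> times in all, and at most twice in each row.\<close>
  have "2 * sum_list (take k lam) \<le> 2 * sum_list (take k kap)" for k
  proof -
    have fn: "f v < n" if "v \<in> V" for v using f that by auto
    have "2 * sum_list (take k lam) = card {v \<in> V. rowT lam v < k}" by (simp add: card_row_less)
    also have "{v \<in> V. rowT lam v < k} = (\<Union>j<n. {v \<in> V. rowT lam v < k \<and> f v = j})" using fn by auto
    also have "card \<dots> \<le> (\<Sum>j<n. card {v \<in> V. rowT lam v < k \<and> f v = j})"
      by (rule card_UN_le) simp
    also have "\<dots> \<le> (\<Sum>j<n. 2 * min k (conj_part kap j))"
    proof (rule sum_mono)
      fix j assume j: "j \<in> {..<n}"
      have "card {v \<in> V. rowT lam v < k \<and> f v = j} \<le> card {v \<in> V. f v = j}" by (rule card_mono) auto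
      also have "\<dots> = 2 * conj_part kap j" using f j by simp
      finally have 1: "card {v \<in> V. rowT lam v < k \<and> f v = j} \<le> 2 * conj_part kap j" .
      have "{v \<in> V. rowT lam v < k \<and> f v = j} = (\<Union>i<k. {v \<in> V. (rowT lam v, f v) = (i, j)})" by auto
      also have "card \<dots> \<le> (\<Sum>i<k. card {v \<in> V. (rowT lam v, f v) = (i, j)})"
        by (rule card_UN_le) simp
      also have "\<dots> \<le> (\<Sum>i<k. 2)" by (rule sum_mono) (rule small)
      finally show "card {v \<in> V. rowT lam v < k \<and> f v = j} \<le> 2 * min k (conj_part kap j)" using 1 by simp
    qed
    also have "\<dots> = 2 * sum_list (take k kap)"
      using sum_min_conj_part[OF kap'(1), of k] by (simp add: kap'(2) flip: sum_distrib_left)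
    finally show ?thesis .
  qed
  then show ?thesis by (simp add: dominated_def)
qed

section \<open>First matchings as families of column permutations\<close>

definition cm :: "(nat \<Rightarrow> nat \<Rightarrow> nat) \<Rightarrow> nat \<Rightarrow> nat" where
  "cm \<sigma> v = (if v \<in> V then
     (let i = rowT lam v; j = (colT lam v - 1) div 2 in
       if odd (colT lam v) then box (\<sigma> j i) j 1 else box (inv (\<sigma> j) i) j 0) else v)"

definition col_perms :: "(nat \<Rightarrow> nat \<Rightarrow> nat) set" where
  "col_perms = {\<sigma>. \<forall>j<n. \<sigma> j permutes {..<c j}}"

lemma cm_outside: "v \<notin> V \<Longrightarrow> cm \<sigma> v = v"
  by (simp add: cm_def)

lemma Sstd_outside: "v \<notin> V \<Longrightarrow> Sstd n v = v"
  unfolding V_def Sstd_def by (simp only: if_False)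

lemma cm_box:
  assumes "i < c j"
  shows "cm \<sigma> (box i j 0) = box (\<sigma> j i) j 1" "cm \<sigma> (box i j 1) = box (inv (\<sigma> j) i) j 0"
  using assms by (simp_all add: cm_def box_in_V rowT_box colT_box Let_def)

lemma col_permsD:
  assumes "\<sigma> \<in> col_perms" "i < c j"
  shows "\<sigma> j permutes {..<c j}" "\<sigma> j i < c j" "inv (\<sigma> j) i < c j" "inv (\<sigma> j) (\<sigma> j i) = i" "\<sigma> j (inv (\<sigma> j) i) = i"
proof -
  show p: "\<sigma> j permutes {..<c j}" using assms less_c_n by (simp add: col_perms_def)
  show "\<sigma> j i < c j" using permutes_in_image[OF p, of i] assms(2) by simp
  show "inv (\<sigma> j) i < c j" using permutes_in_image[OF permutes_inv[OF p], of i] assms(2) by simp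
  show "inv (\<sigma> j) (\<sigma> j i) = i" "\<sigma> j (inv (\<sigma> j) i) = i" using permutes_inverses[OF p] by auto
qed

lemma less_2_cases': "b < 2 \<Longrightarrow> b = 0 \<or> b = (1::nat)"
  by auto

lemma cm_matching_on:
  assumes "\<sigma> \<in> col_perms"
  shows "matching_on V (cm \<sigma>)"
  unfolding matching_on_def
proof
  fix v assume "v \<in> V"
  then obtain i j b where v: "i < c j" "b < 2" "v = box i j b" by (rule box_cases)
  note p = col_permsD[OF assms v(1)]
  show "cm \<sigma> v \<in> V \<and> cm \<sigma> v \<noteq> v \<and> cm \<sigma> (cm \<sigma> v) = v"
    using less_2_cases'[OF v(2)] p v(1) by (auto simp: v(3) cm_box box_in_V box_eq_iff simp del: One_nat_def)
qed

lemma cm_colmatch: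
  assumes "\<sigma> \<in> col_perms"
  shows "cm \<sigma> \<in> colmatch lam"
proof -
  have "colT lam (Sstd n (cm \<sigma> v)) = colT lam v" if "v \<in> V" for v
  proof -
    obtain i j b where v: "i < c j" "b < 2" "v = box i j b" using \<open>v \<in> V\<close> by (rule box_cases)
    note p = col_permsD[OF assms v(1)]
    show ?thesis
      using less_2_cases'[OF v(2)] p v(1) by (auto simp: v(3) cm_box Sstd_box colT_box simp del: One_nat_def)
  qed
  moreover have "cm \<sigma> \<in> matchings V"
    using cm_matching_on[OF assms] by (simp add: matchings_iff cm_def)
  ultimately show ?thesis by (simp add: colmatch_def n_def V_def)
qed

text \<open>The standard matching flips the last coordinate. For the composition to preserve
  columns, a left box must go to a right box of the same pair of columns; only the row is free, and
  it becomes \<open>\<sigma> j i\<close>.\<close>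

lemma colmatch_box:
  assumes A: "A \<in> colmatch lam" and i: "i < c j"
  shows "rowT lam (A (box i j 0)) < c j" "A (box i j 0) = box (rowT lam (A (box i j 0))) j 1"
proof -
  have v: "box i j 0 \<in> V" by (rule box_in_V[OF i]) simp
  have "A (box i j 0) \<in> V"
    using matching_onD(1)[OF colmatch_matching_on[OF A]] v by (simp add: V_def n_def)
  then obtain i' j' b' where b: "i' < c j'" "b' < 2" "A (box i j 0) = box i' j' b'" by (rule box_cases)
  have "colT lam (Sstd n (A (box i j 0))) = colT lam (box i j 0)"
    using A v by (simp add: colmatch_def V_def n_def)
  then have "2 * j' + 1 + (1 - b') = 2 * j + 1"
    using b i by (simp add: Sstd_box colT_box)
  then have "j' = j" "b' = 1" using b(2) by presburger+
  then show "rowT lam (A (box i j 0)) < c j" "A (box i j 0) = box (rowT lam (A (box i j 0))) j 1"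
    using b by (simp_all add: rowT_box)
qed

abbreviation col_fam :: "(nat \<Rightarrow> nat \<Rightarrow> nat) set" where
  "col_fam \<equiv> Pi\<^sub>E {..<n} (\<lambda>j. {p. p permutes {..<c j}})"

lemma col_fam_col_perms: "\<sigma> \<in> col_fam \<Longrightarrow> \<sigma> \<in> col_perms"
  by (auto simp: col_perms_def)

text \<open>The left boxes determine \<sigma>, and the involution then forces the inverse
  permutations on the right boxes. Families are extensional in j so that each matching arises
  once.\<close>

lemma bij_betw_cm: "bij_betw cm col_fam (colmatch lam)"
  unfolding bij_betw_def
proof
  show "inj_on cm col_fam"
  proof (rule inj_onI)
    fix \<sigma> \<sigma>' assume s: "\<sigma> \<in> col_fam" "\<sigma>' \<in> col_fam" and eq: "cm \<sigma> = cm \<sigma>'"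
    show "\<sigma> = \<sigma>'"
    proof (rule PiE_ext[OF s], rule ext)
      fix j i assume j: "j \<in> {..<n}"
      show "\<sigma> j i = \<sigma>' j i"
      proof (cases "i < c j")
        case True
        note p = col_permsD[OF col_fam_col_perms[OF s(1)] True] and p' = col_permsD[OF col_fam_col_perms[OF s(2)] True]
        have "box (\<sigma> j i) j 1 = box (\<sigma>' j i) j 1" using fun_cong[OF eq, of "box i j 0"] by (simp only: cm_box[OF True])
        then show ?thesis using box_eq_iff[OF p(2) _ p'(2), of 1 1] by simp
      next
        case False
        have "\<sigma> j permutes {..<c j}" "\<sigma>' j permutes {..<c j}" using s j by auto
        then show ?thesis using False by (simp add: permutes_not_in)
      qed
    qed
  qed
  show "cm ` col_fam = colmatch lam"
  proof
    show "cm ` col_fam \<subseteq> colmatch lam" using cm_colmatch col_fam_col_perms by blast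
    show "colmatch lam \<subseteq> cm ` col_fam"
    proof
      fix A assume A: "A \<in> colmatch lam"
      note mA = colmatch_matching_on[OF A, folded n_def, folded V_def]
      define p where "p = (\<lambda>j i. if i < c j then rowT lam (A (box i j 0)) else i)"
      have pA: "A (box i j 0) = box (p j i) j 1" "p j i < c j" if "i < c j" for i j
        using colmatch_box[OF A that] that by (simp_all add: p_def)
      have perm: "p j permutes {..<c j}" for j
      proof (rule bij_imp_permutes)
        have "inj_on (p j) {..<c j}"
        proof (rule inj_onI)
          fix i i' assume i: "i \<in> {..<c j}" "i' \<in> {..<c j}" "p j i = p j i'"
          then have "A (box i j 0) = A (box i' j 0)" using pA(1)[of i j] pA(1)[of i' j] by simp
          then have "A (A (box i j 0)) = A (A (box i' j 0))" by simp
          then have "box i j 0 = box i' j 0" using matching_onD(3)[OF mA] box_in_V i by simp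
          then show "i = i'" using box_eq_iff[of i j 0 i' j 0] i by simp
        qed
        moreover have "p j ` {..<c j} \<subseteq> {..<c j}" using pA(2) by auto
        ultimately show "bij_betw (p j) {..<c j} {..<c j}" unfolding bij_betw_def by (simp add: endo_inj_surj)
      qed (simp add: p_def)
      define \<sigma> where "\<sigma> = restrict p {..<n}"
      have \<sigma>: "\<sigma> \<in> col_fam" using perm by (simp add: \<sigma>_def)
      note \<sigma>' = col_fam_col_perms[OF \<sigma>]
      have \<sigma>p: "\<sigma> j = p j" if "i < c j" for i j using less_c_n[OF that] by (simp add: \<sigma>_def)
      have "cm \<sigma> v = A v" for v
      proof (cases "v \<in> V")
        case True
        then obtain i j b where v: "i < c j" "b < 2" "v = box i j b" by (rule box_cases)
        note q = col_permsD[OF \<sigma>' v(1)]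
        from less_2_cases'[OF v(2)] show ?thesis
        proof
          assume "b = 0"
          then show ?thesis using v(1) pA(1)[OF v(1)] \<sigma>p[OF v(1)] by (simp only: v(3) cm_box)
        next
          assume b: "b = 1"
          define k where "k = inv (\<sigma> j) i"
          have k: "k < c j" "\<sigma> j k = i" using q by (auto simp: k_def)
          have "A (box k j 0) = box i j 1" using pA(1)[OF k(1)] \<sigma>p[OF k(1)] k(2) by simp
          then have "A (box i j 1) = box k j 0" using matching_onD(3)[OF mA box_in_V[OF k(1)], of 0] by simp
          then show ?thesis using v(1) b by (simp only: v(3) cm_box k_def)
        qed
      next
        case False
        then have "A v = v" using A unfolding colmatch_def matchings_iff V_def n_def by blast
        then show ?thesis using False by (simp add: cm_def)
      qed
      then have "cm \<sigma> = A" ..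
      then show "A \<in> cm ` col_fam" using \<sigma> by blast
    qed
  qed
qed

lemma Sstd_matching_on: "matching_on V (Sstd n)"
  unfolding matching_on_def
proof
  fix v assume "v \<in> V"
  then obtain i j b where v: "i < c j" "b < 2" "v = box i j b" by (rule box_cases)
  show "Sstd n v \<in> V \<and> Sstd n v \<noteq> v \<and> Sstd n (Sstd n v) = v"
    using less_2_cases'[OF v(2)] v(1) by (auto simp: v(3) Sstd_box box_in_V box_eq_iff simp del: One_nat_def)
qed

text \<open>Ensures that the exponent in \<open>loop_sign\<close> is a true difference, so that
  parities can be compared.\<close>

lemma card_loop_set_le:
  assumes "matching_on V A" "matching_on V B"
  shows "card (loop_set V A B) \<le> n"
proof -
  have "loop_type n A B \<in> partitions n" by (rule loop_type_partition) (use assms in \<open>simp_all add: V_def\<close>)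
  then show ?thesis
    using length_le_sum_list[of "loop_type n A B"]
    by (simp add: length_loop_type V_def partitions_def is_partition_def)
qed

abbreviation csign :: "(nat \<Rightarrow> nat \<Rightarrow> nat) \<Rightarrow> real" where
  "csign \<sigma> \<equiv> loop_sign n (Sstd n) (cm \<sigma>)"

text \<open>A transposition composed with \<open>\<sigma> m\<close> conjugates the matching by the
  transposition of two right boxes, which is a rewiring at four points. The parity of labels
  alternates along both matchings and agrees at the two left boxes, so the number of loops changes
  by an odd amount.\<close>

lemma loop_sign_flip:
  assumes \<sigma>: "\<sigma> \<in> col_perms" and m: "m < n" and ab: "a < c m" "b < c m" "a \<noteq> b"
  shows "csign (\<sigma>(m := transpose a b \<circ> \<sigma> m)) = - csign \<sigma>"
proof -
  let ?\<sigma> = "\<sigma>(m := transpose a b \<circ> \<sigma> m)" and ?B = "cm \<sigma>"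
  note mB = cm_matching_on[OF \<sigma>]
  have pm: "\<sigma> m permutes {..<c m}" by (rule col_permsD(1)[OF \<sigma> ab(1)])
  define i k where "i = inv (\<sigma> m) a" and "k = inv (\<sigma> m) b"
  have i: "i < c m" "\<sigma> m i = a" and k: "k < c m" "\<sigma> m k = b"
    using col_permsD[OF \<sigma> ab(1)] col_permsD[OF \<sigma> ab(2)] by (auto simp: i_def k_def)
  have Bi: "?B (box i m 0) = box a m 1" and Bk: "?B (box k m 0) = box b m 1"
    using i k by (simp_all only: cm_box)
  have eq: "cm ?\<sigma> v = conj_fun (box a m 1) (box b m 1) ?B v" for v
  proof (cases "v \<in> V")
    case True
    then obtain r j d where v: "r < c j" "d < 2" "v = box r j d" by (rule box_cases)
    note p = col_permsD[OF \<sigma> v(1)]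
    have d: "transpose (box a m 1) (box b m 1) (box s q 0) = box s q 0" if "s < c q" for s q
      using that ab by (simp add: transpose_def box_eq_iff)
    have d1: "transpose (box a m 1) (box b m 1) (box s q 1) = box (if q = m then transpose a b s else s) q 1" if "s < c q" for s q
      using that ab by (auto simp: transpose_def box_eq_iff)
    have inv: "inv (transpose a b \<circ> \<sigma> m) = inv (\<sigma> m) \<circ> transpose a b"
      using pm by (subst o_inv_distrib) (auto simp: permutes_bij inv_swap_id[unfolded id_def])
    have tr: "transpose a b r < c m" if "j = m" using v(1) ab that by (simp add: transpose_def)
    from less_2_cases'[OF v(2)] show ?thesis
    proof
      assume "d = 0"
      then show ?thesis
        using v(1) p by (simp add: v(3) conj_fun_def d cm_box d1 del: One_nat_def)
    next
      assume dd: "d = 1"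
      show ?thesis
      proof (cases "j = m")
        case True
        then have "inv (\<sigma> m) (transpose a b r) < c m" using col_permsD(3)[OF \<sigma> tr] by simp
        then show ?thesis
          using v(1) True dd tr by (simp add: v(3) conj_fun_def d cm_box d1 inv del: One_nat_def)
      next
        case False
        then show ?thesis
          using v(1) p dd by (simp add: v(3) conj_fun_def d cm_box d1 del: One_nat_def)
      qed
    qed
  next
    case False
    then have "v \<noteq> box a m 1" "v \<noteq> box b m 1" using box_in_V ab by auto
    then show ?thesis using False by (simp add: cm_def conj_fun_def)
  qed
  then have eq: "cm ?\<sigma> = conj_fun (?B (box i m 0)) (?B (box k m 0)) ?B" by (simp only: Bi Bk) auto
  have \<sigma>': "?\<sigma> \<in> col_perms"
    using \<sigma> ab pm by (auto simp: col_perms_def intro!: permutes_compose permutes_swap_id)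
  have par: "odd (cm \<sigma> v) \<noteq> odd v" "odd (Sstd n v) \<noteq> odd v" if "v \<in> V" for v
  proof -
    obtain r j d where v: "r < c j" "d < 2" "v = box r j d" using \<open>v \<in> V\<close> by (rule box_cases)
    show "odd (cm \<sigma> v) \<noteq> odd v" "odd (Sstd n v) \<noteq> odd v"
      using less_2_cases'[OF v(2)] v(1) by (auto simp: v(3) cm_box Sstd_box even_box simp del: One_nat_def)
  qed
  have ne: "box k m 0 \<noteq> box i m 0" "box k m 0 \<noteq> ?B (box i m 0)"
    using i k ab by (auto simp: Bi box_eq_iff)
  have "odd (card (loop_set V (Sstd n) ?B) + card (loop_set V (Sstd n) (cm ?\<sigma>)))"
    unfolding eq
    by (rule loop_set_rewire(2)[where s = odd, OF finite_V Sstd_matching_on mB box_in_V[OF i(1)] box_in_V[OF k(1)] ne])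
      (use par in \<open>auto simp: even_box\<close>)
  moreover have "odd (p + q) \<Longrightarrow> p \<le> N \<Longrightarrow> q \<le> N \<Longrightarrow> odd ((N - p) + (N - q))" for p q N :: nat
    by presburger
  ultimately have "odd ((n - card (loop_set V (Sstd n) ?B)) + (n - card (loop_set V (Sstd n) (cm ?\<sigma>))))"
    using card_loop_set_le[OF Sstd_matching_on mB] card_loop_set_le[OF Sstd_matching_on cm_matching_on[OF \<sigma>']] by blast
  moreover have "(-1 :: real) ^ q = - ((-1) ^ p)" if "odd (p + q)" for p q :: nat
    using that by (cases "even p"; cases "even q") auto
  ultimately show ?thesis
    unfolding loop_sign_def loops_loop_set V_def[symmetric] by blast
qed

text \<open>Columns are treated one at a time, and within a column the permutation is built from
  transpositions. At the start all columns carry the identity, and the matching is the standard one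
  with n loops.\<close>

lemma loop_sign_cm:
  assumes "\<sigma> \<in> col_perms"
  shows "csign \<sigma> = (\<Prod>j<n. of_int (sign (\<sigma> j)))"
proof -
  have "csign \<sigma> = (\<Prod>j<m. of_int (sign (\<sigma> j)))"
    if "m \<le> n" "\<sigma> \<in> col_perms" "\<And>j. m \<le> j \<Longrightarrow> j < n \<Longrightarrow> \<sigma> j = id" for m \<sigma>
    using that
  proof (induction m arbitrary: \<sigma>)
    case 0
    have "cm \<sigma> v = Sstd n v" if "v \<in> V" for v
    proof -
      obtain r j d where v: "r < c j" "d < 2" "v = box r j d" using \<open>v \<in> V\<close> by (rule box_cases)
      have "\<sigma> j = id" by (rule 0(3)) (simp_all add: less_c_n[OF v(1)])
      then show ?thesis
        using less_2_cases'[OF v(2)] v(1) by (auto simp: v(3) cm_box Sstd_box simp del: One_nat_def)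
    qed
    moreover have "cm \<sigma> v = Sstd n v" if "v \<notin> V" for v by (simp only: cm_outside[OF that] Sstd_outside[OF that])
    ultimately have "cm \<sigma> = Sstd n" by blast
    then show ?case
      using card_loop_set_self[OF finite_V Sstd_matching_on]
      by (simp add: loop_sign_def loops_loop_set V_def)
  next
    case (Suc m)
    have "csign (\<sigma>(m := p)) = of_int (sign p) * (\<Prod>j<m. of_int (sign (\<sigma> j)))"
      if "p permutes {..<c m}" for p
      using that finite_lessThan
    proof (induction p rule: permutes_induct)
      case id
      have "csign (\<sigma>(m := id)) = (\<Prod>j<m. of_int (sign ((\<sigma>(m := id)) j)))"
      proof (rule Suc.IH)
        show "\<sigma>(m := id) \<in> col_perms" using Suc.prems(2) by (simp add: col_perms_def)
        show "(\<sigma>(m := id)) j = id" if "m \<le> j" "j < n" for j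
          using Suc.prems(3)[of j] that by (cases "j = m") auto
      qed (use Suc.prems in simp)
      also have "\<dots> = of_int (sign id) * (\<Prod>j<m. of_int (sign (\<sigma> j)))" by simp
      finally show ?case .
    next
      case (swap a b p)
      have "\<sigma>(m := p) \<in> col_perms" using Suc.prems(2) swap.hyps by (simp add: col_perms_def)
      then have "csign ((\<sigma>(m := p))(m := transpose a b \<circ> (\<sigma>(m := p)) m)) =
        - csign (\<sigma>(m := p))"
        by (rule loop_sign_flip) (use Suc.prems swap.hyps in auto)
      then have flip: "csign (\<sigma>(m := transpose a b \<circ> p)) = - csign (\<sigma>(m := p))"
        by (simp only: fun_upd_upd fun_upd_same)
      have "sign (transpose a b \<circ> p) = - sign p"
        using swap.hyps
        by (subst sign_compose) (auto simp: sign_swap_id permutes_lessThan_permutation permutation_swap_id)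
      then show ?case by (simp only: flip swap.IH of_int_minus mult_minus_left)
    qed
    from this[of "\<sigma> m"] show ?case using Suc.prems by (simp add: col_perms_def mult.commute)
  qed
  from this[of n \<sigma>] show ?thesis using assms by simp
qed

section \<open>Monomial coefficients as Gaussian expectations\<close>

definition fillings :: "nat list \<Rightarrow> (nat \<Rightarrow> nat \<Rightarrow> nat) set" where
  "fillings mu = {\<tau> \<in> Pi\<^sub>E {..<n} (\<lambda>j. {..<c j} \<rightarrow>\<^sub>E {..<length mu}).
     \<forall>l<length mu. (\<Sum>j<n. card {i \<in> {..<c j}. \<tau> j i = l}) = mu ! l}"

lemma finite_fillings: "finite (fillings mu)"
  unfolding fillings_def by (rule finite_Collect_conjI) (simp add: finite_PiE)

definition colouring :: "(nat \<Rightarrow> nat \<Rightarrow> nat) \<Rightarrow> (nat \<Rightarrow> nat \<Rightarrow> nat) \<Rightarrow> nat \<Rightarrow> nat" where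
  "colouring \<sigma> \<tau> = (\<lambda>v\<in>V. let i = rowT lam v; j = (colT lam v - 1) div 2 in
     if odd (colT lam v) then \<tau> j i else \<tau> j (inv (\<sigma> j) i))"

lemma colouring_box:
  assumes "i < c j"
  shows "colouring \<sigma> \<tau> (box i j 0) = \<tau> j i" "colouring \<sigma> \<tau> (box i j 1) = \<tau> j (inv (\<sigma> j) i)"
  using assms by (simp_all add: colouring_def box_in_V rowT_box colT_box Let_def)

lemma sum_colourings:
  fixes g :: "(nat \<Rightarrow> nat) \<Rightarrow> real"
  assumes \<sigma>: "\<sigma> \<in> col_perms"
  shows "(\<Sum>f\<in>{f \<in> V \<rightarrow>\<^sub>E {..<length mu}. (\<forall>v\<in>V. f (cm \<sigma> v) = f v) \<and>
      (\<forall>l<length mu. card {v \<in> V. f v = l} = 2 * mu ! l)}. g f) = (\<Sum>\<tau>\<in>fillings mu. g (colouring \<sigma> \<tau>))"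
proof -
  let ?r = "\<lambda>f. \<lambda>j\<in>{..<n}. \<lambda>i\<in>{..<c j}. f (box i j 0)"
  have content: "card {v \<in> V. f v = l} = 2 * (\<Sum>j<n. card {i \<in> {..<c j}. f (box i j 0) = l})"
    if f: "\<And>v. v \<in> V \<Longrightarrow> f (cm \<sigma> v) = f v" for f :: "nat \<Rightarrow> nat" and l
  proof -
    have "card {v \<in> V. f v = l} = (\<Sum>v\<in>V. if f v = l then 1 else 0)"
      by (simp add: sum.inter_filter[symmetric])
    also have "\<dots> = (\<Sum>j<n. 2 * card {i \<in> {..<c j}. f (box i j 0) = l})"
      unfolding sum_V
    proof (rule sum.cong)
      fix j assume "j \<in> {..<n}"
      then have p: "\<sigma> j permutes {..<c j}" using \<sigma> by (simp add: col_perms_def)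
      have "(\<Sum>i<c j. if f (box i j 1) = l then 1 else (0::nat)) = (\<Sum>i<c j. if f (box (\<sigma> j i) j 1) = l then 1 else 0)"
        using sum.permute[OF p, of "\<lambda>i. if f (box i j 1) = l then 1 else (0::nat)"] by (simp add: o_def)
      also have "\<dots> = (\<Sum>i<c j. if f (box i j 0) = l then 1 else 0)"
      proof (rule sum.cong)
        fix i assume "i \<in> {..<c j}"
        then have "i < c j" by simp
        then have "f (box (\<sigma> j i) j 1) = f (box i j 0)"
          using f[OF box_in_V, of i j 0] by (simp only: cm_box(1))
        then show "(if f (box (\<sigma> j i) j 1) = l then 1 else (0::nat)) = (if f (box i j 0) = l then 1 else 0)" by simp
      qed simp
      finally show "(\<Sum>i<c j. if f (box i j 0) = l then 1 else 0) + (\<Sum>i<c j. if f (box i j 1) = l then 1 else 0) =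
        2 * card {i \<in> {..<c j}. f (box i j 0) = l}"
        by (simp add: sum.inter_filter[symmetric])
    qed simp
    finally show ?thesis by (simp add: sum_distrib_left)
  qed
  have inv: "colouring \<sigma> \<tau> (cm \<sigma> v) = colouring \<sigma> \<tau> v" if "v \<in> V" for v \<tau>
  proof -
    obtain i j b where v: "i < c j" "b < 2" "v = box i j b" using \<open>v \<in> V\<close> by (rule box_cases)
    note p = col_permsD[OF \<sigma> v(1)]
    from less_2_cases'[OF v(2)] show ?thesis
    proof
      assume "b = 0"
      then show ?thesis using p(4) by (simp only: v(3) cm_box[OF v(1)] colouring_box[OF v(1)] colouring_box[OF p(2)])
    next
      assume "b = 1"
      then show ?thesis by (simp only: v(3) cm_box[OF v(1)] colouring_box[OF v(1)] colouring_box[OF p(3)])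
    qed
  qed
  show ?thesis
  proof (rule sum.reindex_bij_witness[of _ "colouring \<sigma>" ?r])
    fix f assume "f \<in> {f \<in> V \<rightarrow>\<^sub>E {..<length mu}. (\<forall>v\<in>V. f (cm \<sigma> v) = f v) \<and>
      (\<forall>l<length mu. card {v \<in> V. f v = l} = 2 * mu ! l)}"
    then have f: "f \<in> V \<rightarrow>\<^sub>E {..<length mu}" "\<And>v. v \<in> V \<Longrightarrow> f (cm \<sigma> v) = f v"
      "\<And>l. l < length mu \<Longrightarrow> card {v \<in> V. f v = l} = 2 * mu ! l" by auto
    show eq: "colouring \<sigma> (?r f) = f"
    proof
      fix v
      show "colouring \<sigma> (?r f) v = f v"
      proof (cases "v \<in> V")
        case True
        then obtain i j b where v: "i < c j" "j < n" "b < 2" "v = box i j b" by (rule box_cases)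
        note p = col_permsD[OF \<sigma> v(1)]
        from less_2_cases'[OF v(3)] show ?thesis
        proof
          assume "b = 0"
          then show ?thesis using v(1,2) by (simp add: v(4) colouring_box)
        next
          assume b: "b = 1"
          have "f (box i j 1) = f (cm \<sigma> (box i j 1))" using f(2)[of v] True v(4) b by simp
          also have "\<dots> = f (box (inv (\<sigma> j) i) j 0)" by (simp only: cm_box[OF v(1)])
          finally have "f (box i j 1) = f (box (inv (\<sigma> j) i) j 0)" .
          moreover have "colouring \<sigma> (?r f) (box i j 1) = f (box (inv (\<sigma> j) i) j 0)"
            using v(2) p(3) by (simp only: colouring_box[OF v(1)]) simp
          ultimately show ?thesis by (simp only: v(4) b)
        qed
      qed (use f(1) in \<open>auto simp: colouring_def\<close>)
    qed
    show "?r f \<in> fillings mu"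
      unfolding fillings_def
    proof (intro CollectI conjI allI impI)
      show "?r f \<in> Pi\<^sub>E {..<n} (\<lambda>j. {..<c j} \<rightarrow>\<^sub>E {..<length mu})"
        using PiE_mem[OF f(1) box_in_V] unfolding restrict_PiE_iff by simp
      fix l assume l: "l < length mu"
      have "(\<Sum>j<n. card {i \<in> {..<c j}. ?r f j i = l}) = (\<Sum>j<n. card {i \<in> {..<c j}. f (box i j 0) = l})"
        by (intro sum.cong refl arg_cong[where f = card]) auto
      then show "(\<Sum>j<n. card {i \<in> {..<c j}. ?r f j i = l}) = mu ! l"
        using content[of f l] f(2) f(3)[OF l] by simp
    qed
    show "g (colouring \<sigma> (?r f)) = g f" by (simp only: eq)
  next
    fix \<tau> assume "\<tau> \<in> fillings mu"
    then have t: "\<tau> \<in> Pi\<^sub>E {..<n} (\<lambda>j. {..<c j} \<rightarrow>\<^sub>E {..<length mu})"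
      "\<And>l. l < length mu \<Longrightarrow> (\<Sum>j<n. card {i \<in> {..<c j}. \<tau> j i = l}) = mu ! l"
      by (auto simp: fillings_def)
    have \<tau>: "\<tau> j i < length mu" if "i < c j" for i j using t(1) that less_c_n[OF that] by auto
    show "?r (colouring \<sigma> \<tau>) = \<tau>"
    proof (rule PiE_ext[of _ "{..<n}" "\<lambda>j. {..<c j} \<rightarrow>\<^sub>E UNIV"])
      show "?r (colouring \<sigma> \<tau>) j = \<tau> j" if j: "j \<in> {..<n}" for j
        using PiE_mem[OF t(1) j] j by (auto simp: fun_eq_iff colouring_box PiE_def extensional_def)
    qed (use t(1) in \<open>auto simp: PiE_def\<close>)
    show "colouring \<sigma> \<tau> \<in> {f \<in> V \<rightarrow>\<^sub>E {..<length mu}. (\<forall>v\<in>V. f (cm \<sigma> v) = f v) \<and>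
      (\<forall>l<length mu. card {v \<in> V. f v = l} = 2 * mu ! l)}"
    proof (intro CollectI conjI allI impI ballI PiE_I)
      fix v assume "v \<in> V"
      then show "colouring \<sigma> \<tau> (cm \<sigma> v) = colouring \<sigma> \<tau> v" by (rule inv)
      obtain i j b where v: "i < c j" "b < 2" "v = box i j b" using \<open>v \<in> V\<close> by (rule box_cases)
      show "colouring \<sigma> \<tau> v \<in> {..<length mu}"
        using less_2_cases'[OF v(2)] \<tau>[OF v(1)] \<tau>[OF col_permsD(3)[OF \<sigma> v(1)]] v(1)
        by (auto simp: v(3) colouring_box simp del: One_nat_def)
    next
      fix v assume "v \<notin> V"
      then show "colouring \<sigma> \<tau> v = undefined" by (simp add: colouring_def)
    next
      fix l assume l: "l < length mu"
      have "(\<Sum>j<n. card {i \<in> {..<c j}. colouring \<sigma> \<tau> (box i j 0) = l}) = (\<Sum>j<n. card {i \<in> {..<c j}. \<tau> j i = l})"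
        by (intro sum.cong refl arg_cong[where f = card]) (auto simp: colouring_box)
      then show "card {v \<in> V. colouring \<sigma> \<tau> v = l} = 2 * mu ! l"
        using content[of "colouring \<sigma> \<tau>" l, OF inv] t(2)[OF l] by simp
    qed
  qed
qed

text \<open>A box stands for the Gaussian variable indexed by its row and colour. Reindexing the
  right boxes by \<open>\<sigma> j\<close> moves the permutation from the colour to the row, as in
  the terms of \<open>minor\<close>.\<close>

lemma wick_colouring:
  assumes \<sigma>: "\<sigma> \<in> col_perms"
  shows "wick (image_mset (\<lambda>v. (rowT lam v, colouring \<sigma> \<tau> v)) (mset_set V)) =
    gauss (\<Prod>j<n. (\<Prod>i<c j. mvar (i, \<tau> j i)) * (\<Prod>i<c j. mvar (\<sigma> j i, \<tau> j i)))"
proof -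
  have "wick (image_mset (\<lambda>v. (rowT lam v, colouring \<sigma> \<tau> v)) (mset_set V)) =
    gauss (\<Prod>v\<in>V. mvar (rowT lam v, colouring \<sigma> \<tau> v))"
    by (simp add: gauss_prod_mvar)
  also have "(\<Prod>v\<in>V. mvar (rowT lam v, colouring \<sigma> \<tau> v)) =
    (\<Prod>j<n. (\<Prod>i<c j. mvar (i, \<tau> j i)) * (\<Prod>i<c j. mvar (\<sigma> j i, \<tau> j i)))"
    unfolding prod_V
  proof (rule prod.cong)
    fix j assume "j \<in> {..<n}"
    then have p: "\<sigma> j permutes {..<c j}" using \<sigma> by (simp add: col_perms_def)
    have "(\<Prod>i<c j. mvar (rowT lam (box i j 0), colouring \<sigma> \<tau> (box i j 0))) = (\<Prod>i<c j. mvar (i, \<tau> j i))"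
      by (rule prod.cong) (auto simp: rowT_box colouring_box)
    moreover have "(\<Prod>i<c j. mvar (rowT lam (box i j 1), colouring \<sigma> \<tau> (box i j 1))) = (\<Prod>i<c j. mvar (\<sigma> j i, \<tau> j i))"
    proof -
      have "(\<Prod>i<c j. mvar (rowT lam (box i j 1), colouring \<sigma> \<tau> (box i j 1))) = (\<Prod>i<c j. mvar (i, \<tau> j (inv (\<sigma> j) i)))"
        by (rule prod.cong) (auto simp: rowT_box colouring_box simp del: One_nat_def)
      also have "\<dots> = (\<Prod>i<c j. mvar (\<sigma> j i, \<tau> j i))"
        using prod.permute[OF p, of "\<lambda>i. mvar (i, \<tau> j (inv (\<sigma> j) i))"] permutes_inverses[OF p] by (simp add: o_def)
      finally show ?thesis .
    qed
    ultimately show "(\<Prod>i<c j. mvar (rowT lam (box i j 0), colouring \<sigma> \<tau> (box i j 0))) *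
      (\<Prod>i<c j. mvar (rowT lam (box i j 1), colouring \<sigma> \<tau> (box i j 1))) =
      (\<Prod>i<c j. mvar (i, \<tau> j i)) * (\<Prod>i<c j. mvar (\<sigma> j i, \<tau> j i))" by simp
  qed simp
  finally show ?thesis .
qed

text \<open>For a fixed filling the signed sum over \<sigma> factors over the columns, and each
  factor is the Leibniz expansion of a minor with column indices \<open>\<tau> j\<close>.\<close>

lemma mcoeff_zvec:
  "mcoeff n (zvec lam) mu = (\<Sum>\<tau>\<in>fillings mu. gauss (\<Prod>j<n. (\<Prod>i<c j. mvar (i, \<tau> j i)) * minor (c j) (\<tau> j)))"
proof -
  let ?P = "\<lambda>f. \<forall>l<length mu. card {v \<in> V. f v = l} = 2 * mu ! l"
  let ?G = "\<lambda>A. {f \<in> V \<rightarrow>\<^sub>E {..<length mu}. (\<forall>v\<in>V. f (A v) = f v) \<and> ?P f}"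
  let ?s = "\<lambda>\<sigma>. \<Prod>j<n. real_of_int (sign (\<sigma> j))"
  let ?m = "\<lambda>\<sigma> \<tau>. \<Prod>j<n. (\<Prod>i<c j. mvar (i, \<tau> j i)) * (\<Prod>i<c j. mvar (\<sigma> j i, \<tau> j i))"
  have "mcoeff n (zvec lam) mu = (\<Sum>A\<in>colmatch lam. loop_sign n (Sstd n) A *
      (\<Sum>B\<in>respecting V (rowT lam). real (p_to_m (loop_type n A B) mu)))"
    unfolding mcoeff_def using sum_zvec[of lam "\<lambda>rho. real (p_to_m rho mu)"] by (simp add: n_def V_def)
  also have "\<dots> = (\<Sum>A\<in>colmatch lam. loop_sign n (Sstd n) A *
      (\<Sum>f\<in>?G A. wick (image_mset (\<lambda>v. (rowT lam v, f v)) (mset_set V))))"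
  proof (rule sum.cong[OF refl], rule arg_cong[where f = "times _"])
    fix A assume A: "A \<in> colmatch lam"
    have "(\<Sum>B\<in>respecting V (rowT lam). real (p_to_m (loop_type n A B) mu)) =
      (\<Sum>B\<in>respecting V (rowT lam). 1 * real (card {f \<in> invcol V {..<length mu} A B. ?P f}))"
    proof (rule sum.cong)
      fix B assume B: "B \<in> respecting V (rowT lam)"
      have m: "matching_on {1..2 * n} A" "matching_on {1..2 * n} B"
        using colmatch_matching_on[OF A] respecting_matching_on[OF B] by (simp_all add: n_def V_def)
      show "real (p_to_m (loop_type n A B) mu) = 1 * real (card {f \<in> invcol V {..<length mu} A B. ?P f})"
        unfolding p_to_m_colcount content_count_loop_type[OF m] V_def by simp
    qed simp
    also have "\<dots> = (\<Sum>f\<in>?G A. \<Sum>B\<in>respecting V (\<lambda>v. (rowT lam v, f v)). 1)"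
      by (rule sum_respecting_swap) simp_all
    also have "\<dots> = (\<Sum>f\<in>?G A. wick (image_mset (\<lambda>v. (rowT lam v, f v)) (mset_set V)))"
      by (rule sum.cong) (simp_all add: card_respecting)
    finally show "(\<Sum>B\<in>respecting V (rowT lam). real (p_to_m (loop_type n A B) mu)) = \<dots>" .
  qed
  also have "\<dots> = (\<Sum>\<sigma>\<in>col_fam. csign \<sigma> *
      (\<Sum>f\<in>?G (cm \<sigma>). wick (image_mset (\<lambda>v. (rowT lam v, f v)) (mset_set V))))"
    by (rule sum.reindex_bij_betw[OF bij_betw_cm, symmetric])
  also have "\<dots> = (\<Sum>\<sigma>\<in>col_fam. ?s \<sigma> * (\<Sum>\<tau>\<in>fillings mu. gauss (?m \<sigma> \<tau>)))"
  proof (rule sum.cong)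
    fix \<sigma> assume "\<sigma> \<in> col_fam"
    then have \<sigma>: "\<sigma> \<in> col_perms" by (rule col_fam_col_perms)
    show "csign \<sigma> * (\<Sum>f\<in>?G (cm \<sigma>). wick (image_mset (\<lambda>v. (rowT lam v, f v)) (mset_set V))) =
      ?s \<sigma> * (\<Sum>\<tau>\<in>fillings mu. gauss (?m \<sigma> \<tau>))"
      unfolding sum_colourings[OF \<sigma>] loop_sign_cm[OF \<sigma>] wick_colouring[OF \<sigma>] ..
  qed simp
  also have "\<dots> = (\<Sum>\<tau>\<in>fillings mu. \<Sum>\<sigma>\<in>col_fam. ?s \<sigma> * gauss (?m \<sigma> \<tau>))"
    unfolding sum_distrib_left by (rule sum.swap)
  also have "\<dots> = (\<Sum>\<tau>\<in>fillings mu. gauss (\<Prod>j<n. (\<Prod>i<c j. mvar (i, \<tau> j i)) * minor (c j) (\<tau> j)))"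
  proof (rule sum.cong)
    fix \<tau>
    have "(\<Prod>j<n. (\<Prod>i<c j. mvar (i, \<tau> j i)) * minor (c j) (\<tau> j)) =
      (\<Prod>j<n. \<Sum>p\<in>{p. p permutes {..<c j}}. of_int (sign p) * ((\<Prod>i<c j. mvar (i, \<tau> j i)) * (\<Prod>i<c j. mvar (p i, \<tau> j i))))"
      unfolding minor_def sum_distrib_left by (simp only: mult.left_commute)
    also have "\<dots> = (\<Sum>\<sigma>\<in>col_fam. \<Prod>j<n. of_int (sign (\<sigma> j)) * ((\<Prod>i<c j. mvar (i, \<tau> j i)) * (\<Prod>i<c j. mvar (\<sigma> j i, \<tau> j i))))"
      by (rule prod_sum_PiE) (simp_all add: finite_permutations)
    also have "\<dots> = (\<Sum>\<sigma>\<in>col_fam. of_int (\<Prod>j<n. sign (\<sigma> j)) * ?m \<sigma> \<tau>)"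
      by (simp only: prod.distrib of_int_prod)
    finally have eq: "(\<Prod>j<n. (\<Prod>i<c j. mvar (i, \<tau> j i)) * minor (c j) (\<tau> j)) = \<dots>" .
    show "(\<Sum>\<sigma>\<in>col_fam. ?s \<sigma> * gauss (?m \<sigma> \<tau>)) = gauss (\<Prod>j<n. (\<Prod>i<c j. mvar (i, \<tau> j i)) * minor (c j) (\<tau> j))"
      unfolding eq gauss_sum gauss_of_int by simp
  qed simp
  finally show ?thesis .
qed

lemma fillings_less:
  assumes "\<tau> \<in> fillings mu" "k \<le> length mu"
  shows "(\<Sum>j<n. card {i \<in> {..<c j}. \<tau> j i < k}) = sum_list (take k mu)"
proof -
  have "card {i \<in> {..<c j}. \<tau> j i < k} = (\<Sum>l<k. card {i \<in> {..<c j}. \<tau> j i = l})" for j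
  proof -
    have "{i \<in> {..<c j}. \<tau> j i < k} = (\<Union>l\<in>{..<k}. {i \<in> {..<c j}. \<tau> j i = l})" by auto
    then show ?thesis by (simp only:) (rule card_UN_disjoint, auto)
  qed
  then have "(\<Sum>j<n. card {i \<in> {..<c j}. \<tau> j i < k}) = (\<Sum>l<k. \<Sum>j<n. card {i \<in> {..<c j}. \<tau> j i = l})"
    by (simp only: sum.swap[of _ "{..<k}"])
  also have "\<dots> = (\<Sum>l<k. mu ! l)"
    using assms by (intro sum.cong) (auto simp: fillings_def)
  also have "\<dots> = (\<Sum>l | l < k \<and> l < length mu. mu ! l)"
    using assms(2) by (intro sum.cong) auto
  finally show ?thesis by (simp add: sum_list_take)
qed

lemma inj_card_less_le:
  assumes "inj_on t {..<m}"
  shows "card {i \<in> {..<m}. t i < (k :: nat)} \<le> min k m"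
proof -
  have "card {i \<in> {..<m}. t i < k} \<le> card {..<k}"
    by (rule card_inj_on_le[of t]) (use assms in \<open>auto simp: inj_on_def\<close>)
  moreover have "card {i \<in> {..<m}. t i < k} \<le> card {..<m}" by (rule card_mono) auto
  ultimately show ?thesis by simp
qed

lemma mcoeff_zvec_dominated:
  assumes "mcoeff n (zvec lam) mu \<noteq> 0"
  shows "dominated mu lam"
proof -
  obtain \<tau> where t: "\<tau> \<in> fillings mu" "gauss (\<Prod>j<n. (\<Prod>i<c j. mvar (i, \<tau> j i)) * minor (c j) (\<tau> j)) \<noteq> 0"
    using assms unfolding mcoeff_zvec by (rule sum.not_neutral_contains_not_neutral)
  have inj: "inj_on (\<tau> j) {..<c j}" if "j < n" for j
  proof (rule ccontr)
    assume "\<not> inj_on (\<tau> j) {..<c j}"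
    then have z: "(\<Prod>i<c j. mvar (i, \<tau> j i)) * minor (c j) (\<tau> j) = 0" by (simp add: minor_not_inj)
    have "(\<Prod>j<n. (\<Prod>i<c j. mvar (i, \<tau> j i)) * minor (c j) (\<tau> j)) = 0"
      by (rule prod_zero, simp, rule bexI[of _ j], rule z, simp add: that)
    then show False using t(2) by (simp add: gauss_zero)
  qed
  show ?thesis
  proof (rule dominated_if_columns[OF partition])
    fix k
    \<comment> \<open>The content of a filling is prescribed for colours below
      \<open>length mu\<close>, so k is cut off there.\<close>
    define k' where "k' = min k (length mu)"
    have "(\<Sum>i | i < k \<and> i < length mu. mu ! i) = sum_list (take k' mu)"
      by (simp add: sum_list_take k'_def)
    also have "\<dots> = (\<Sum>j<n. card {i \<in> {..<c j}. \<tau> j i < k'})"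
      by (rule fillings_less[OF t(1), symmetric]) (simp add: k'_def)
    also have "\<dots> \<le> (\<Sum>j<n. min k (c j))"
    proof (rule sum_mono)
      fix j assume "j \<in> {..<n}"
      then have "card {i \<in> {..<c j}. \<tau> j i < k'} \<le> min k' (c j)" by (intro inj_card_less_le inj) simp
      also have "\<dots> \<le> min k (c j)" by (simp add: k'_def)
      finally show "card {i \<in> {..<c j}. \<tau> j i < k'} \<le> min k (c j)" .
    qed
    finally show "(\<Sum>i | i < k \<and> i < length mu. mu ! i) \<le> (\<Sum>j<sum_list lam. min k (c j))" by (simp add: n_def)
  qed
qed

section \<open>The coefficient at the shape itself\<close>

abbreviation inj_fillings :: "(nat \<Rightarrow> nat \<Rightarrow> nat) set" where
  "inj_fillings \<equiv> {\<tau> \<in> fillings lam. \<forall>j<n. inj_on (\<tau> j) {..<c j}}"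

text \<open>The equality case of the triangularity estimate: a column with distinct colours has at
  most min(k, c j) of them below k, and for content \<open>lam\<close> these bounds add up to the
  exact total, so each is attained. For k = c j this puts all colours of column j below c j.\<close>

lemma injective_fillings_lam:
  "inj_fillings =
    Pi\<^sub>E {..<n} (\<lambda>j. injs (c j))"
proof (intro equalityI subsetI)
  fix \<tau> assume "\<tau> \<in> inj_fillings"
  then have t: "\<tau> \<in> fillings lam" and inj: "\<And>j. j < n \<Longrightarrow> inj_on (\<tau> j) {..<c j}" by auto
  have ext: "\<tau> \<in> Pi\<^sub>E {..<n} (\<lambda>j. {..<c j} \<rightarrow>\<^sub>E {..<length lam})" using t by (simp add: fillings_def)
  have "\<tau> j i < c j" if "j < n" "i < c j" for j i
  proof -
    let ?k = "c j"
    have sums: "(\<Sum>j'<n. card {i \<in> {..<c j'}. \<tau> j' i < ?k}) = (\<Sum>j'<n. min ?k (c j'))"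
      using fillings_less[OF t conj_part_le_length] sum_min_conj_part[OF partition, of ?k] by (simp add: n_def)
    have "card {i \<in> {..<c j}. \<tau> j i < ?k} = min ?k (c j)"
    proof (rule ccontr)
      assume "card {i \<in> {..<c j}. \<tau> j i < ?k} \<noteq> min ?k (c j)"
      then have "card {i \<in> {..<c j}. \<tau> j i < ?k} < min ?k (c j)"
        using inj_card_less_le[OF inj[OF that(1)], of ?k] by simp
      then have "(\<Sum>j'<n. card {i \<in> {..<c j'}. \<tau> j' i < ?k}) < (\<Sum>j'<n. min ?k (c j'))"
        using that(1) inj_card_less_le[OF inj, of _ ?k] by (intro sum_strict_mono_ex1) auto
      then show False using sums by simp
    qed
    then have "card {i \<in> {..<c j}. \<tau> j i < ?k} = card {..<c j}" by simp
    then have "{i \<in> {..<c j}. \<tau> j i < ?k} = {..<c j}" by (intro card_subset_eq) auto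
    then show ?thesis using that(2) by blast
  qed
  then show "\<tau> \<in> Pi\<^sub>E {..<n} (\<lambda>j. injs (c j))"
    using ext inj by (auto simp: PiE_def Pi_def)
next
  fix \<tau> assume t: "\<tau> \<in> Pi\<^sub>E {..<n} (\<lambda>j. injs (c j))"
  have tj: "\<tau> j \<in> {..<c j} \<rightarrow>\<^sub>E {..<c j}" "inj_on (\<tau> j) {..<c j}" if "j < n" for j using t that by auto
  have le: "c j \<le> length lam" for j by (rule conj_part_le_length)
  have "\<tau> \<in> Pi\<^sub>E {..<n} (\<lambda>j. {..<c j} \<rightarrow>\<^sub>E {..<length lam})"
  proof (rule PiE_I)
    fix j assume j: "j \<in> {..<n}"
    have "({..<c j} \<rightarrow>\<^sub>E {..<c j}) \<subseteq> ({..<c j} \<rightarrow>\<^sub>E {..<length lam})" by (rule PiE_mono) (simp add: le)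
    then show "\<tau> j \<in> {..<c j} \<rightarrow>\<^sub>E {..<length lam}" using tj(1)[of j] j by blast
  qed (use PiE_arb[OF t] in blast)
  moreover have "(\<Sum>j<n. card {i \<in> {..<c j}. \<tau> j i = l}) = lam ! l" if l: "l < length lam" for l
  proof -
    have "card {i \<in> {..<c j}. \<tau> j i = l} = (if l < c j then 1 else 0)" if j: "j < n" for j
    proof (cases "l < c j")
      case True
      have "\<tau> j ` {..<c j} = {..<c j}" using tj[OF j] by (intro endo_inj_surj) auto
      then obtain r where r: "r < c j" "\<tau> j r = l" using True by (metis imageE lessThan_iff)
      then have "{i \<in> {..<c j}. \<tau> j i = l} = {r}" using tj(2)[OF j] by (auto simp: inj_on_def)
      then show ?thesis using True by simp
    next
      case False
      then have "{i \<in> {..<c j}. \<tau> j i = l} = {}" using tj(1)[OF j] by auto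
      then show ?thesis using False by simp
    qed
    then have "(\<Sum>j<n. card {i \<in> {..<c j}. \<tau> j i = l}) = card {j \<in> {..<n}. l < c j}"
      by (simp add: sum.inter_filter[symmetric])
    also have "{j \<in> {..<n}. l < c j} = {..<lam ! l}"
      using l less_c[of l] less_c_n[of l] by auto
    finally show ?thesis by simp
  qed
  ultimately show "\<tau> \<in> inj_fillings"
    using tj(2) by (simp add: fillings_def)
qed

text \<open>On injective fillings the columns are filled independently of each other, so the sum
  factors, and each column gives a squared minor.\<close>

lemma mcoeff_zvec_lam: "mcoeff n (zvec lam) lam = gauss (\<Prod>j<n. minor (c j) id * minor (c j) id)"
proof -
  let ?X = "\<lambda>j t. (\<Prod>i<c j. mvar (i, t i)) * minor (c j) t"
  let ?Q = "\<lambda>j. injs (c j)"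
  have "mcoeff n (zvec lam) lam = (\<Sum>\<tau>\<in>inj_fillings. gauss (\<Prod>j<n. ?X j (\<tau> j)))"
    unfolding mcoeff_zvec
  proof (rule sum.mono_neutral_right[OF finite_fillings])
    show "\<forall>\<tau>\<in>fillings lam - inj_fillings. gauss (\<Prod>j<n. ?X j (\<tau> j)) = 0"
    proof
      fix \<tau> assume "\<tau> \<in> fillings lam - inj_fillings"
      then obtain j where j: "j < n" "\<not> inj_on (\<tau> j) {..<c j}" by blast
      then have z: "?X j (\<tau> j) = 0" by (simp add: minor_not_inj)
      have "(\<Prod>j<n. ?X j (\<tau> j)) = 0"
        by (rule prod_zero, simp, rule bexI[of _ j], rule z, simp add: j(1))
      then show "gauss (\<Prod>j<n. ?X j (\<tau> j)) = 0" by (simp add: gauss_zero)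
    qed
  qed blast
  also have "\<dots> = gauss (\<Sum>\<tau>\<in>Pi\<^sub>E {..<n} ?Q. \<Prod>j<n. ?X j (\<tau> j))"
    unfolding injective_fillings_lam by (simp only: gauss_sum)
  also have "(\<Sum>\<tau>\<in>Pi\<^sub>E {..<n} ?Q. \<Prod>j<n. ?X j (\<tau> j)) = (\<Prod>j<n. \<Sum>t\<in>?Q j. ?X j t)"
    by (rule prod_sum_PiE[symmetric]) (simp_all add: finite_PiE)
  finally show ?thesis by (simp only: sum_inj_minor)
qed

text \<open>The later columns that contain row i form the arm of the box (i, j), and
  \<open>c j - i\<close> is its leg plus one.\<close>

lemma mcoeff_zvec_hook: "mcoeff n (zvec lam) lam = hook2 lam"
proof -
  have "mcoeff n (zvec lam) lam = (\<Prod>j<n. \<Prod>r<c j. real (c j - r + 2 * card {k. j < k \<and> k < n \<and> r < c k}))"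
    unfolding mcoeff_zvec_lam by (rule gauss_prod_minor_sq) (rule conj_part_antimono)
  also have "\<dots> = (\<Prod>j<n. \<Prod>i<c j. real (2 * (lam ! i - j - 1) + (c j - i - 1) + 1))"
  proof (intro prod.cong refl)
    fix j i assume "i \<in> {..<c j}"
    then have i: "i < c j" by simp
    have "{k. j < k \<and> k < n \<and> i < c k} = {j<..<lam ! i}"
      using i less_c[of i] less_c_n[of i] by auto
    then have "card {k. j < k \<and> k < n \<and> i < c k} = lam ! i - j - 1" by simp
    then show "real (c j - i + 2 * card {k. j < k \<and> k < n \<and> i < c k}) = real (2 * (lam ! i - j - 1) + (c j - i - 1) + 1)"
      using i by simp
  qed
  also have "\<dots> = (\<Prod>(j, i)\<in>Sigma {..<n} (\<lambda>j. {..<c j}). real (2 * (lam ! i - j - 1) + (c j - i - 1) + 1))"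
    by (rule prod.Sigma) auto
  also have "\<dots> = hook2 lam"
    unfolding hook2_def
    by (rule prod.reindex_bij_witness[of _ "\<lambda>(i, j). (j, i)" "\<lambda>(j, i). (i, j)"])
      (use less_c less_c_n in \<open>auto\<close>)
  finally show ?thesis .
qed

lemma zonal_zvec: "zonal lam = zvec lam"
proof (rule zonal_eqI[OF partition n_def])
  show "degree_vec n (zvec lam)" unfolding n_def by (rule degree_vec_zvec)
qed (simp_all add: mcoeff_zvec_hook mcoeff_zvec_dominated inner2_zvec_evec)

end

theorem theorem1p2:
  fixes lam :: "nat list"
  assumes "is_partition lam"
  shows "zonal lam = (\<lambda>rho. \<Sum>(S1, S2)\<in>{(S1, S2). admissible lam S1 S2
                                   \<and> loop_type (sum_list lam) S1 S2 = rho}.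
                        loop_sign (sum_list lam) (Sstd (sum_list lam)) S1)"
  using tableau.zonal_zvec[OF tableau.intro[OF assms]] by (simp add: zvec_def fun_eq_iff)

end
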